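(* Let $H$ be a fixed graph. There is a polynomial time approximation scheme for the metric $\rho$-independent set problem in $H$-minor-free graphs under the uniform measure. Specifically, given a weighted $n$-vertex $H$-minor-free graph $G=(V,E,w)$ and parameters $\epsilon\in(0,\frac12)$, $\rho>0$, in $n^{O_{|H|}(\epsilon^{-2})}$ time one can find a $\rho$-independent set $S\subseteq V$ such that for every $\rho$-independent set $\tilde{S}$, $|S|\ge(1-\epsilon)|\tilde{S}|$.
   Context: $d_G$ is the shortest-path metric of $G$. A $\rho$-independent set is a subset $S\subseteq V$ with $d_G(x,y)>\rho$ for all distinct $x,y\in S$. $O_{|H|}(\cdot)$ hides a factor depending only on $|H|$. *)

theory Defs
  imports Graph_Theory.Graph_Theory
begin

section \<open>Weighted minor-free graphs and independent sets\<close>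

text \<open>
  Finite simple undirected graphs are values of type \<^typ>\<open>'a pair_pre_digraph\<close> satisfying
  \<^const>\<open>pair_graph\<close>: an edge between u and v is the pair of arcs (u,v) and (v,u).
  The null graph is admitted.
\<close>

text \<open>H is a minor of G: disjoint connected branch sets, adjacent in G wherever H has an edge.\<close>

definition minor :: "'b pair_pre_digraph \<Rightarrow> 'a pair_pre_digraph \<Rightarrow> bool" where
  "minor H G \<longleftrightarrow> (\<exists>B. (\<forall>x \<in> pverts H. B x \<subseteq> pverts G \<and>
        Digraph_Component.connected (with_proj G \<restriction> B x)) \<and>
      (\<forall>x \<in> pverts H. \<forall>y \<in> pverts H. x \<noteq> y \<longrightarrow> B x \<inter> B y = {}) \<and>
      (\<forall>(x, y) \<in> parcs H. \<exists>u \<in> B x. \<exists>v \<in> B y. (u, v) \<in> parcs G))"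

definition minor_free :: "'b pair_pre_digraph \<Rightarrow> 'a pair_pre_digraph \<Rightarrow> bool" where
  "minor_free H G \<longleftrightarrow> \<not> minor H G"

text \<open>Only the values of the weight function on the arcs of G are constrained (and ever used).\<close>

definition weighted_graph :: "'a pair_pre_digraph \<Rightarrow> ('a \<times> 'a) weight_fun \<Rightarrow> bool" where
  "weighted_graph G w \<longleftrightarrow> pair_graph G \<and>
     (\<forall>(u, v) \<in> parcs G. 0 \<le> w (u, v) \<and> w (u, v) = w (v, u))"

text \<open>The value is infinite for vertices in different components.\<close>

definition graph_dist ::
    "'a pair_pre_digraph \<Rightarrow> ('a \<times> 'a) weight_fun \<Rightarrow> 'a \<Rightarrow> 'a \<Rightarrow> ereal" where
  "graph_dist G w = wf_digraph.\<mu> (with_proj G) w"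

definition metric_independent ::
    "'a pair_pre_digraph \<Rightarrow> ('a \<times> 'a) weight_fun \<Rightarrow> real \<Rightarrow> 'a set \<Rightarrow> bool" where
  "metric_independent G w \<rho> S \<longleftrightarrow> S \<subseteq> pverts G \<and>
     (\<forall>x \<in> S. \<forall>y \<in> S. x \<noteq> y \<longrightarrow> ereal \<rho> < graph_dist G w x y)"


section \<open>Machine model\<close>

text \<open>
  A unit-cost random access machine with exact real weights. It has two sorts of cells, natural
  numbers and reals; for each sort there are registers, named by the program text, and a memory
  addressed through natural-number registers.

  Arithmetic is restricted to addition and subtraction (truncated on naturals), and a program can
  mention only the real constant 1. Unit-cost multiplication of naturals or rounding of reals
  would give the machine unrealistic power, and arbitrary real constants would be nonuniform
  advice. Every program here is also a program of the usual real RAM, with the same running time.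
\<close>

datatype instr =
    NConst nat nat
  | NAdd nat nat nat
  | NSub nat nat nat
  | NLoad nat nat
  | NStore nat nat
  | ROne nat
  | RAdd nat nat nat
  | RSub nat nat nat
  | RLoad nat nat
  | RStore nat nat
  | JumpNLess nat nat nat
  | JumpRLess nat nat nat

type_synonym program = "instr list"

record config =
  pc :: nat
  nreg :: "nat \<Rightarrow> nat"
  rreg :: "nat \<Rightarrow> real"
  nmem :: "nat \<Rightarrow> nat"
  rmem :: "nat \<Rightarrow> real"

text \<open>The program counter has already been advanced when the effect of an instruction is applied.\<close>

fun exec :: "instr \<Rightarrow> config \<Rightarrow> config" where
  "exec (NConst i c) s = s\<lparr>nreg := (nreg s)(i := c)\<rparr>"
| "exec (NAdd i j k) s = s\<lparr>nreg := (nreg s)(i := nreg s j + nreg s k)\<rparr>"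
| "exec (NSub i j k) s = s\<lparr>nreg := (nreg s)(i := nreg s j - nreg s k)\<rparr>"
| "exec (NLoad i j) s = s\<lparr>nreg := (nreg s)(i := nmem s (nreg s j))\<rparr>"
| "exec (NStore i j) s = s\<lparr>nmem := (nmem s)(nreg s i := nreg s j)\<rparr>"
| "exec (ROne i) s = s\<lparr>rreg := (rreg s)(i := 1)\<rparr>"
| "exec (RAdd i j k) s = s\<lparr>rreg := (rreg s)(i := rreg s j + rreg s k)\<rparr>"
| "exec (RSub i j k) s = s\<lparr>rreg := (rreg s)(i := rreg s j - rreg s k)\<rparr>"
| "exec (RLoad i j) s = s\<lparr>rreg := (rreg s)(i := rmem s (nreg s j))\<rparr>"
| "exec (RStore i j) s = s\<lparr>rmem := (rmem s)(nreg s i := rreg s j)\<rparr>"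
| "exec (JumpNLess i j l) s = (if nreg s i < nreg s j then s\<lparr>pc := l\<rparr> else s)"
| "exec (JumpRLess i j l) s = (if rreg s i < rreg s j then s\<lparr>pc := l\<rparr> else s)"

definition halted :: "program \<Rightarrow> config \<Rightarrow> bool" where
  "halted P s \<longleftrightarrow> length P \<le> pc s"

definition step :: "program \<Rightarrow> config \<Rightarrow> config" where
  "step P s = (if halted P s then s else exec (P ! pc s) (s\<lparr>pc := Suc (pc s)\<rparr>))"

text \<open>
  The input graph has vertex set \<^term>\<open>{..<n}\<close>. The number n is in natural register 0, the
  parameters \<^term>\<open>\<epsilon>\<close> and \<^term>\<open>\<rho>\<close> are in real registers 0 and 1, and the memories hold the
  adjacency matrix and the weight matrix in row-major order. All other cells are 0.
\<close>

definition input ::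
    "nat pair_pre_digraph \<Rightarrow> (nat \<times> nat) weight_fun \<Rightarrow> real \<Rightarrow> real \<Rightarrow> config" where
  "input G w \<epsilon> \<rho> = (let n = card (pverts G); arc = (\<lambda>a. (a div n, a mod n)) in
     \<lparr>pc = 0,
      nreg = (\<lambda>_. 0)(0 := n),
      rreg = (\<lambda>_. 0)(0 := \<epsilon>, 1 := \<rho>),
      nmem = (\<lambda>a. if arc a \<in> parcs G then 1 else 0),
      rmem = (\<lambda>a. if arc a \<in> parcs G then w (arc a) else 0)\<rparr>)"

text \<open>The output is read off the first n natural memory cells as a characteristic vector.\<close>

definition output_set :: "nat pair_pre_digraph \<Rightarrow> config \<Rightarrow> nat set" where
  "output_set G s = {v \<in> pverts G. nmem s v \<noteq> 0}"

definition computes_within :: "program \<Rightarrow> nat pair_pre_digraph \<Rightarrow> config \<Rightarrow> real \<Rightarrow> nat set \<Rightarrow> bool"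
  where
  "computes_within P G s T S \<longleftrightarrow> (\<exists>t. real t \<le> T \<and> halted P ((step P ^^ t) s) \<and>
     S = output_set G ((step P ^^ t) s))"

end

theory Submission
  imports Defs
begin

text \<open>
  The algorithm is local search: starting from the empty set, it exchanges at most
  $r = O(1/\<epsilon>^2)$ vertices as long as the set stays independent and grows. To compare a local
  optimum L with an independent set O', assign every vertex to its nearest centre in the symmetric
  difference of L and O'. A shortest path between two conflicting centres stays in their two cells,
  so the conflict graph is a minor of G and excludes a clique minor. The separators of Alon,
  Seymour and Thomas, applied recursively, cover it by pieces of at most r vertices that contain
  every edge and have total size at most $1 + \<epsilon>/2$ times the number of centres. Within each
  piece, local optimality forbids trading the vertices of L for those vertices of O' that lie in no
  other piece; summing over the pieces gives the ratio.

  Swaps are enumerated as numbers below $(n+1)^r$, and distances are needed only up to the cap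
  $\<rho> + 1$. All loops of the program are counted, with bounds in registers that the loops do not
  write, so the running time is a polynomial of fixed degree in the largest bound.
\<close>

section \<open>Separators in graphs without a clique minor\<close>

text \<open>The square in 1/\<epsilon>^2 comes from the separators: dividing a graph on N vertices
  into pieces of size r duplicates about N / sqrt r vertices, up to a factor depending on the
  excluded clique, and this has to stay below a fixed fraction of \<epsilon> * N. Vertices common to
  L and O' are far from all other centres. They are set aside for the division and restored
  afterwards on both sides of the inequality. Two conflicting centres belong to different sets, so a
  third centre shares a set with one of them and is farther than \<rho> from it. A vertex of a
  shortest path between the two that preferred the third centre would bring it within \<rho> of
  both. This is why two cells suffice for each conflict. The size r depends on \<epsilon>, which is
  known only at run time. The program text therefore contains one constant determined by the order
  of H, and the machine derives r and the number of swaps from it. Without multiplication and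
  division, all of this arithmetic is counted addition and subtraction.\<close>

definition conn :: "'a rel \<Rightarrow> 'a set \<Rightarrow> bool" where
  "conn E T \<longleftrightarrow> T \<noteq> {} \<and> (\<forall>u\<in>T. \<forall>v\<in>T. (u, v) \<in> (E \<inter> T \<times> T)\<^sup>*)"

lemma conn_singleton: "conn E {v}"
  by (simp add: conn_def)

lemma connI_root:
  assumes "sym E" "r \<in> T" "\<And>v. v \<in> T \<Longrightarrow> (r, v) \<in> (E \<inter> T \<times> T)\<^sup>*"
  shows "conn E T"
proof -
  have s: "sym ((E \<inter> T \<times> T)\<^sup>*)"
    using assms(1) by (intro sym_rtrancl) (auto simp: sym_def)
  show ?thesis
    unfolding conn_def
    using assms(2,3) s by (meson empty_iff rtrancl_trans symD)
qed

lemma conn_insert: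
  assumes "sym E" "conn E T" "u \<in> T" "(u, v) \<in> E"
  shows "conn E (insert v T)"
proof (rule connI_root[OF assms(1), of u])
  show "u \<in> insert v T" using assms(3) by simp
next
  fix x assume x: "x \<in> insert v T"
  have sub: "(E \<inter> T \<times> T)\<^sup>* \<subseteq> (E \<inter> insert v T \<times> insert v T)\<^sup>*"
    by (intro rtrancl_mono) auto
  show "(u, x) \<in> (E \<inter> insert v T \<times> insert v T)\<^sup>*"
  proof (cases "x = v")
    case True
    then show ?thesis using assms(3,4) by (intro r_into_rtrancl) auto
  next
    case False
    then show ?thesis using x assms(2,3) sub by (auto simp: conn_def)
  qed
qed

text \<open>The form in which connectivity is used throughout: a property that passes along edges
  inside \<open>D\<close> spreads from one vertex to all of \<open>D\<close>.\<close>

lemma conn_propagate: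
  assumes "conn E D" "a \<in> D" "P a"
    and "\<And>u v. u \<in> D \<Longrightarrow> v \<in> D \<Longrightarrow> (u, v) \<in> E \<Longrightarrow> P u \<Longrightarrow> P v"
    and "x \<in> D"
  shows "P x"
proof -
  have "(a, x) \<in> (E \<inter> D \<times> D)\<^sup>*" using assms by (auto simp: conn_def)
  then show ?thesis
    by (induction rule: rtrancl_induct) (use assms in auto)
qed

text \<open>Breadth-first layers on pairs (v, i), where i counts the sets A 0, A 1, \<dots> that the
  walk has visited in this order.\<close>

primrec layers :: "'a rel \<Rightarrow> 'a set \<Rightarrow> (nat \<Rightarrow> 'a set) \<Rightarrow> nat \<Rightarrow> nat \<Rightarrow> ('a \<times> nat) set" where
  "layers E B A t 0 = B \<times> {0}"
| "layers E B A t (Suc j) = layers E B A t j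
     \<union> {(v, i). v \<in> B \<and> (\<exists>u. (u, i) \<in> layers E B A t j \<and> (u, v) \<in> E)}
     \<union> {(v, Suc i) | v i. (v, i) \<in> layers E B A t j \<and> i < t \<and> v \<in> A i}"

lemma layers_edge:
  "(u, i) \<in> layers E B A t j \<Longrightarrow> (u, v) \<in> E \<Longrightarrow> v \<in> B \<Longrightarrow> (v, i) \<in> layers E B A t (Suc j)"
  by auto

lemma layers_subset: "layers E B A t j \<subseteq> B \<times> {..t}"
  by (induction j) auto

lemma layers_mono: "j \<le> j' \<Longrightarrow> layers E B A t j \<subseteq> layers E B A t j'"
  by (rule lift_Suc_mono_le[of "layers E B A t"]) auto

text \<open>A walk step adds the new vertex to the tree. A step that only raises the counter adds
  nothing, because \<open>v\<close> itself witnesses that the tree meets \<open>A i\<close>. Hence j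
  steps give at most j + 1 vertices.\<close>

lemma layers_tree:
  assumes "sym E" "finite B"
  shows "(v, i) \<in> layers E B A t j \<Longrightarrow>
    \<exists>T. conn E T \<and> T \<subseteq> B \<and> v \<in> T \<and> card T \<le> Suc j \<and> (\<forall>l<i. T \<inter> A l \<noteq> {})"
proof (induction j arbitrary: v i)
  case 0
  then show ?case by (intro exI[of _ "{v}"]) (auto simp: conn_singleton)
next
  case (Suc j)
  then consider "(v, i) \<in> layers E B A t j"
    | u where "v \<in> B" "(u, i) \<in> layers E B A t j" "(u, v) \<in> E"
    | l where "i = Suc l" "(v, l) \<in> layers E B A t j" "v \<in> A l"
    by auto
  then show ?case
  proof cases
    case 1
    then show ?thesis using Suc.IH[of v i] by (meson le_SucI)
  next
    case 2
    then obtain T where T: "conn E T" "T \<subseteq> B" "u \<in> T" "card T \<le> Suc j" "\<forall>l<i. T \<inter> A l \<noteq> {}"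
      using Suc.IH[of u i] by auto
    have "card (insert v T) \<le> Suc (Suc j)"
      using T(2,4) assms(2) finite_subset[OF T(2)] by (simp add: card_insert_if)
    then show ?thesis
      using T 2 conn_insert[OF assms(1) T(1,3) 2(3)] by (intro exI[of _ "insert v T"]) auto
  next
    case 3
    then obtain T where T: "conn E T" "T \<subseteq> B" "v \<in> T" "card T \<le> Suc j" "\<forall>l'<l. T \<inter> A l' \<noteq> {}"
      using Suc.IH[of v l] by auto
    then show ?thesis
      using 3 by (intro exI[of _ T]) (auto simp: less_Suc_eq)
  qed
qed

text \<open>The sets of newcomers are pairwise disjoint inside \<open>U\<close>, so the smallest of
  the first m of them is at most the average.\<close>

lemma small_layer:
  fixes R :: "nat \<Rightarrow> 'b set"
  assumes "\<And>j. R j \<subseteq> R (Suc j)" "\<And>j. R j \<subseteq> U" "finite U" "0 < m"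
  shows "\<exists>j<m. m * card (R j - (\<Union>l<j. R l)) \<le> card U"
proof (rule ccontr)
  define L where "L j = R j - (\<Union>l<j. R l)" for j
  assume "\<not> ?thesis"
  then have gt: "\<And>j. j < m \<Longrightarrow> card U < m * card (L j)" by (auto simp: L_def not_le)
  have LU: "L j \<subseteq> U" for j using assms(2) by (auto simp: L_def)
  have disj_less: "L i \<inter> L j = {}" if "i < j" for i j using that by (auto simp: L_def)
  have disj: "L i \<inter> L j = {}" if "i \<noteq> j" for i j
    using disj_less[of i j] disj_less[of j i] that by (cases i j rule: linorder_cases) auto
  have finL: "finite (L j)" for j using LU assms(3) by (rule finite_subset)
  have "m * card U = (\<Sum>j<m. card U)" by simp
  also have "\<dots> < (\<Sum>j<m. m * card (L j))"
    using gt assms(4) by (intro sum_strict_mono) auto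
  also have "\<dots> = m * (\<Sum>j<m. card (L j))" by (simp add: sum_distrib_left)
  also have "(\<Sum>j<m. card (L j)) = card (\<Union>j<m. L j)"
    using disj finL by (subst card_UN_disjoint) auto
  also have "\<dots> \<le> card U" using LU assms(3) by (intro card_mono) auto
  finally show False using assms(4) by simp
qed

text \<open>If the counter reaches t within m - 1 steps, the trail of the walk is the tree.
  Otherwise a thin layer among the first m, projected to \<open>B\<close>, is the cut. The factor
  \<open>Suc t\<close> counts the copies of \<open>B\<close>, one for each counter value.\<close>

lemma tree_or_cut:
  assumes "sym E" "finite B" "0 < m"
  shows "(\<exists>T. conn E T \<and> T \<subseteq> B \<and> card T \<le> m \<and> (\<forall>l<t. T \<inter> A l \<noteq> {})) \<or>
    (\<exists>Z \<subseteq> B. m * card Z \<le> Suc t * card B \<and>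
      (\<forall>D. conn E D \<longrightarrow> D \<subseteq> B - Z \<longrightarrow> (\<exists>l<t. D \<inter> A l = {})))"
proof (cases "\<exists>v. (v, t) \<in> layers E B A t (m - 1)")
  case True
  then obtain v where "(v, t) \<in> layers E B A t (m - 1)" by blast
  from layers_tree[OF assms(1,2) this] show ?thesis using assms(3) by auto
next
  case False
  let ?R = "layers E B A t"
  obtain j where j: "j < m" "m * card (?R j - (\<Union>l<j. ?R l)) \<le> card (B \<times> {..t})"
  proof -
    have "\<exists>j<m. m * card (?R j - (\<Union>l<j. ?R l)) \<le> card (B \<times> {..t})"
      by (rule small_layer[OF layers_mono layers_subset]) (use assms(2,3) in auto)
    then show ?thesis using that by blast
  qed
  define L where "L = ?R j - (\<Union>l<j. ?R l)"
  define Z where "Z = fst ` L"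
  have Lfin: "finite L" using layers_subset[of E B A t j] assms(2)
    unfolding L_def by (meson finite_Diff finite_SigmaI finite_atMost finite_subset)
  have ZB: "Z \<subseteq> B" using layers_subset[of E B A t j] by (auto simp: Z_def L_def)
  have "m * card Z \<le> m * card L" unfolding Z_def using Lfin by (simp add: card_image_le)
  also have "\<dots> \<le> Suc t * card B" using j(2) by (simp add: L_def card_cartesian_product mult.commute)
  finally have Zc: "m * card Z \<le> Suc t * card B" .
  have "\<exists>l<t. D \<inter> A l = {}" if D: "conn E D" "D \<subseteq> B - Z" for D
  proof (rule ccontr)
    assume "\<not> ?thesis"
    then have hit: "\<And>l. l < t \<Longrightarrow> D \<inter> A l \<noteq> {}" by auto
    have notL: "(v, i) \<notin> L" if "v \<in> D" for v i using that D(2) by (force simp: Z_def)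
    obtain a where a: "a \<in> D" using D(1) by (auto simp: conn_def)
    \<comment> \<open>Layer 0 projects onto all of \<open>B\<close> and would leave no room for
      \<open>D\<close>.\<close>
    have j0: "0 < j"
    proof (rule ccontr)
      assume "\<not> 0 < j"
      then have "(a, 0) \<in> L" using a D(2) by (auto simp: L_def)
      then show False using notL a by blast
    qed
    then obtain j' where j': "j = Suc j'" using gr0_conv_Suc by blast
    have un: "(\<Union>l<j. ?R l) = ?R j'"
      using layers_mono[of _ j' E B A t] unfolding j' by (fastforce simp: less_Suc_eq_le)
    \<comment> \<open>Since \<open>D\<close> avoids the projected layer, nothing over
      \<open>D\<close> is new in \<open>?R j\<close>. So over \<open>D\<close> the set
      \<open>?R j'\<close> is closed under both kinds of moves, and the counter climbs up to
      t.\<close>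
    have stay: "(v, i) \<in> ?R j'" if "(v, i) \<in> ?R j" "v \<in> D" for v i
      using that notL un by (auto simp: L_def)
    have "D \<times> {i} \<subseteq> ?R j'" if "i \<le> t" for i using that
    proof (induction i)
      case 0
      have "D \<times> {0} \<subseteq> ?R 0" using D(2) by auto
      then show ?case using layers_mono[of 0 j' E B A t] by blast
    next
      case (Suc i)
      then obtain b where b: "b \<in> D" "b \<in> A i" "(b, i) \<in> ?R j'" using hit[of i] by auto
      then have bS: "(b, Suc i) \<in> ?R j'"
        using Suc.prems by (intro stay) (auto simp: j')
      have "(x, Suc i) \<in> ?R j'" if "x \<in> D" for x
      proof (rule conn_propagate[OF D(1) b(1), of "\<lambda>x. (x, Suc i) \<in> ?R j'"])
        fix u v assume *: "u \<in> D" "v \<in> D" "(u, v) \<in> E" "(u, Suc i) \<in> ?R j'"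
        then have "(v, Suc i) \<in> ?R j" unfolding j' using D(2) by (intro layers_edge[of u]) auto
        then show "(v, Suc i) \<in> ?R j'" using *(2) by (rule stay)
      qed (use bS that in auto)
      then show ?case by auto
    qed
    then have "(a, t) \<in> ?R j'" using a by auto
    then have "(a, t) \<in> ?R (m - 1)" using layers_mono[of j' "m - 1" E B A t] j(1) j' by fastforce
    then show False using False by blast
  qed
  then show ?thesis using ZB Zc by blast
qed


section \<open>Clique models and havens\<close>

lemma conn_grow:
  fixes D
  assumes "sym E" "conn E C"
  defines "K \<equiv> {v. \<exists>a \<in> E `` C \<inter> D. (a, v) \<in> (E \<inter> D \<times> D)\<^sup>*}"
  shows "conn E (C \<union> K)"
proof -
  obtain r where r: "r \<in> C" using assms(2) by (auto simp: conn_def)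
  let ?R = "E \<inter> (C \<union> K) \<times> (C \<union> K)"
  have inC: "(r, v) \<in> ?R\<^sup>*" if "v \<in> C" for v
  proof -
    have "(r, v) \<in> (E \<inter> C \<times> C)\<^sup>*" using assms(2) r that by (auto simp: conn_def)
    moreover have "(E \<inter> C \<times> C)\<^sup>* \<subseteq> ?R\<^sup>*" by (intro rtrancl_mono) auto
    ultimately show ?thesis by blast
  qed
  have inK: "(r, v) \<in> ?R\<^sup>*" if "v \<in> K" for v
  proof -
    obtain a c where a: "c \<in> C" "(c, a) \<in> E" "a \<in> D" "(a, v) \<in> (E \<inter> D \<times> D)\<^sup>*"
      using \<open>v \<in> K\<close> unfolding K_def by blast
    from a(4) have "v \<in> K \<and> (r, v) \<in> ?R\<^sup>*"
    proof (induction rule: rtrancl_induct)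
      case base
      have "a \<in> K" using a by (auto simp: K_def)
      moreover have "(c, a) \<in> ?R" using a \<open>a \<in> K\<close> by auto
      ultimately show ?case using inC[OF a(1)] by (meson rtrancl.rtrancl_into_rtrancl)
    next
      case (step y z)
      have "z \<in> K" using a step.hyps by (auto simp: K_def intro: rtrancl_into_rtrancl)
      then show ?case using step by (auto intro: rtrancl_into_rtrancl)
    qed
    then show ?thesis by blast
  qed
  show ?thesis
    by (rule connI_root[OF assms(1), of r]) (use r inC inK in auto)
qed

text \<open>Index sets are arbitrary finite sets because branch sets are discarded and added during
  the haven argument. Plain relations are used because models are transported from the conflict
  relation of centres to the arcs of G.\<close>

definition clique_model :: "'a rel \<Rightarrow> nat set \<Rightarrow> (nat \<Rightarrow> 'a set) \<Rightarrow> bool" where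
  "clique_model E I C \<longleftrightarrow> finite I \<and> (\<forall>i\<in>I. conn E (C i)) \<and>
     (\<forall>i\<in>I. \<forall>j\<in>I. i \<noteq> j \<longrightarrow> C i \<inter> C j = {} \<and> (\<exists>u\<in>C i. \<exists>v\<in>C j. (u, v) \<in> E))"

definition clique_minor_free :: "'a rel \<Rightarrow> 'a set \<Rightarrow> nat \<Rightarrow> bool" where
  "clique_minor_free E V h \<longleftrightarrow>
     \<not> (\<exists>I C. clique_model E I C \<and> card I = h \<and> (\<forall>i\<in>I. C i \<subseteq> V))"

lemma clique_minor_free_subset:
  "clique_minor_free E V h \<Longrightarrow> W \<subseteq> V \<Longrightarrow> clique_minor_free E W h"
  unfolding clique_minor_free_def by (fast dest: subset_trans)

text \<open>A connected set that meets \<open>B\<close> can leave it only through the boundary of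
  \<open>B\<close>, which \<open>Y\<close> covers and \<open>D\<close> avoids. This is what nests
  each new haven set in the previous one.\<close>

lemma conn_trapped:
  assumes "conn E D" "D \<inter> B \<noteq> {}" "D \<subseteq> V - Y" "E `` B \<inter> V \<subseteq> B \<union> Y"
  shows "D \<subseteq> B"
proof
  fix x assume x: "x \<in> D"
  obtain a where "a \<in> D" "a \<in> B" using assms(2) by blast
  from conn_propagate[OF assms(1) this(1), of "\<lambda>x. x \<in> B", OF this(2) _ x]
  show "x \<in> B" using assms(3,4) by blast
qed

lemma intersect_if_large:
  assumes "finite V" "A \<subseteq> V" "B \<subseteq> V" "2 * card V < 3 * card A" "2 * card V < 3 * card B"
  shows "A \<inter> B \<noteq> {}"
proof
  assume "A \<inter> B = {}"
  then have "card A + card B = card (A \<union> B)"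
    using assms finite_subset by (metis card_Un_disjoint)
  also have "\<dots> \<le> card V" using assms by (intro card_mono) auto
  finally show False using assms(4,5) by linarith
qed

lemma card_UN_le_mult:
  assumes "finite I" "\<And>i. i \<in> I \<Longrightarrow> card (X i) \<le> (m::nat)"
  shows "card (\<Union>(X ` I)) \<le> card I * m"
  using card_UN_le[OF assms(1), of X] sum_bounded_above[of I "\<lambda>i. card (X i)" m] assms(2)
  by fastforce

text \<open>
  The neighbourhood of the large set B is contained in the union of the X i. Either a small connected
  set inside B touches all branch sets C i and becomes a new one, or a small cut Z allows one C i
  to absorb a part of B, whereupon Z replaces X i. In both cases B shrinks.
\<close>

lemma no_haven:
  fixes V :: "'a set"
  assumes E: "sym E" and V: "finite V" and free: "clique_minor_free E V h"
    and m: "0 < m" "h * card V \<le> m * m"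
    and haven: "\<And>X. X \<subseteq> V \<Longrightarrow> card X \<le> h * m \<Longrightarrow>
      \<exists>B. conn E B \<and> B \<subseteq> V - X \<and> E `` B \<inter> V \<subseteq> B \<union> X \<and> 2 * card V < 3 * card B"
  shows "clique_model E I C \<Longrightarrow> card I < h \<Longrightarrow>
    (\<forall>i\<in>I. C i \<subseteq> V \<and> X i \<subseteq> C i \<and> card (X i) \<le> m \<and> C i \<inter> B = {}) \<Longrightarrow>
    B \<subseteq> V \<Longrightarrow> E `` B \<inter> V \<subseteq> B \<union> \<Union>(X ` I) \<Longrightarrow> 2 * card V < 3 * card B \<Longrightarrow> False"
\<comment> \<open>Discarding a branch set lowers the second term. The other two moves shrink
  \<open>B\<close>, and the weight \<open>Suc h\<close> outweighs the one branch set that may be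
  added.\<close>
proof (induction "Suc h * card B + card I" arbitrary: I C X B rule: less_induct)
  case less
  note CM = less.prems(1) and cI = less.prems(2) and CX = less.prems(3) and BV = less.prems(4)
    and NB = less.prems(5) and big = less.prems(6)
  have finI: "finite I" and connC: "\<And>i. i \<in> I \<Longrightarrow> conn E (C i)"
    and disjC: "\<And>i j. i \<in> I \<Longrightarrow> j \<in> I \<Longrightarrow> i \<noteq> j \<Longrightarrow> C i \<inter> C j = {}"
    and adjC: "\<And>i j. i \<in> I \<Longrightarrow> j \<in> I \<Longrightarrow> i \<noteq> j \<Longrightarrow> \<exists>u\<in>C i. \<exists>v\<in>C j. (u, v) \<in> E"
    using CM unfolding clique_model_def by blast+
  have symE: "(x, y) \<in> E \<Longrightarrow> (y, x) \<in> E" for x y using E by (rule symD)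
  have finB: "finite B" using BV V by (rule finite_subset)
  define t where "t = card I"
  have cardX: "card (\<Union>(X ` I)) \<le> t * m"
    unfolding t_def by (rule card_UN_le_mult) (use finI CX in auto)
  have XV: "\<Union>(X ` I) \<subseteq> V" using CX by blast
  show False
  proof (cases "\<exists>i\<in>I. E `` C i \<inter> B = {}")
    case True
    then obtain i where i: "i \<in> I" "E `` C i \<inter> B = {}" by blast
    have N: "E `` B \<inter> V \<subseteq> B \<union> \<Union>(X ` (I - {i}))"
    proof
      fix x assume x: "x \<in> E `` B \<inter> V"
      then obtain b where b: "b \<in> B" "(b, x) \<in> E" by blast
      show "x \<in> B \<union> \<Union>(X ` (I - {i}))"
      proof (cases "x \<in> B")
        case False
        then obtain j where j: "j \<in> I" "x \<in> X j" using x NB by blast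
        have "j \<noteq> i" using j b i CX symE by blast
        then show ?thesis using j by blast
      qed simp
    qed
    have "card (I - {i}) < card I" using i finI by (meson card_Diff1_less)
    moreover have "clique_model E (I - {i}) C" using CM unfolding clique_model_def by blast
    ultimately show False
      using less.hyps[of B "I - {i}" C X] cI CX BV N big by auto
  next
    case False
    then have hit: "\<And>i. i \<in> I \<Longrightarrow> E `` C i \<inter> B \<noteq> {}" by blast
    obtain f where f: "bij_betw f {..<t} I"
      using ex_bij_betw_nat_finite[OF finI] by (auto simp: t_def atLeast0LessThan)
    have all_f: "(\<forall>l<t. P (f l)) \<longleftrightarrow> (\<forall>i\<in>I. P i)" for P
      using f by (auto simp: bij_betw_def)
    have ex_f: "(\<exists>l<t. P (f l)) \<longleftrightarrow> (\<exists>i\<in>I. P i)" for P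
      using all_f[of "\<lambda>i. \<not> P i"] by blast
    consider
      T where "conn E T" "T \<subseteq> B" "card T \<le> m" "\<forall>i\<in>I. T \<inter> (E `` C i \<inter> B) \<noteq> {}"
    | Z where "Z \<subseteq> B" "m * card Z \<le> Suc t * card B"
        "\<And>D. conn E D \<Longrightarrow> D \<subseteq> B - Z \<Longrightarrow> \<exists>i\<in>I. D \<inter> (E `` C i \<inter> B) = {}"
      using tree_or_cut[OF E finB m(1), of t "\<lambda>l. E `` C (f l) \<inter> B"]
        all_f[of "\<lambda>i. _ \<inter> (E `` C i \<inter> B) \<noteq> {}"] ex_f[of "\<lambda>i. _ \<inter> (E `` C i \<inter> B) = {}"]
      by auto
    then show False
    proof cases
      case 1
      obtain j where j: "j \<notin> I" using ex_new_if_finite[OF infinite_UNIV_nat finI] by blast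
      define I' where "I' = insert j I"
      define C' where "C' = C(j := T)"
      define X' where "X' = X(j := T)"
      have Tne: "T \<noteq> {}" using 1(1) by (auto simp: conn_def)
      have CM': "clique_model E I' C'"
        unfolding clique_model_def
      proof (intro conjI ballI impI)
        show "finite I'" using finI by (simp add: I'_def)
      next
        fix i assume "i \<in> I'"
        then show "conn E (C' i)" using connC 1(1) by (auto simp: I'_def C'_def)
      next
        fix i l assume "i \<in> I'" "l \<in> I'" "i \<noteq> l"
        then show "C' i \<inter> C' l = {}"
          using disjC CX 1(2) unfolding I'_def C'_def by (auto split: if_splits) blast+
      next
        fix i l assume il: "i \<in> I'" "l \<in> I'" "i \<noteq> l"
        have TC: "\<exists>u\<in>C i. \<exists>v\<in>T. (u, v) \<in> E" if "i \<in> I" for i using 1(4) that by blast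
        consider "i \<in> I" "l \<in> I" | "i = j" "l \<in> I" | "l = j" "i \<in> I" using il I'_def by blast
        then show "\<exists>u\<in>C' i. \<exists>v\<in>C' l. (u, v) \<in> E"
        proof cases
          case 1
          then have "i \<noteq> j" "l \<noteq> j" using j by auto
          then show ?thesis using adjC[OF 1 il(3)] by (simp add: C'_def)
        next
          case 2
          then have "l \<noteq> j" using j by auto
          then show ?thesis using 2 TC[OF 2(2)] symE by (auto simp: C'_def)
        next
          case 3
          then have "i \<noteq> j" using j by auto
          then show ?thesis using 3 TC[OF 3(2)] by (auto simp: C'_def)
        qed
      qed
      have C'V: "\<forall>i\<in>I'. C' i \<subseteq> V" using CX 1(2) BV by (auto simp: I'_def C'_def)
      have cI': "card I' = Suc t" using finI j by (simp add: I'_def t_def)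
      \<comment> \<open>The new model lies in \<open>V\<close>, so h branch sets would be the
        excluded clique minor. There is still room for the induction.\<close>
      have "card I' \<noteq> h"
        using free CM' C'V unfolding clique_minor_free_def by blast
      then have cI'h: "card I' < h" using cI cI' t_def by linarith
      define Y where "Y = \<Union>(X' ` I')"
      have X'm: "\<And>i. i \<in> I' \<Longrightarrow> card (X' i) \<le> m" using CX 1(3) by (auto simp: I'_def X'_def)
      have "card Y \<le> card I' * m"
        unfolding Y_def by (rule card_UN_le_mult) (use finI X'm in \<open>auto simp: I'_def\<close>)
      also have "\<dots> \<le> h * m" using cI'h by simp
      finally have cY: "card Y \<le> h * m" .
      have X'C': "\<forall>i\<in>I'. X' i \<subseteq> C' i" using CX by (auto simp: I'_def X'_def C'_def)
      have YV: "Y \<subseteq> V" using C'V X'C' unfolding Y_def by blast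
      have YX: "\<Union>(X ` I) \<union> T \<subseteq> Y" using j by (auto simp: Y_def I'_def X'_def)
      obtain B' where B': "conn E B'" "B' \<subseteq> V - Y" "E `` B' \<inter> V \<subseteq> B' \<union> Y"
        "2 * card V < 3 * card B'" using haven[OF YV cY] by blast
      \<comment> \<open>Two sets with more than two thirds of \<open>V\<close> each must meet, and
        \<open>Y\<close> contains the boundary of \<open>B\<close>.\<close>
      have "B' \<subseteq> B"
        by (rule conn_trapped[OF B'(1), of B V Y])
          (use intersect_if_large[OF V _ BV B'(4) big] B'(2) NB YX in blast)+
      moreover have "T \<inter> B' = {}" using B'(2) YX by blast
      ultimately have "B' \<subset> B" using Tne 1(2) by blast
      then have "card B' < card B" using finB by (rule psubset_card_mono[rotated])
      then have "Suc h * card B' + card I' < Suc h * card B + card I"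
      proof -
        have "Suc h * Suc (card B') \<le> Suc h * card B"
          using \<open>card B' < card B\<close> by (intro mult_le_mono2) simp
        then show ?thesis using cI' cI t_def by simp
      qed
      moreover have "\<forall>i\<in>I'. C' i \<subseteq> V \<and> X' i \<subseteq> C' i \<and> card (X' i) \<le> m \<and> C' i \<inter> B' = {}"
      proof (intro ballI conjI)
        fix i assume i: "i \<in> I'"
        show "C' i \<inter> B' = {}"
        proof (cases "i = j")
          case False
          then have "C i \<inter> B = {}" using i CX by (simp add: I'_def)
          then show ?thesis using False \<open>B' \<subseteq> B\<close> by (auto simp: C'_def)
        qed (use \<open>T \<inter> B' = {}\<close> in \<open>simp add: C'_def\<close>)
      qed (use C'V X'C' X'm in auto)
      ultimately show False
        using less.hyps[of B' I' C' X'] CM' cI'h B' Y_def by blast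
    next
      case 2
      \<comment> \<open>The hypothesis on \<open>m\<close> makes the cut as small as a single
        \<open>X i\<close>, so \<open>Z\<close> can take the place of one of them.\<close>
      have "m * card Z \<le> h * card V"
      proof -
        have "Suc t * card B \<le> h * card V"
          using cI t_def card_mono[OF V BV] by (intro mult_le_mono) auto
        then show ?thesis using 2(2) by linarith
      qed
      then have "m * card Z \<le> m * m" using m(2) by linarith
      then have cZ: "card Z \<le> m" using m(1) by simp
      define Y where "Y = \<Union>(X ` I) \<union> Z"
      have YV: "Y \<subseteq> V" using XV 2(1) BV by (auto simp: Y_def)
      have "card Y \<le> t * m + m"
        unfolding Y_def using card_Un_le[of "\<Union>(X ` I)" Z] cardX cZ by linarith
      also have "\<dots> = Suc t * m" by simp
      also have "\<dots> \<le> h * m" using cI t_def by (intro mult_le_mono1) auto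
      finally have cY: "card Y \<le> h * m" .
      obtain B' where B': "conn E B'" "B' \<subseteq> V - Y" "E `` B' \<inter> V \<subseteq> B' \<union> Y"
        "2 * card V < 3 * card B'" using haven[OF YV cY] by blast
      have B'B: "B' \<subseteq> B"
        by (rule conn_trapped[OF B'(1), of B V Y])
          (use intersect_if_large[OF V _ BV B'(4) big] B'(2) NB in \<open>auto simp: Y_def\<close>)
      then have "B' \<subseteq> B - Z" using B'(2) by (auto simp: Y_def)
      then obtain i where i: "i \<in> I" "B' \<inter> (E `` C i \<inter> B) = {}" using 2(3)[OF B'(1)] by blast
      \<comment> \<open>The branch set \<open>C i\<close> absorbs everything that it reaches inside
        \<open>D\<close>. It cannot touch \<open>B'\<close>, since its neighbours in
        \<open>B\<close> all lie in \<open>D\<close>.\<close>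
      define D where "D = B - B'"
      define K where "K = {v. \<exists>a \<in> E `` C i \<inter> D. (a, v) \<in> (E \<inter> D \<times> D)\<^sup>*}"
      have AK: "E `` C i \<inter> B \<subseteq> K" using i(2) by (auto simp: K_def D_def)
      have KD: "K \<subseteq> D"
      proof
        fix v assume "v \<in> K"
        then obtain a where "a \<in> D" "(a, v) \<in> (E \<inter> D \<times> D)\<^sup>*" by (auto simp: K_def)
        then show "v \<in> D" by (metis IntD2 SigmaD2 rtranclE)
      qed
      have Kclosed: "y \<in> K" if "x \<in> K" "y \<in> D" "(x, y) \<in> E" for x y
      proof -
        have "(x, y) \<in> E \<inter> D \<times> D" using that KD by blast
        moreover obtain a where "a \<in> E `` C i \<inter> D" "(a, x) \<in> (E \<inter> D \<times> D)\<^sup>*"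
          using \<open>x \<in> K\<close> unfolding K_def by blast
        ultimately have "(a, y) \<in> (E \<inter> D \<times> D)\<^sup>*" by (simp add: rtrancl_into_rtrancl)
        then show ?thesis using \<open>a \<in> E `` C i \<inter> D\<close> unfolding K_def by blast
      qed
      define C' where "C' = C(i := C i \<union> K)"
      \<comment> \<open>The old \<open>X i\<close> may be forgotten: all neighbours of
        \<open>C i\<close> in \<open>B\<close> are swallowed by \<open>K\<close>, so it has none in
        \<open>B - K\<close>.\<close>
      define X' where "X' = X(i := Z \<inter> K)"
      define B'' where "B'' = B - K"
      have CC': "C l \<subseteq> C' l" for l by (auto simp: C'_def)
      have C'C: "C' l \<subseteq> C l \<union> K" for l by (auto simp: C'_def)
      have CK: "C l \<inter> K = {}" if "l \<in> I" for l
      proof -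
        have "C l \<inter> B = {}" using CX that by blast
        then show ?thesis using KD by (auto simp: D_def)
      qed
      have CM': "clique_model E I C'"
        unfolding clique_model_def
      proof (intro conjI ballI impI)
        fix l assume l: "l \<in> I"
        show "conn E (C' l)"
        proof (cases "l = i")
          case True
          then show ?thesis using conn_grow[OF E connC[OF i(1)], of D] by (simp add: C'_def K_def)
        qed (use connC l in \<open>simp add: C'_def\<close>)
      next
        fix k l assume kl: "k \<in> I" "l \<in> I" "k \<noteq> l"
        show "C' k \<inter> C' l = {}"
          using disjC[OF kl] CK[OF kl(1)] CK[OF kl(2)] kl(3) by (auto simp: C'_def)
        show "\<exists>u\<in>C' k. \<exists>v\<in>C' l. (u, v) \<in> E"
          using adjC[OF kl] CC' by blast
      qed (rule finI)
      have inv: "\<forall>l\<in>I. C' l \<subseteq> V \<and> X' l \<subseteq> C' l \<and> card (X' l) \<le> m \<and> C' l \<inter> B'' = {}"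
      proof (intro ballI conjI)
        fix l assume l: "l \<in> I"
        show "C' l \<subseteq> V" using C'C[of l] bspec[OF CX l] KD BV by (auto simp: D_def)
        show "X' l \<subseteq> C' l" using CX l by (auto simp: X'_def C'_def)
        have "card (Z \<inter> K) \<le> card Z" using 2(1) finB by (meson card_mono finite_subset inf_le1)
        then show "card (X' l) \<le> m" using CX l cZ by (auto simp: X'_def)
        show "C' l \<inter> B'' = {}" using CX l by (auto simp: C'_def B''_def)
      qed
      have N: "E `` B'' \<inter> V \<subseteq> B'' \<union> \<Union>(X' ` I)"
      proof
        fix x assume "x \<in> E `` B'' \<inter> V"
        then obtain b where b: "b \<in> B''" "(b, x) \<in> E" "x \<in> V" by blast
        show "x \<in> B'' \<union> \<Union>(X' ` I)"
        proof (cases "x \<in> B''")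
          case xB'': False
          show ?thesis
          proof (cases "x \<in> B")
            case True
            then have xK: "x \<in> K" using xB'' by (simp add: B''_def)
            \<comment> \<open>A neighbour of \<open>K\<close> in \<open>D\<close> would belong to
              \<open>K\<close>. So \<open>b\<close> lies in \<open>B'\<close>, whose boundary is
              covered by \<open>Y\<close>, and this forces \<open>x\<close> into
              \<open>Z\<close>.\<close>
            have "b \<in> B'"
            proof (rule ccontr)
              assume "b \<notin> B'"
              then have "b \<in> D" using b(1) by (simp add: D_def B''_def)
              then show False using Kclosed[OF xK _ symE[OF b(2)]] b(1) by (simp add: B''_def)
            qed
            then have "x \<in> B' \<union> Y" using b B'(3) by blast
            moreover have "x \<notin> B'" using xK KD by (auto simp: D_def)
            moreover have "x \<notin> \<Union>(X ` I)" using True CX by blast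
            ultimately have "x \<in> Z \<inter> K" using xK by (simp add: Y_def)
            then show ?thesis using i(1) by (auto simp: X'_def)
          next
            case False
            then obtain j where j: "j \<in> I" "x \<in> X j" using NB b by (auto simp: B''_def)
            have "j \<noteq> i"
            proof
              assume "j = i"
              then have "b \<in> E `` C i \<inter> B" using j b bspec[OF CX i(1)] symE[OF b(2)] by (auto simp: B''_def)
              then show False using AK b(1) by (auto simp: B''_def)
            qed
            then show ?thesis using j by (auto simp: X'_def)
          qed
        qed simp
      qed
      have "B' \<subseteq> B''" using B'B KD by (auto simp: B''_def D_def)
      then have "card B' \<le> card B''" using finB by (intro card_mono) (auto simp: B''_def)
      then have big'': "2 * card V < 3 * card B''" using B'(4) by linarith
      \<comment> \<open>Every remaining branch set has a neighbour in \<open>B\<close>; those of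
        \<open>C i\<close> have just been removed.\<close>
      have "B'' \<subset> B" using hit[OF i(1)] AK by (auto simp: B''_def)
      then have "card B'' < card B" using finB by (rule psubset_card_mono[rotated])
      then have "Suc h * card B'' + card I < Suc h * card B + card I"
        by (simp only: add_less_cancel_right mult_less_cancel1 zero_less_Suc)
      then show False
        using less.hyps[of B'' I C' X'] CM' cI inv N big'' BV B''_def by blast
    qed
  qed
qed

text \<open>A connected \<open>B\<close> whose neighbours stay in B \<union> X is a component of V -
  X. If every small \<open>X\<close> left a component with more than two thirds of \<open>V\<close>,
  these components would form the haven that \<open>no_haven\<close> excludes, starting from the
  empty model.\<close>

theorem clique_minor_free_separator:
  assumes "sym E" "finite V" "clique_minor_free E V h" "0 < h" "0 < m" "h * card V \<le> m * m"
  shows "\<exists>X \<subseteq> V. card X \<le> h * m \<and>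
    (\<forall>B. conn E B \<longrightarrow> B \<subseteq> V - X \<longrightarrow> E `` B \<inter> V \<subseteq> B \<union> X \<longrightarrow> 3 * card B \<le> 2 * card V)"
proof (rule ccontr)
  assume contr: "\<not> ?thesis"
  have haven: "\<exists>B. conn E B \<and> B \<subseteq> V - X \<and> E `` B \<inter> V \<subseteq> B \<union> X \<and> 2 * card V < 3 * card B"
    if "X \<subseteq> V" "card X \<le> h * m" for X
    using contr that by (meson not_le)
  obtain B where B: "B \<subseteq> V" "E `` B \<inter> V \<subseteq> B" "2 * card V < 3 * card B"
    using haven[of "{}"] by auto
  show False
    by (rule no_haven[OF assms(1-3,5,6) haven, of "{}" "\<lambda>_. {}" "\<lambda>_. {}" B])
      (use B assms(4) in \<open>auto simp: clique_model_def\<close>)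
qed


section \<open>Balanced separations\<close>

lemma conn_reachable_set:
  assumes "sym E" "q \<in> Q"
  shows "conn E {v. (q, v) \<in> (E \<inter> Q \<times> Q)\<^sup>*}" (is "conn E ?K")
proof (rule connI_root[OF assms(1), of q])
  show "q \<in> ?K" by simp
next
  fix v assume "v \<in> ?K"
  then have "(q, v) \<in> (E \<inter> Q \<times> Q)\<^sup>*" by simp
  then show "(q, v) \<in> (E \<inter> ?K \<times> ?K)\<^sup>*"
  proof (induction rule: rtrancl_induct)
    case (step y z)
    then have "z \<in> ?K" by (simp add: rtrancl_into_rtrancl)
    then have "(y, z) \<in> E \<inter> ?K \<times> ?K" using step.hyps by blast
    with step.IH show ?case by (rule rtrancl_into_rtrancl)
  qed simp
qed

text \<open>Let \<open>A\<close> be a largest union of components of V - X with at most two thirds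
  of \<open>V\<close>. If the rest \<open>Q\<close> had more than two thirds, \<open>A\<close> would
  have less than one third. A component \<open>K\<close> of \<open>Q\<close> is itself a candidate,
  hence not larger than \<open>A\<close>, and A \<union> K would be a larger candidate.\<close>

lemma balanced_split:
  assumes E: "sym E" and V: "finite V" and "X \<subseteq> V"
    and small: "\<And>B. conn E B \<Longrightarrow> B \<subseteq> V - X \<Longrightarrow> E `` B \<inter> V \<subseteq> B \<union> X \<Longrightarrow> 3 * card B \<le> 2 * card V"
  shows "\<exists>P Q. P \<union> Q = V - X \<and> P \<inter> Q = {} \<and> E \<inter> P \<times> Q = {} \<and>
    3 * card P \<le> 2 * card V \<and> 3 * card Q \<le> 2 * card V"
proof -
  have symE: "(x, y) \<in> E \<Longrightarrow> (y, x) \<in> E" for x y using E by (rule symD)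
  define F where "F = {A. A \<subseteq> V - X \<and> E `` A \<inter> V \<subseteq> A \<union> X \<and> 3 * card A \<le> 2 * card V}"
  have "finite F" using V by (auto simp: F_def intro: finite_subset[of _ "Pow V"])
  moreover have "{} \<in> F" by (simp add: F_def)
  ultimately have "Max (card ` F) \<in> card ` F" by (intro Max_in) auto
  then obtain A where A: "A \<in> F" "card A = Max (card ` F)" by auto
  have Amax: "card B \<le> card A" if "B \<in> F" for B using that \<open>finite F\<close> A(2) by simp
  have AX: "A \<subseteq> V - X" and Acl: "E `` A \<inter> V \<subseteq> A \<union> X" and Ac: "3 * card A \<le> 2 * card V"
    using A(1) by (auto simp: F_def)
  define Q where "Q = V - X - A"
  have finA: "finite A" using AX V by (meson Diff_subset finite_subset)
  have finQ: "finite Q" using V by (simp add: Q_def)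
  have cAQ: "card A + card Q \<le> card V"
  proof -
    have "card A + card Q = card (A \<union> Q)"
      using finA finQ by (intro card_Un_disjoint[symmetric]) (auto simp: Q_def)
    also have "\<dots> \<le> card V" using V AX by (intro card_mono) (auto simp: Q_def)
    finally show ?thesis .
  qed
  have "3 * card Q \<le> 2 * card V"
  proof (rule ccontr)
    assume big: "\<not> ?thesis"
    then obtain q where q: "q \<in> Q" by fastforce
    define K where "K = {v. (q, v) \<in> (E \<inter> Q \<times> Q)\<^sup>*}"
    have KQ: "K \<subseteq> Q"
    proof
      fix v assume "v \<in> K"
      then have "(q, v) \<in> (E \<inter> Q \<times> Q)\<^sup>*" by (simp add: K_def)
      then show "v \<in> Q" using q by (metis IntD2 SigmaD2 rtranclE)
    qed
    have Kcl: "E `` K \<inter> V \<subseteq> K \<union> X"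
    proof
      fix y assume "y \<in> E `` K \<inter> V"
      then obtain x where x: "x \<in> K" "(x, y) \<in> E" "y \<in> V" by blast
      show "y \<in> K \<union> X"
      proof (cases "y \<in> X")
        case False
        have "y \<notin> A" using Acl symE[OF x(2)] x(1) KQ by (auto simp: Q_def)
        then have "(x, y) \<in> E \<inter> Q \<times> Q" using False x KQ by (auto simp: Q_def)
        then have "(q, y) \<in> (E \<inter> Q \<times> Q)\<^sup>*" using x(1) unfolding K_def
          by (auto intro: rtrancl_into_rtrancl)
        then show ?thesis by (simp add: K_def)
      qed simp
    qed
    have KX: "K \<subseteq> V - X" using KQ by (auto simp: Q_def)
    have "conn E K" unfolding K_def using E q by (rule conn_reachable_set)
    then have "3 * card K \<le> 2 * card V" using KX Kcl by (rule small)
    then have "K \<in> F" using KX Kcl by (simp add: F_def)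
    then have "card K \<le> card A" by (rule Amax)
    moreover have cAK: "card (A \<union> K) = card A + card K"
      using finA finQ KQ finite_subset by (intro card_Un_disjoint) (auto simp: Q_def)
    ultimately have "3 * card (A \<union> K) \<le> 2 * card V" using big cAQ by linarith
    then have "A \<union> K \<in> F" using AX KX Acl Kcl by (auto simp: F_def)
    then have "card K = 0" using Amax cAK by fastforce
    moreover have "q \<in> K" by (simp add: K_def)
    ultimately show False using KQ finQ by (metis card_0_eq empty_iff finite_subset)
  qed
  moreover have "E \<inter> A \<times> Q = {}" using Acl by (auto simp: Q_def)
  ultimately show ?thesis using AX Ac by (intro exI[of _ A] exI[of _ Q]) (auto simp: Q_def)
qed

section \<open>Divisions into small pieces\<close>

text \<open>By concavity the worst case is a split into n/3 and 2n/3, where the sum is (sqrt (1/3) +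
  sqrt (2/3)) * sqrt n. The constant 4/3 is a rational value below that coefficient.\<close>

lemma sqrt_sum_ge:
  fixes a b n :: real
  assumes "0 \<le> n" "n \<le> 3 * a" "n \<le> 3 * b" "n \<le> a + b"
  shows "4 / 3 * sqrt n \<le> sqrt a + sqrt b"
proof (rule power2_le_imp_le)
  have ab: "0 \<le> a" "0 \<le> b" using assms by linarith+
  have "0 \<le> (a - n / 3) * (b - n / 3)" using assms by (intro mult_nonneg_nonneg) auto
  then have "n / 3 * (a + b) \<le> a * b + n\<^sup>2 / 9" by (simp add: algebra_simps power2_eq_square)
  moreover have "n / 3 * n \<le> n / 3 * (a + b)" using assms by (intro mult_left_mono) auto
  moreover have "0 \<le> n * n" by simp
  \<comment> \<open>The true bound is 2/9. The smaller 4/25 is a rational square, and 1 + 2 * 2/5 =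
    9/5 still exceeds 16/9.\<close>
  ultimately have "4 / 25 * (n * n) \<le> a * b" unfolding power2_eq_square by linarith
  then have "(2 / 5 * n)\<^sup>2 \<le> a * b" by (simp add: power2_eq_square)
  then have "2 / 5 * n \<le> sqrt (a * b)" by (rule real_le_rsqrt)
  then have *: "2 / 5 * n \<le> sqrt a * sqrt b" by (simp add: real_sqrt_mult)
  have "(4 / 3 * sqrt n)\<^sup>2 = 16 / 9 * n" using assms(1) by (simp add: power_mult_distrib power_divide)
  also have "\<dots> \<le> a + b + 2 * (sqrt a * sqrt b)" using * assms by linarith
  also have "\<dots> = (sqrt a + sqrt b)\<^sup>2" using ab by (simp add: power2_sum)
  finally show "(4 / 3 * sqrt n)\<^sup>2 \<le> (sqrt a + sqrt b)\<^sup>2" .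
  show "0 \<le> sqrt a + sqrt b" using ab by simp
qed

text \<open>With m the ceiling of sqrt (h * card V), a separator has at most h * m vertices. The
  factor 2 absorbs the rounding.\<close>

definition sep_const :: "nat \<Rightarrow> real" where
  "sep_const h = 2 * real h * sqrt (real h)"

lemma sqrt_separator:
  assumes "sym E" "finite V" "clique_minor_free E V h" "0 < h" "0 < card V"
  shows "\<exists>X P Q. X \<subseteq> V \<and> real (card X) \<le> sep_const h * sqrt (card V) \<and>
    P \<union> Q = V - X \<and> P \<inter> Q = {} \<and> E \<inter> P \<times> Q = {} \<and>
    3 * card P \<le> 2 * card V \<and> 3 * card Q \<le> 2 * card V"
proof -
  let ?s = "sqrt (real h * real (card V))"
  define m where "m = nat \<lceil>?s\<rceil>"
  have "1 \<le> real h * real (card V)" using assms(4,5)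
    by (metis less_eq_Suc_le nat_0_less_mult_iff of_nat_1 of_nat_le_iff of_nat_mult One_nat_def)
  then have s1: "1 \<le> ?s" by simp
  have ms: "?s \<le> real m" unfolding m_def by (rule real_nat_ceiling_ge)
  then have m0: "0 < m" using s1 by linarith
  have "real m \<le> ?s + 1" unfolding m_def using s1 by linarith
  then have m2: "real m \<le> 2 * ?s" using s1 by linarith
  have "real h * real (card V) = ?s * ?s" by simp
  also have "\<dots> \<le> real m * real m" using ms s1 by (intro mult_mono) auto
  finally have mm: "h * card V \<le> m * m" by (metis of_nat_le_iff of_nat_mult)
  obtain X where X: "X \<subseteq> V" "card X \<le> h * m"
    "\<And>B. conn E B \<Longrightarrow> B \<subseteq> V - X \<Longrightarrow> E `` B \<inter> V \<subseteq> B \<union> X \<Longrightarrow> 3 * card B \<le> 2 * card V"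
    using clique_minor_free_separator[OF assms(1-4) m0 mm] by blast
  have "real (card X) \<le> real h * real m" using X(2) by (metis of_nat_le_iff of_nat_mult)
  also have "\<dots> \<le> real h * (2 * ?s)" using m2 by (intro mult_left_mono) auto
  also have "\<dots> = sep_const h * sqrt (card V)" by (simp add: sep_const_def real_sqrt_mult)
  finally show ?thesis using balanced_split[OF assms(1,2) X(1,3)] X(1) by blast
qed

text \<open>The negative term pays for counting the separator in both parts of the recursion.\<close>

lemma weak_division:
  fixes \<gamma> :: real
  assumes E: "sym E" and fin: "finite V" and free: "clique_minor_free E V h" and h: "0 < h"
    and \<gamma>: "0 < \<gamma>" "\<gamma> \<le> 1" and r: "108 * (sep_const h)\<^sup>2 \<le> \<gamma>\<^sup>2 * real r"
  shows "r \<le> 3 * card V \<Longrightarrow>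
    \<exists>\<P>. finite \<P> \<and> \<Union>\<P> = V \<and> (\<forall>P\<in>\<P>. card P \<le> r) \<and>
      (\<forall>u\<in>V. \<forall>v\<in>V. (u, v) \<in> E \<longrightarrow> (\<exists>P\<in>\<P>. u \<in> P \<and> v \<in> P)) \<and>
      real (\<Sum>P\<in>\<P>. card P) \<le> (1 + \<gamma>) * card V - 6 * sep_const h * sqrt (card V)"
  using fin free
proof (induction "card V" arbitrary: V rule: less_induct)
  case less
  define c where "c = sep_const h"
  define n where "n = card V"
  have c0: "0 < c" using h by (simp add: c_def sep_const_def)
  have rn: "real r \<le> 3 * real n" using less.prems(1) by (simp add: n_def)
  show ?case
  proof (cases "n \<le> r")
    case True
    \<comment> \<open>Here 108 = 3 * 36: a graph with at least r / 3 vertices is large enough for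
      \<gamma> * n to cover the subtracted 6 * c * sqrt n.\<close>
    have "108 * c\<^sup>2 \<le> \<gamma>\<^sup>2 * (3 * real n)"
      using r mult_left_mono[OF rn, of "\<gamma>\<^sup>2"] zero_le_power2[of \<gamma>] unfolding c_def by linarith
    then have "(6 * c)\<^sup>2 \<le> \<gamma>\<^sup>2 * real n" by (simp add: power_mult_distrib mult.commute)
    then have "6 * c \<le> sqrt (\<gamma>\<^sup>2 * real n)" by (rule real_le_rsqrt)
    then have "6 * c \<le> \<gamma> * sqrt n" using \<gamma> by (simp add: real_sqrt_mult)
    then have "6 * c * sqrt n \<le> \<gamma> * sqrt n * sqrt n" by (intro mult_right_mono) auto
    then have "6 * c * sqrt n \<le> \<gamma> * real n" by (simp add: mult.assoc)
    then show ?thesis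
      using True by (intro exI[of _ "{V}"]) (auto simp: n_def c_def algebra_simps)
  next
    case False
    then have n0: "0 < n" by simp
    \<comment> \<open>This makes the separator smaller than a third of \<open>V\<close>, so neither
      side is empty and both recursive graphs are proper.\<close>
    have "(3 * c)\<^sup>2 \<le> 108 * c\<^sup>2" by (simp add: power_mult_distrib)
    also have "\<dots> \<le> \<gamma>\<^sup>2 * real r" using r by (simp add: c_def)
    also have "\<dots> \<le> 1 * real r" using \<gamma> by (intro mult_right_mono) (auto simp: power_le_one)
    also have "\<dots> < real n" using False by simp
    finally have "3 * c < sqrt n" by (rule real_less_rsqrt)
    then have "3 * c * sqrt n < sqrt n * sqrt n" using n0 by (intro mult_strict_right_mono) auto
    then have cn: "3 * (c * sqrt n) < real n" by simp
    obtain X P Q where X: "X \<subseteq> V" "real (card X) \<le> c * sqrt n"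
      and PQ: "P \<union> Q = V - X" "P \<inter> Q = {}" "E \<inter> P \<times> Q = {}"
        "3 * card P \<le> 2 * n" "3 * card Q \<le> 2 * n"
      using sqrt_separator[OF E less.prems(2,3) h] n0 unfolding n_def c_def by blast
    have finX: "finite X" "finite P" "finite Q"
      using X(1) less.prems(2) finite_Un[of P Q] finite_subset[of X V] unfolding PQ(1) by auto
    have V_eq: "V = P \<union> Q \<union> X" using PQ(1) X(1) by blast
    have n_eq: "n = card P + card Q + card X"
    proof -
      have "(P \<union> Q) \<inter> X = {}" using PQ(1) by blast
      then show ?thesis
        unfolding n_def V_eq using finX PQ(2) by (simp add: card_Un_disjoint)
    qed
    define A where "A = P \<union> X"
    define B where "B = Q \<union> X"
    have cA: "card A = card P + card X" and cB: "card B = card Q + card X"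
      unfolding A_def B_def using finX PQ(1) by (auto intro!: card_Un_disjoint)
    have X3: "3 * card X < n" using cn X(2) by linarith
    then have P0: "0 < card P" "0 < card Q" using PQ(4,5) n_eq by linarith+
    have An: "card A < card V" "card B < card V" using P0 n_eq cA cB by (auto simp: n_def)
    \<comment> \<open>Each part keeps at least a third of the vertices because the opposite side has
      at most two thirds. As n > r, the size hypothesis of the induction survives.\<close>
    have An3: "n \<le> 3 * card A" "n \<le> 3 * card B" using PQ(4,5) n_eq cA cB by linarith+
    have AV: "A \<subseteq> V" "B \<subseteq> V" using V_eq by (auto simp: A_def B_def)
    have IH: "\<exists>\<P>. finite \<P> \<and> \<Union>\<P> = W \<and> (\<forall>P\<in>\<P>. card P \<le> r) \<and>
        (\<forall>u\<in>W. \<forall>v\<in>W. (u, v) \<in> E \<longrightarrow> (\<exists>P\<in>\<P>. u \<in> P \<and> v \<in> P)) \<and>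
        real (\<Sum>P\<in>\<P>. card P) \<le> (1 + \<gamma>) * card W - 6 * c * sqrt (card W)"
      if "card W < card V" "n \<le> 3 * card W" "W \<subseteq> V" for W
      unfolding c_def
    proof (rule less.hyps)
      show "clique_minor_free E W h" using less.prems(3) that(3) by (rule clique_minor_free_subset)
      show "finite W" using that(3) less.prems(2) by (rule finite_subset)
    qed (use that False in auto)
    obtain \<A> where A: "finite \<A>" "\<Union>\<A> = A" "\<forall>P\<in>\<A>. card P \<le> r"
        "\<forall>u\<in>A. \<forall>v\<in>A. (u, v) \<in> E \<longrightarrow> (\<exists>P\<in>\<A>. u \<in> P \<and> v \<in> P)"
        "real (\<Sum>P\<in>\<A>. card P) \<le> (1 + \<gamma>) * card A - 6 * c * sqrt (card A)"
      using IH[OF An(1) An3(1) AV(1)] by blast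
    obtain \<B> where B: "finite \<B>" "\<Union>\<B> = B" "\<forall>P\<in>\<B>. card P \<le> r"
        "\<forall>u\<in>B. \<forall>v\<in>B. (u, v) \<in> E \<longrightarrow> (\<exists>P\<in>\<B>. u \<in> P \<and> v \<in> P)"
        "real (\<Sum>P\<in>\<B>. card P) \<le> (1 + \<gamma>) * card B - 6 * c * sqrt (card B)"
      using IH[OF An(2) An3(2) AV(2)] by blast
    have edges: "\<exists>P\<in>\<A> \<union> \<B>. u \<in> P \<and> v \<in> P" if uv: "u \<in> V" "v \<in> V" "(u, v) \<in> E" for u v
    proof -
      have "(v, u) \<in> E" using E uv(3) by (rule symD)
      then have "u \<in> A \<and> v \<in> A \<or> u \<in> B \<and> v \<in> B"
        using uv PQ(3) unfolding V_eq A_def B_def by blast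
      then show ?thesis
      proof
        assume "u \<in> A \<and> v \<in> A"
        with A(4) uv(3) obtain P where "P \<in> \<A>" "u \<in> P" "v \<in> P" by meson
        then show ?thesis by (meson UnI1)
      next
        assume "u \<in> B \<and> v \<in> B"
        with B(4) uv(3) obtain P where "P \<in> \<B>" "u \<in> P" "v \<in> P" by meson
        then show ?thesis by (meson UnI2)
      qed
    qed
    have "real (\<Sum>P\<in>\<A> \<union> \<B>. card P) \<le> real (\<Sum>P\<in>\<A>. card P) + real (\<Sum>P\<in>\<B>. card P)"
    proof -
      have "(\<Sum>P\<in>\<A> \<union> \<B>. card P) \<le> (\<Sum>P\<in>\<A>. card P) + (\<Sum>P\<in>\<B>. card P)"
        using A(1) B(1) by (simp add: sum_Un_nat)
      then show ?thesis by linarith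
    qed
    also have "\<dots> \<le> (1 + \<gamma>) * (card A + card B) - 6 * c * (sqrt (card A) + sqrt (card B))"
      using A(5) B(5) by (simp add: algebra_simps)
    also have "\<dots> \<le> (1 + \<gamma>) * (real n + c * sqrt n) - 6 * c * (4 / 3 * sqrt n)"
    proof (rule diff_mono)
      have "real (card A + card B) \<le> real n + c * sqrt n" using n_eq cA cB X(2) by simp
      then show "(1 + \<gamma>) * (card A + card B) \<le> (1 + \<gamma>) * (real n + c * sqrt n)"
        using \<gamma> by (intro mult_left_mono) auto
      have "4 / 3 * sqrt n \<le> sqrt (card A) + sqrt (card B)"
        using An3 n_eq cA cB by (intro sqrt_sum_ge) auto
      then show "6 * c * (4 / 3 * sqrt n) \<le> 6 * c * (sqrt (card A) + sqrt (card B))"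
        using c0 by (intro mult_left_mono) auto
    qed
    \<comment> \<open>The balance is exact: the duplicated separator costs at most 2 * c * sqrt n,
      and the square roots gain 6 * (4/3 - 1) = 2 times c * sqrt n.\<close>
    also have "\<dots> \<le> (1 + \<gamma>) * n - 6 * c * sqrt n"
    proof -
      have "(1 + \<gamma>) * (c * sqrt n) \<le> 2 * (c * sqrt n)" using \<gamma> c0 by (intro mult_right_mono) auto
      then show ?thesis by (simp add: algebra_simps)
    qed
    finally have sum: "real (\<Sum>P\<in>\<A> \<union> \<B>. card P) \<le> (1 + \<gamma>) * n - 6 * c * sqrt n" .
    have "\<Union>(\<A> \<union> \<B>) = V" using A(2) B(2) V_eq by (auto simp: A_def B_def)
    moreover have "\<forall>P\<in>\<A> \<union> \<B>. card P \<le> r" using A(3) B(3) by blast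
    moreover have "finite (\<A> \<union> \<B>)" using A(1) B(1) by simp
    moreover have "\<forall>u\<in>V. \<forall>v\<in>V. (u, v) \<in> E \<longrightarrow> (\<exists>P\<in>\<A> \<union> \<B>. u \<in> P \<and> v \<in> P)"
      by (intro ballI impI edges)
    ultimately show ?thesis using sum unfolding n_def c_def by (intro exI[of _ "\<A> \<union> \<B>"] conjI)
  qed
qed

text \<open>Graphs with fewer than r / 3 vertices are too small for the strengthened bound, but they
  are one piece by themselves.\<close>

theorem division:
  fixes \<gamma> :: real
  assumes "sym E" "finite V" "clique_minor_free E V h" "0 < h" "0 < \<gamma>" "\<gamma> \<le> 1"
    and "108 * (sep_const h)\<^sup>2 \<le> \<gamma>\<^sup>2 * real r"
  shows "\<exists>\<P>. finite \<P> \<and> \<Union>\<P> = V \<and> (\<forall>P\<in>\<P>. card P \<le> r) \<and>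
      (\<forall>u\<in>V. \<forall>v\<in>V. (u, v) \<in> E \<longrightarrow> (\<exists>P\<in>\<P>. u \<in> P \<and> v \<in> P)) \<and>
      real (\<Sum>P\<in>\<P>. card P) \<le> (1 + \<gamma>) * card V"
proof (cases "r \<le> 3 * card V")
  case True
  obtain \<P> where "finite \<P> \<and> \<Union>\<P> = V \<and> (\<forall>P\<in>\<P>. card P \<le> r) \<and>
      (\<forall>u\<in>V. \<forall>v\<in>V. (u, v) \<in> E \<longrightarrow> (\<exists>P\<in>\<P>. u \<in> P \<and> v \<in> P)) \<and>
      real (\<Sum>P\<in>\<P>. card P) \<le> (1 + \<gamma>) * card V - 6 * sep_const h * sqrt (card V)"
    using weak_division[OF assms True] by (elim exE)
  moreover have "0 \<le> 6 * sep_const h * sqrt (card V)" by (simp add: sep_const_def)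
  ultimately show ?thesis by (intro exI[of _ \<P>]) linarith
next
  case False
  then have "card V \<le> r" by simp
  moreover have "1 * real (card V) \<le> (1 + \<gamma>) * card V"
    using assms(5) by (intro mult_right_mono) auto
  ultimately show ?thesis by (intro exI[of _ "{V}"]) auto
qed

section \<open>The exchange argument\<close>

text \<open>Let m v be the number of pieces containing v. Vertices of \<open>O'\<close> with m v = 1
  are the ones a swap may bring in, and their number is bounded by the total weight m of
  \<open>L\<close>. Vertices of \<open>O'\<close> with m v \<ge> 2 already count twice on the
  right-hand side.\<close>

lemma exchange_count:
  assumes fin: "finite \<P>" "finite L" "finite O'" and disj: "L \<inter> O' = {}" and cover: "\<Union>\<P> = L \<union> O'"
    and swap: "\<And>P. P \<in> \<P> \<Longrightarrow> card {v \<in> O' \<inter> P. \<forall>P'\<in>\<P>. v \<in> P' \<longrightarrow> P' = P} \<le> card (L \<inter> P)"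
  shows "2 * card O' \<le> (\<Sum>P\<in>\<P>. card P)"
proof -
  define m where "m v = card {P\<in>\<P>. v \<in> P}" for v
  have count: "(\<Sum>P\<in>\<P>. card (W \<inter> P)) = (\<Sum>v\<in>W. m v)" if "finite W" for W
  proof -
    have "(\<Sum>P\<in>\<P>. card (W \<inter> P)) = (\<Sum>P\<in>\<P>. \<Sum>v\<in>W. if v \<in> P then 1 else 0)"
      using that by (simp add: sum.If_cases Int_def)
    also have "\<dots> = (\<Sum>v\<in>W. \<Sum>P\<in>\<P>. if v \<in> P then 1 else 0)" by (rule sum.swap)
    also have "\<dots> = (\<Sum>v\<in>W. m v)" using fin(1) by (simp add: sum.If_cases Int_def m_def)
    finally show ?thesis .
  qed
  define int where "int P = {v \<in> O' \<inter> P. \<forall>P'\<in>\<P>. v \<in> P' \<longrightarrow> P' = P}" for P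
  have m1: "1 \<le> m v" if "v \<in> O'" for v
  proof -
    have "{P\<in>\<P>. v \<in> P} \<noteq> {}" using that cover by blast
    then have "0 < m v" using fin(1) by (simp add: m_def card_gt_0_iff)
    then show ?thesis by simp
  qed
  \<comment> \<open>Subtraction is truncated: as m v is at least 1, the term is 1 for m v = 1 and 0
    otherwise.\<close>
  have "(\<Sum>v\<in>O'. 2 - m v) \<le> (\<Sum>v\<in>O'. if m v = 1 then 1 else 0)"
    using m1 by (intro sum_mono) force
  also have "\<dots> = card {v\<in>O'. m v = 1}" using fin(3) by (simp add: sum.If_cases Int_def)
  also have "\<dots> \<le> card (\<Union>P\<in>\<P>. int P)"
  proof (rule card_mono)
    show "finite (\<Union>P\<in>\<P>. int P)"
      using fin(3) by (rule finite_subset[rotated]) (auto simp: int_def)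
    show "{v\<in>O'. m v = 1} \<subseteq> (\<Union>P\<in>\<P>. int P)"
    proof
      fix v assume v: "v \<in> {v\<in>O'. m v = 1}"
      then obtain P where "{P\<in>\<P>. v \<in> P} = {P}" by (auto simp: m_def card_1_singleton_iff)
      then have "P \<in> \<P>" "v \<in> int P" using v unfolding int_def by blast+
      then show "v \<in> (\<Union>P\<in>\<P>. int P)" by blast
    qed
  qed
  also have "\<dots> \<le> (\<Sum>P\<in>\<P>. card (int P))" using fin(1) by (rule card_UN_le)
  also have "\<dots> \<le> (\<Sum>P\<in>\<P>. card (L \<inter> P))"
    using swap unfolding int_def by (intro sum_mono)
  also have "\<dots> = (\<Sum>v\<in>L. m v)" using count[OF fin(2)] .
  finally have le: "(\<Sum>v\<in>O'. 2 - m v) \<le> (\<Sum>v\<in>L. m v)" .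
  have "2 * card O' = (\<Sum>v\<in>O'. 2)" by simp
  also have "\<dots> \<le> (\<Sum>v\<in>O'. (2 - m v) + m v)" by (intro sum_mono) simp
  also have "\<dots> \<le> (\<Sum>v\<in>L. m v) + (\<Sum>v\<in>O'. m v)" using le by (simp add: sum.distrib)
  also have "\<dots> = (\<Sum>v\<in>L \<union> O'. m v)" using fin disj by (simp add: sum.union_disjoint)
  also have "\<dots> = (\<Sum>P\<in>\<P>. card ((L \<union> O') \<inter> P))" using count fin by simp
  also have "\<dots> = (\<Sum>P\<in>\<P>. card P)" using cover by (intro sum.cong) (auto intro: arg_cong[of _ _ card])
  finally show ?thesis .
qed

text \<open>Turns a branch set of centres into a branch set of G by replacing each centre with its
  cell.\<close>

lemma conn_blowup:
  assumes E: "sym E" and X: "conn X S"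
    and cells: "\<And>c. c \<in> S \<Longrightarrow> conn E (N c)"
    and adj: "\<And>a b. a \<in> S \<Longrightarrow> b \<in> S \<Longrightarrow> (a, b) \<in> X \<Longrightarrow> \<exists>u\<in>N a. \<exists>v\<in>N b. (u, v) \<in> E"
  shows "conn E (\<Union>(N ` S))"
proof -
  let ?T = "\<Union>(N ` S)"
  let ?R = "E \<inter> ?T \<times> ?T"
  have within: "(u, v) \<in> ?R\<^sup>*" if "c \<in> S" "u \<in> N c" "v \<in> N c" for c u v
  proof -
    have "(u, v) \<in> (E \<inter> N c \<times> N c)\<^sup>*" using cells[OF that(1)] that by (auto simp: conn_def)
    moreover have "(E \<inter> N c \<times> N c)\<^sup>* \<subseteq> ?R\<^sup>*" using that(1) by (intro rtrancl_mono) auto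
    ultimately show ?thesis by blast
  qed
  obtain a where a: "a \<in> S" using X by (auto simp: conn_def)
  then obtain r where r: "r \<in> N a" using cells[OF a] by (auto simp: conn_def)
  have reach: "\<forall>v\<in>N c. (r, v) \<in> ?R\<^sup>*" if "c \<in> S" for c
  proof (rule conn_propagate[OF X a, of "\<lambda>c. \<forall>v\<in>N c. (r, v) \<in> ?R\<^sup>*", OF _ _ that])
    show "\<forall>v\<in>N a. (r, v) \<in> ?R\<^sup>*" using within a r by blast
  next
    fix b c assume bc: "b \<in> S" "c \<in> S" "(b, c) \<in> X" "\<forall>v\<in>N b. (r, v) \<in> ?R\<^sup>*"
    then obtain x y where xy: "x \<in> N b" "y \<in> N c" "(x, y) \<in> E" using adj by blast
    then have "(x, y) \<in> ?R" using bc by blast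
    then have "(r, y) \<in> ?R\<^sup>*" using bc(4) xy(1) by (meson rtrancl_into_rtrancl)
    then show "\<forall>v\<in>N c. (r, v) \<in> ?R\<^sup>*" using within[OF bc(2) xy(2)] by (meson rtrancl_trans)
  qed
  show ?thesis
    by (rule connI_root[OF E, of r]) (use a r reach in auto)
qed

section \<open>Nearest-centre cells in a capped metric\<close>

locale capped_metric =
  fixes V :: "'a::wellorder set" and E :: "'a rel" and D :: "'a \<Rightarrow> 'a \<Rightarrow> real" and M :: real
  assumes finV: "finite V" and symE: "sym E" and M0: "0 < M"
    and D_self: "x \<in> V \<Longrightarrow> D x x = 0"
    and D_sym: "x \<in> V \<Longrightarrow> y \<in> V \<Longrightarrow> D x y = D y x"
    and D_nonneg: "x \<in> V \<Longrightarrow> y \<in> V \<Longrightarrow> 0 \<le> D x y"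
    and triangle: "x \<in> V \<Longrightarrow> y \<in> V \<Longrightarrow> z \<in> V \<Longrightarrow> D x z \<le> D x y + D y z"
    and first_step: "x \<in> V \<Longrightarrow> y \<in> V \<Longrightarrow> x \<noteq> y \<Longrightarrow> D x y < M \<Longrightarrow>
      \<exists>z\<in>V. (x, z) \<in> E \<and> D x y = D x z + D z y \<and> D z y < D x y"
begin

lemma D_pos: "x \<in> V \<Longrightarrow> y \<in> V \<Longrightarrow> x \<noteq> y \<Longrightarrow> 0 < D x y"
  using first_step[of x y] D_nonneg M0 by (metis le_less_trans not_le order.strict_trans2)

text \<open>Real distances are not well-founded, but \<open>V\<close> is finite: the number of
  vertices closer to \<open>y\<close> decreases.\<close>

lemma closer_induct [consumes 2, case_names closer]:
  assumes "x \<in> V" "y \<in> V"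
    and "\<And>x. x \<in> V \<Longrightarrow> (\<And>z. z \<in> V \<Longrightarrow> D z y < D x y \<Longrightarrow> P z) \<Longrightarrow> P x"
  shows "P x"
  using assms(1)
proof (induction "card {u\<in>V. D u y < D x y}" arbitrary: x rule: less_induct)
  case less
  show ?case
  proof (rule assms(3)[OF less.prems])
    fix z assume z: "z \<in> V" "D z y < D x y"
    have "{u\<in>V. D u y < D z y} \<subset> {u\<in>V. D u y < D x y}" using z by force
    then have "card {u\<in>V. D u y < D z y} < card {u\<in>V. D u y < D x y}"
      using finV by (intro psubset_card_mono) auto
    then show "P z" using z(1) by (rule less.hyps)
  qed
qed

text \<open>Consistent tie-breaking keeps the cells connected.\<close>

definition near :: "'a set \<Rightarrow> 'a \<Rightarrow> 'a" where
  "near Q v = (LEAST c. c \<in> Q \<and> (\<forall>c'\<in>Q. D v c \<le> D v c'))"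

text \<open>Vertices that reach no centre below the cap get no cell, since \<open>first_step\<close>
  provides no path for them.\<close>

definition cell :: "'a set \<Rightarrow> 'a \<Rightarrow> 'a set" where
  "cell Q c = {v\<in>V. D v c < M \<and> near Q v = c}"

lemma near_props:
  assumes "Q \<subseteq> V" "Q \<noteq> {}"
  shows "near Q v \<in> Q" "c \<in> Q \<Longrightarrow> D v (near Q v) \<le> D v c"
    "c \<in> Q \<Longrightarrow> D v c \<le> D v (near Q v) \<Longrightarrow> near Q v \<le> c"
proof -
  have finQ: "finite Q" using assms(1) finV by (rule finite_subset)
  then have "Min (D v ` Q) \<in> D v ` Q" using assms(2) by (intro Min_in) auto
  then obtain c where "c \<in> Q" "D v c = Min (D v ` Q)" by auto
  then have "c \<in> Q \<and> (\<forall>c'\<in>Q. D v c \<le> D v c')" using finQ by simp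
  then have *: "near Q v \<in> Q \<and> (\<forall>c'\<in>Q. D v (near Q v) \<le> D v c')"
    unfolding near_def by (rule LeastI)
  then show "near Q v \<in> Q" and min: "c \<in> Q \<Longrightarrow> D v (near Q v) \<le> D v c" for c by auto
  show "near Q v \<le> c" if "c \<in> Q" "D v c \<le> D v (near Q v)" for c
    unfolding near_def using that min by (intro Least_le) (auto intro: order_trans)
qed

lemma near_center:
  assumes "Q \<subseteq> V" "c \<in> Q"
  shows "near Q c = c"
proof (rule ccontr)
  assume ne: "near Q c \<noteq> c"
  have "near Q c \<in> Q" "D c (near Q c) \<le> D c c" using near_props[OF assms(1)] assms(2) by auto
  then show False using D_pos[of c "near Q c"] D_self[of c] assms ne by force
qed

lemma center_in_cell: "Q \<subseteq> V \<Longrightarrow> c \<in> Q \<Longrightarrow> c \<in> cell Q c"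
  using near_center D_self M0 by (auto simp: cell_def)

text \<open>Let z follow v on a shortest path to c. By the triangle inequality, a centre that is at
  least as good as c for z is at least as good for v. So both vertices have c among their nearest
  centres, and the least-element rule gives them the same one.\<close>

lemma cell_step:
  assumes Q: "Q \<subseteq> V" "c \<in> Q" and v: "v \<in> cell Q c" "v \<noteq> c"
  shows "\<exists>z\<in>cell Q c. (v, z) \<in> E \<and> D z c < D v c"
proof -
  have vV: "v \<in> V" "D v c < M" and nv: "near Q v = c" using v(1) by (auto simp: cell_def)
  have cV: "c \<in> V" using Q by blast
  obtain z where z: "z \<in> V" "(v, z) \<in> E" "D v c = D v z + D z c" "D z c < D v c"
    using first_step[OF vV(1) cV v(2) vV(2)] by blast
  define c' where "c' = near Q z"
  have c': "c' \<in> Q" "D z c' \<le> D z c" "\<And>x. x \<in> Q \<Longrightarrow> D z x \<le> D z c' \<Longrightarrow> c' \<le> x"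
    using near_props[OF Q(1), where v = z] Q(2) unfolding c'_def by auto
  have c: "\<And>x. x \<in> Q \<Longrightarrow> D v c \<le> D v x" "\<And>x. x \<in> Q \<Longrightarrow> D v x \<le> D v c \<Longrightarrow> c \<le> x"
    using near_props[OF Q(1), where v = v] Q(2) unfolding nv by auto
  have tri: "D v c' \<le> D v z + D z c'" using triangle[OF vV(1) z(1)] c'(1) Q(1) by blast
  have "c \<le> c'" using c(2)[OF c'(1)] tri c'(2) z(3) by linarith
  moreover have "c' \<le> c" using c'(3)[OF Q(2)] c(1)[OF c'(1)] tri z(3) by linarith
  ultimately have "near Q z = c" by (simp add: c'_def)
  then show ?thesis using z vV(2) by (auto simp: cell_def)
qed

lemma conn_cell:
  assumes Q: "Q \<subseteq> V" "c \<in> Q"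
  shows "conn E (cell Q c)"
proof (rule connI_root[OF symE, of c])
  show "c \<in> cell Q c" using Q by (rule center_in_cell)
next
  fix v assume v: "v \<in> cell Q c"
  have cV: "c \<in> V" using Q by blast
  have "v \<in> V" using v by (simp add: cell_def)
  then show "(c, v) \<in> (E \<inter> cell Q c \<times> cell Q c)\<^sup>*"
    using cV v
  proof (induction rule: closer_induct)
    case (closer v)
    show ?case
    proof (cases "v = c")
      case False
      then obtain z where z: "z \<in> cell Q c" "(v, z) \<in> E" "D z c < D v c"
        using cell_step[OF Q closer.prems] by blast
      then have "(c, z) \<in> (E \<inter> cell Q c \<times> cell Q c)\<^sup>*"
        using closer.IH by (auto simp: cell_def)
      moreover have "(z, v) \<in> E \<inter> cell Q c \<times> cell Q c"
        using z closer.prems symD[OF symE] by blast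
      ultimately show ?thesis by (rule rtrancl_into_rtrancl)
    qed simp
  qed
qed

text \<open>Walk along a shortest path from a to b. Its vertices lie in the two cells only, it
  starts in the first and ends in the second, so some edge crosses.\<close>

lemma cells_adjacent:
  assumes Q: "Q \<subseteq> V" "a \<in> Q" "b \<in> Q" "a \<noteq> b" and close: "D a b \<le> \<rho>" and "\<rho> < M"
    and apart: "\<And>c. c \<in> Q \<Longrightarrow> c \<noteq> a \<Longrightarrow> c \<noteq> b \<Longrightarrow> \<rho> < D c a \<or> \<rho> < D c b"
  shows "\<exists>u\<in>cell Q a. \<exists>v\<in>cell Q b. (u, v) \<in> E"
proof -
  have ab: "a \<in> V" "b \<in> V" using Q by auto
  \<comment> \<open>The nearest centre c of x satisfies D x c \<le> D x a and D x c \<le> D x b.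
    Hence D c a and D c b are both at most D a b, and \<open>apart\<close> leaves only a and
    b.\<close>
  have path: "x \<in> cell Q a \<or> x \<in> cell Q b" if x: "x \<in> V" "D a x + D x b = D a b" for x
  proof -
    define c where "c = near Q x"
    have cQ: "c \<in> Q" and ca: "D x c \<le> D x a" and cb: "D x c \<le> D x b"
      using near_props[OF Q(1), where v = x] Q(2,3) unfolding c_def by auto
    have cV: "c \<in> V" using cQ Q(1) by blast
    have "D c a \<le> D x c + D x a" "D c b \<le> D x c + D x b"
      using triangle[OF cV x(1) ab(1)] triangle[OF cV x(1) ab(2)] D_sym[OF cV x(1)] by auto
    moreover have sx: "D x a = D a x" using D_sym x(1) ab(1) by blast
    ultimately have "c = a \<or> c = b" using apart[OF cQ] ca cb x(2) close by linarith
    moreover have "D x a < M" "D x b < M"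
      using x(2) close \<open>\<rho> < M\<close> sx D_nonneg[OF x(1) ab(1)] D_nonneg[OF x(1) ab(2)] by linarith+
    ultimately show ?thesis using x(1) by (auto simp: cell_def c_def)
  qed
  have "D a x + D x b = D a b \<longrightarrow> x \<in> cell Q a \<longrightarrow> (\<exists>u\<in>cell Q a. \<exists>v\<in>cell Q b. (u, v) \<in> E)"
    if "x \<in> V" for x
    using that ab(2)
  proof (induction rule: closer_induct)
    case (closer x)
    show ?case
    proof (intro impI)
      assume x: "D a x + D x b = D a b" "x \<in> cell Q a"
      have "x \<noteq> b" using x(2) near_center[OF Q(1,3)] Q(4) by (auto simp: cell_def)
      moreover have "D x b < M"
        using x(1) close \<open>\<rho> < M\<close> D_nonneg[OF ab(1) closer.hyps] by linarith
      ultimately obtain z where z: "z \<in> V" "(x, z) \<in> E" "D x b = D x z + D z b" "D z b < D x b"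
        using first_step[OF closer.hyps ab(2)] by blast
      have "D a z + D z b = D a b"
        using triangle[OF ab(1) closer.hyps z(1)] triangle[OF ab(1) z(1) ab(2)] z(3) x(1) by linarith
      then show "\<exists>u\<in>cell Q a. \<exists>v\<in>cell Q b. (u, v) \<in> E"
        using path[OF z(1)] closer.IH[OF z(1,4)] z(2) x(2) by blast
    qed
  qed
  then show ?thesis using ab(1) D_self[OF ab(1)] center_in_cell[OF Q(1,2)] by simp
qed

section \<open>Conflicts between two separated sets\<close>

definition separated :: "real \<Rightarrow> 'a set \<Rightarrow> bool" where
  "separated \<rho> S \<longleftrightarrow> (\<forall>x\<in>S. \<forall>y\<in>S. x \<noteq> y \<longrightarrow> \<rho> < D x y)"

definition conflict :: "real \<Rightarrow> 'a set \<Rightarrow> 'a rel" where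
  "conflict \<rho> Q = {(a, b). a \<in> Q \<and> b \<in> Q \<and> a \<noteq> b \<and> D a b \<le> \<rho>}"

lemma conflict_clique_minor_free:
  assumes free: "clique_minor_free E V h" and "A \<union> B \<subseteq> V"
    and A: "separated \<rho> A" and B: "separated \<rho> B" and "\<rho> < M"
  shows "clique_minor_free (conflict \<rho> (A \<union> B)) (A \<union> B) h"
  unfolding clique_minor_free_def
proof
  let ?Q = "A \<union> B"
  assume "\<exists>I C. clique_model (conflict \<rho> ?Q) I C \<and> card I = h \<and> (\<forall>i\<in>I. C i \<subseteq> ?Q)"
  then obtain I C where I: "clique_model (conflict \<rho> ?Q) I C" "card I = h" "\<And>i. i \<in> I \<Longrightarrow> C i \<subseteq> ?Q"
    by blast
  have cells: "\<exists>u\<in>cell ?Q a. \<exists>v\<in>cell ?Q b. (u, v) \<in> E" if "(a, b) \<in> conflict \<rho> ?Q" for a b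
  proof (rule cells_adjacent[OF assms(2) _ _ _ _ assms(5)])
    fix c assume c: "c \<in> ?Q" "c \<noteq> a" "c \<noteq> b"
    have ab: "a \<in> ?Q" "b \<in> ?Q" "a \<noteq> b" "D a b \<le> \<rho>" using that by (auto simp: conflict_def)
    \<comment> \<open>The conflict joins different sides, so c is on the same side as a or as b and
      hence separated from it.\<close>
    then have "\<not> (a \<in> A \<and> b \<in> A)" "\<not> (a \<in> B \<and> b \<in> B)"
      using A B unfolding separated_def by (meson not_le)+
    then show "\<rho> < D c a \<or> \<rho> < D c b" using A B c ab unfolding separated_def by blast
  qed (use that in \<open>auto simp: conflict_def\<close>)
  define N where "N i = \<Union>(cell ?Q ` C i)" for i
  have "clique_model E I N"
    unfolding clique_model_def
  proof (intro conjI ballI impI)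
    show "finite I" using I(1) by (simp add: clique_model_def)
  next
    fix i assume i: "i \<in> I"
    show "conn E (N i)"
      unfolding N_def
    proof (rule conn_blowup[OF symE, of "conflict \<rho> ?Q"])
      show "conn (conflict \<rho> ?Q) (C i)" using I(1) i by (simp add: clique_model_def)
    qed (use I(3)[OF i] conn_cell[OF assms(2)] cells in blast)+
  next
    fix i j assume ij: "i \<in> I" "j \<in> I" "i \<noteq> j"
    then have *: "C i \<inter> C j = {}" "\<exists>u\<in>C i. \<exists>v\<in>C j. (u, v) \<in> conflict \<rho> ?Q"
      using I(1) unfolding clique_model_def by blast+
    show "N i \<inter> N j = {}" using *(1) by (auto simp: N_def cell_def)
    show "\<exists>u\<in>N i. \<exists>v\<in>N j. (u, v) \<in> E" using *(2) cells unfolding N_def by fast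
  qed
  moreover have "\<forall>i\<in>I. N i \<subseteq> V" by (auto simp: N_def cell_def)
  ultimately show False using free I(2) unfolding clique_minor_free_def by blast
qed

text \<open>The parameter \<gamma> is the excess of the division. Counting gives 2 * card B \<le> (1
  + \<gamma>) * (card A + card B) for the two differences A = L - O' and B = O' - L, which
  rearranges to the claim for them.\<close>

theorem local_optimum_ratio:
  fixes \<gamma> :: real
  assumes free: "clique_minor_free E V h" and h: "0 < h"
    and \<gamma>: "0 < \<gamma>" "\<gamma> \<le> 1" and r: "108 * (sep_const h)\<^sup>2 \<le> \<gamma>\<^sup>2 * real r"
    and L: "L \<subseteq> V" "separated \<rho> L" and O': "O' \<subseteq> V" "separated \<rho> O'" and \<rho>: "\<rho> < M"
    and opt: "\<And>A R. A \<subseteq> O' - L \<Longrightarrow> R \<subseteq> L - O' \<Longrightarrow> card A + card R \<le> r \<Longrightarrow>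
      separated \<rho> (L - R \<union> A) \<Longrightarrow> card A \<le> card R"
  shows "(1 - \<gamma>) * card O' \<le> (1 + \<gamma>) * card L"
proof -
  define A where "A = L - O'"
  define B where "B = O' - L"
  have AB: "A \<union> B \<subseteq> V" using L O' by (auto simp: A_def B_def)
  have fin: "finite L" "finite O'" "finite A" "finite B"
    using L(1) O'(1) finV by (auto simp: A_def B_def intro: finite_subset)
  have disj: "A \<inter> B = {}" by (auto simp: A_def B_def)
  let ?X = "conflict \<rho> (A \<union> B)"
  have symX: "sym ?X" using D_sym AB unfolding sym_def conflict_def by (auto simp: subset_iff)
  have sep: "separated \<rho> A" "separated \<rho> B"
    using L(2) O'(2) by (auto simp: A_def B_def separated_def)
  obtain \<P> where P: "finite \<P>" "\<Union>\<P> = A \<union> B" "\<forall>P\<in>\<P>. card P \<le> r"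
    "\<forall>u\<in>A \<union> B. \<forall>v\<in>A \<union> B. (u, v) \<in> ?X \<longrightarrow> (\<exists>P\<in>\<P>. u \<in> P \<and> v \<in> P)"
    "real (\<Sum>P\<in>\<P>. card P) \<le> (1 + \<gamma>) * card (A \<union> B)"
    using division[OF symX _ conflict_clique_minor_free[OF free AB sep \<rho>] h \<gamma> r] fin by auto
  have "2 * card B \<le> (\<Sum>P\<in>\<P>. card P)"
  proof (rule exchange_count[OF P(1) fin(3,4) disj P(2)])
    fix P assume PP: "P \<in> \<P>"
    let ?I = "{v \<in> B \<inter> P. \<forall>P'\<in>\<P>. v \<in> P' \<longrightarrow> P' = P}"
    have finP: "finite P" using PP P(2) fin by (metis Union_upper finite_Un finite_subset)
    have "card ?I + card (A \<inter> P) = card (?I \<union> A \<inter> P)"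
      using finP disj by (intro card_Un_disjoint[symmetric]) auto
    also have "\<dots> \<le> card P" using finP by (intro card_mono) auto
    finally have card: "card ?I + card (A \<inter> P) \<le> r" using P(3) PP by fastforce
    \<comment> \<open>A conflict of y with some x in \<open>A\<close> is covered by a piece. The
      only piece containing y is \<open>P\<close>, so x lies in \<open>P\<close> and has been
      removed.\<close>
    have cross: "\<rho> < D x y" if x: "x \<in> L - A \<inter> P" and y: "y \<in> ?I" and ne: "x \<noteq> y" for x y
    proof (cases "x \<in> O'")
      case True
      then show ?thesis using O'(2) y ne by (auto simp: separated_def B_def)
    next
      case False
      then have xA: "x \<in> A" using x by (auto simp: A_def)
      show ?thesis
      proof (rule ccontr)
        assume "\<not> ?thesis"
        then have "(x, y) \<in> ?X" using xA y ne by (auto simp: conflict_def)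
        then obtain P' where "P' \<in> \<P>" "x \<in> P'" "y \<in> P'" using P(4) xA y by blast
        then show False using x xA y by blast
      qed
    qed
    have "separated \<rho> (L - A \<inter> P \<union> ?I)"
      unfolding separated_def
    proof (intro ballI impI)
      fix x y assume xy: "x \<in> L - A \<inter> P \<union> ?I" "y \<in> L - A \<inter> P \<union> ?I" "x \<noteq> y"
      consider "x \<in> L" "y \<in> L" | "x \<in> ?I" "y \<in> ?I"
        | "x \<in> L - A \<inter> P" "y \<in> ?I" | "x \<in> ?I" "y \<in> L - A \<inter> P" using xy by blast
      then show "\<rho> < D x y"
      proof cases
        case 1
        then show ?thesis using L(2) xy(3) by (simp add: separated_def)
      next
        case 2
        then have "x \<in> O'" "y \<in> O'" by (auto simp: B_def)
        then show ?thesis using O'(2) xy(3) by (simp add: separated_def)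
      next
        case 3
        then show ?thesis using cross xy(3) by blast
      next
        case 4
        then have "x \<in> V" "y \<in> V" using L(1) O'(1) by (auto simp: B_def)
        then show ?thesis using cross[OF 4(2,1)] xy(3) D_sym by simp
      qed
    qed
    then show "card ?I \<le> card (A \<inter> P)"
      using card by (intro opt) (auto simp: A_def B_def)
  qed
  then have "2 * real (card B) \<le> (1 + \<gamma>) * (real (card A) + real (card B))"
    using P(5) fin disj by (simp add: card_Un_disjoint del: of_nat_sum)
  then have *: "(1 - \<gamma>) * card B \<le> (1 + \<gamma>) * card A" by (simp add: algebra_simps)
  have L_eq: "card L = card A + card (L \<inter> O')"
    using fin(1) by (simp add: A_def card_Diff_subset_Int card_mono)
  have O_eq: "card O' = card B + card (L \<inter> O')"
    using fin(2) by (simp add: B_def card_Diff_subset_Int card_mono Int_commute)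
  \<comment> \<open>The common vertices, left out of the division, are added to both sides.\<close>
  have "(1 - \<gamma>) * card (L \<inter> O') \<le> (1 + \<gamma>) * card (L \<inter> O')"
    using \<gamma> by (intro mult_right_mono) auto
  then show ?thesis using * by (simp add: L_eq O_eq distrib_left)
qed

end

section \<open>Shortest-path metrics of weighted graphs\<close>

locale sym_weighted = pair_graph G for G :: "nat pair_pre_digraph" +
  fixes w :: "(nat \<times> nat) weight_fun"
  assumes w_nonneg: "a \<in> parcs G \<Longrightarrow> 0 \<le> w a"
    and w_sym: "(u, v) \<in> parcs G \<Longrightarrow> w (u, v) = w (v, u)"
begin

lemma parcs_sym: "(u, v) \<in> parcs G \<Longrightarrow> (v, u) \<in> parcs G"
  using sym_arcs by (auto simp: symmetric_conv)

lemma sym_parcs: "sym (parcs G)"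
  using parcs_sym by (auto simp: sym_def)

lemma awalk_swap:
  "awalk u p v \<Longrightarrow> awalk v (rev (map prod.swap p)) u \<and>
    awalk_cost w (rev (map prod.swap p)) = awalk_cost w p"
proof (induction p arbitrary: u)
  case Nil
  then show ?case by (auto simp: awalk_Nil_iff)
next
  case (Cons e p)
  obtain x y where e: "e = (x, y)" by force
  have *: "(x, y) \<in> parcs G" "u = x" "awalk y p v" using Cons.prems by (auto simp: awalk_Cons_iff e)
  have "awalk y [(y, x)] x"
    using parcs_sym[OF *(1)] wellformed'(1)[OF *(1)] by (auto simp: awalk_simps)
  then show ?case
    using Cons.IH[OF *(3)] * w_sym[OF *(1)] by (auto simp: e intro: awalk_appendI)
qed

lemma awalk_cost_nonneg: "awalk u p v \<Longrightarrow> 0 \<le> awalk_cost w p"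
  by (rule pos_cost_pos_awalk_cost) (use w_nonneg in auto)

lemma shortest_apath:
  assumes "\<mu> w u v < \<infinity>"
  obtains p where "apath u p v" "\<mu> w u v = ereal (awalk_cost w p)"
  using min_cost_awalk[of u v w] assms w_nonneg that unfolding \<mu>_reach_conv by blast

lemma mu_nonneg: "0 \<le> \<mu> w u v"
proof (cases "\<mu> w u v < \<infinity>")
  case True
  then obtain p where p: "apath u p v" "\<mu> w u v = ereal (awalk_cost w p)" by (rule shortest_apath)
  show ?thesis using awalk_cost_nonneg[OF awalkI_apath[OF p(1)]] p(2) by simp
qed auto

definition capped_dist :: "real \<Rightarrow> nat \<Rightarrow> nat \<Rightarrow> real" where
  "capped_dist M x y = (if \<mu> w x y < ereal M then real_of_ereal (\<mu> w x y) else M)"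

lemma capped_dist_le: "capped_dist M x y \<le> M"
proof (cases "\<mu> w x y < ereal M")
  case True
  then have "\<mu> w x y < \<infinity>" by (metis less_ereal.simps(4) less_trans)
  then obtain p where "\<mu> w x y = ereal (awalk_cost w p)" by (rule shortest_apath)
  then show ?thesis using True by (simp add: capped_dist_def)
qed (simp add: capped_dist_def)

lemma capped_dist_apath:
  assumes "capped_dist M x y < M"
  obtains p where "apath x p y" "capped_dist M x y = awalk_cost w p"
proof -
  have *: "\<mu> w x y < ereal M" using assms by (auto simp: capped_dist_def split: if_splits)
  then have "\<mu> w x y < \<infinity>" by (metis less_ereal.simps(4) less_trans)
  then obtain p where "apath x p y" "\<mu> w x y = ereal (awalk_cost w p)" by (rule shortest_apath)
  then show ?thesis using that * by (simp add: capped_dist_def)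
qed

lemma capped_dist_le_awalk:
  assumes "awalk x p y"
  shows "capped_dist M x y \<le> awalk_cost w p"
proof (cases "\<mu> w x y < ereal M")
  case True
  then have "\<mu> w x y < \<infinity>" by (metis less_ereal.simps(4) less_trans)
  then obtain q where q: "\<mu> w x y = ereal (awalk_cost w q)" by (rule shortest_apath)
  show ?thesis using min_cost_le_walk_cost[OF assms, of w] True by (simp add: capped_dist_def q)
next
  case False
  have "ereal M \<le> ereal (awalk_cost w p)"
    using False min_cost_le_walk_cost[OF assms, of w] by (meson not_le order_trans)
  then show ?thesis using False by (simp add: capped_dist_def)
qed

lemma capped_dist_nonneg: "0 \<le> M \<Longrightarrow> 0 \<le> capped_dist M x y"
  using mu_nonneg[of x y] by (simp add: capped_dist_def real_of_ereal_pos)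

text \<open>A cap above \<rho> changes no comparison with \<rho>, so the finite matrix decides
  independence also across components.\<close>

lemma capped_dist_le_iff:
  assumes "\<rho> < M"
  shows "capped_dist M x y \<le> \<rho> \<longleftrightarrow> \<mu> w x y \<le> ereal \<rho>"
proof (cases "\<mu> w x y < ereal M")
  case True
  then have "\<mu> w x y < \<infinity>" by (metis less_ereal.simps(4) less_trans)
  then obtain q where q: "\<mu> w x y = ereal (awalk_cost w q)" by (rule shortest_apath)
  show ?thesis using True by (simp add: capped_dist_def q)
next
  case False
  have "\<not> \<mu> w x y \<le> ereal \<rho>" using False assms
    by (metis ereal_less_le less_ereal.simps(1) not_le order.strict_trans1)
  then show ?thesis using False assms by (simp add: capped_dist_def)
qed

lemma capped_dist_self: "0 < M \<Longrightarrow> x \<in> pverts G \<Longrightarrow> capped_dist M x x = 0"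
  using capped_dist_le_awalk[of x "[]" x M] capped_dist_nonneg[of M x x] by (simp add: awalk_Nil_iff)

lemma capped_dist_sym: "capped_dist M x y = capped_dist M y x"
proof -
  have "capped_dist M y x \<le> capped_dist M x y" for x y
  proof (cases "capped_dist M x y < M")
    case True
    then obtain p where p: "apath x p y" "capped_dist M x y = awalk_cost w p"
      by (rule capped_dist_apath)
    then show ?thesis
      using awalk_swap[OF awalkI_apath[OF p(1)]] capped_dist_le_awalk by metis
  next
    case False
    then show ?thesis using capped_dist_le[of M x y] capped_dist_le[of M y x] by linarith
  qed
  then show ?thesis by (metis order_antisym)
qed

lemma capped_dist_triangle:
  assumes "0 \<le> M"
  shows "capped_dist M x z \<le> capped_dist M x y + capped_dist M y z"
proof (cases "capped_dist M x y < M \<and> capped_dist M y z < M")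
  case True
  then obtain p q where "apath x p y" "capped_dist M x y = awalk_cost w p"
    "apath y q z" "capped_dist M y z = awalk_cost w q"
    by (metis capped_dist_apath)
  then show ?thesis
    using capped_dist_le_awalk[OF awalk_appendI[of x p y q z], of M] by (auto simp: apath_def)
next
  case False
  then show ?thesis
    using capped_dist_le[of M x z] capped_dist_nonneg[OF assms, of x y]
      capped_dist_nonneg[OF assms, of y z] by linarith
qed

text \<open>For \<open>first_step\<close>, take the first arc of a shortest path. The arc and the
  rest bound the two capped distances from above, and the triangle inequality forces equality. A
  positive weight makes the remaining distance strictly smaller.\<close>

lemma capped_metric_if_pos:
  assumes M: "0 < M" and pos: "\<And>a. a \<in> parcs G \<Longrightarrow> 0 < w a"
  shows "capped_metric (pverts G) (parcs G) (capped_dist M) M"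
proof
  fix x y assume xy: "x \<in> pverts G" "y \<in> pverts G" "x \<noteq> y" "capped_dist M x y < M"
  then obtain p where p: "apath x p y" "capped_dist M x y = awalk_cost w p"
    by (metis capped_dist_apath)
  then obtain e p' where "p = e # p'" using xy(3) by (cases p) (auto simp: apath_Nil_iff)
  then obtain z where pz: "p = (x, z) # p'" "(x, z) \<in> parcs G" "awalk z p' y"
    using p(1) by (cases e) (auto simp: apath_def awalk_Cons_iff)
  have zV: "z \<in> pverts G" using wellformed'(2)[OF pz(2)] .
  have "capped_dist M x z \<le> w (x, z)"
    using capped_dist_le_awalk[of x "[(x, z)]" z M] pz(2) zV by (simp add: awalk_simps)
  moreover have "capped_dist M z y \<le> awalk_cost w p'"
    using pz(3) by (rule capped_dist_le_awalk)
  moreover have "capped_dist M x y \<le> capped_dist M x z + capped_dist M z y"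
    using M by (intro capped_dist_triangle) simp
  moreover have "0 < w (x, z)" using pos pz(2) .
  ultimately have "capped_dist M x y = capped_dist M x z + capped_dist M z y"
    "capped_dist M z y < capped_dist M x y"
    using p(2) pz(1) by auto
  then show "\<exists>z\<in>pverts G. (x, z) \<in> parcs G \<and> capped_dist M x y = capped_dist M x z + capped_dist M z y \<and>
      capped_dist M z y < capped_dist M x y"
    using pz(2) zV by blast
next
  show "capped_dist M x y = capped_dist M y x" for x y by (rule capped_dist_sym)
  show "capped_dist M x z \<le> capped_dist M x y + capped_dist M y z" for x y z
    using M by (intro capped_dist_triangle) simp
qed (use M capped_dist_self capped_dist_nonneg sym_parcs pair_finite_verts in auto)

end

lemma sym_weightedI: "weighted_graph G w \<Longrightarrow> sym_weighted G w"
  by (auto simp: weighted_graph_def sym_weighted_def sym_weighted_axioms_def)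

text \<open>Making all weights positive gives every vertex a unique nearest centre that is itself
  whenever it is a centre, even if the original graph has arcs of weight zero.\<close>

lemma positive_perturbation:
  assumes "sym_weighted G w" "0 < \<rho>"
  shows "\<exists>w' \<rho>'. sym_weighted G w' \<and> (\<forall>a\<in>parcs G. 0 < w' a) \<and> 0 < \<rho>' \<and>
    (\<forall>x\<in>pverts G. \<forall>y\<in>pverts G. graph_dist G w' x y \<le> ereal \<rho>' \<longleftrightarrow> graph_dist G w x y \<le> ereal \<rho>)"
proof -
  interpret sym_weighted G w by fact
  define n where "n = card (pverts G)"
  define F where "F = {real_of_ereal (\<mu> w x y) - \<rho> | x y. x \<in> pverts G \<and> y \<in> pverts G \<and>
    ereal \<rho> < \<mu> w x y \<and> \<mu> w x y < \<infinity>}"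
  \<comment> \<open>The least gap by which a finite distance exceeds \<rho>; the inserted 1 covers
    the case that there is none.\<close>
  define g where "g = Min (insert 1 F)"
  have "F \<subseteq> (\<lambda>(x, y). real_of_ereal (\<mu> w x y) - \<rho>) ` (pverts G \<times> pverts G)"
    by (auto simp: F_def)
  then have finF: "finite F" using pair_finite_verts by (meson finite_SigmaI finite_imageI finite_subset)
  have Fpos: "0 < f" if f: "f \<in> F" for f
  proof -
    obtain x y where xy: "f = real_of_ereal (\<mu> w x y) - \<rho>" "ereal \<rho> < \<mu> w x y" "\<mu> w x y < \<infinity>"
      using f by (auto simp: F_def)
    obtain p where "\<mu> w x y = ereal (awalk_cost w p)" using xy(3) by (rule shortest_apath)
    then show ?thesis using xy by simp
  qed
  have g0: "0 < g" using finF Fpos by (simp add: g_def)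
  \<comment> \<open>A simple path has at most n arcs, so it is lengthened by at most g / 2, exactly
    the amount by which the threshold is raised.\<close>
  define \<delta> where "\<delta> = g / (2 * (real n + 1))"
  define \<rho>' where "\<rho>' = \<rho> + g / 2"
  have \<delta>0: "0 < \<delta>" using g0 by (simp add: \<delta>_def)
  define w' where "w' a = w a + \<delta>" for a
  have cost: "awalk_cost w' p = awalk_cost w p + \<delta> * length p" for p
    by (induction p) (auto simp: w'_def algebra_simps)
  have pos: "\<forall>a\<in>parcs G. 0 < w' a" using w_nonneg \<delta>0 by (force simp: w'_def)
  have sw': "sym_weighted G w'"
    by unfold_locales (use pos w_sym in \<open>auto simp: w'_def less_imp_le\<close>)
  interpret W': sym_weighted G w' by fact
  have "\<mu> w' x y \<le> ereal \<rho>' \<longleftrightarrow> \<mu> w x y \<le> ereal \<rho>" if V: "x \<in> pverts G" "y \<in> pverts G" for x y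
  proof
    assume le: "\<mu> w x y \<le> ereal \<rho>"
    then have "\<mu> w x y < \<infinity>" by auto
    then obtain p where p: "apath x p y" "\<mu> w x y = ereal (awalk_cost w p)" by (rule shortest_apath)
    have "length p \<le> n" using length_apath[OF p(1)] by (simp add: n_def)
    then have "\<delta> * length p \<le> \<delta> * (real n + 1)" using \<delta>0 by (intro mult_left_mono) auto
    also have "\<dots> = g / 2" by (simp add: \<delta>_def field_simps)
    finally have "awalk_cost w' p \<le> \<rho>'" using le p(2) by (simp add: cost \<rho>'_def)
    then show "\<mu> w' x y \<le> ereal \<rho>'"
      using min_cost_le_walk_cost[OF awalkI_apath[OF p(1)], of w'] by (meson ereal_less_eq(3) order_trans)
  next
    assume le: "\<mu> w' x y \<le> ereal \<rho>'"
    then have "\<mu> w' x y < \<infinity>" by auto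
    then obtain p where p: "apath x p y" "\<mu> w' x y = ereal (awalk_cost w' p)"
      by (rule W'.shortest_apath)
    have "\<mu> w x y \<le> ereal (awalk_cost w p)"
      using min_cost_le_walk_cost[OF awalkI_apath[OF p(1)]] .
    also have "awalk_cost w p \<le> \<rho>'" using le p(2) \<delta>0 by (simp add: cost) (smt (verit) mult_nonneg_nonneg of_nat_0_le_iff)
    finally have le': "\<mu> w x y \<le> ereal \<rho>'" by simp
    then have fin: "\<mu> w x y < \<infinity>" by auto
    then obtain q where q: "\<mu> w x y = ereal (awalk_cost w q)" by (rule shortest_apath)
    show "\<mu> w x y \<le> ereal \<rho>"
    proof (rule ccontr)
      \<comment> \<open>Removing \<delta> only shortens paths, so the distance is at most \<rho> + g
        / 2, while by the choice of g it would have to be at least \<rho> + g.\<close>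
      assume "\<not> \<mu> w x y \<le> ereal \<rho>"
      then have "real_of_ereal (\<mu> w x y) - \<rho> \<in> F" using V fin unfolding F_def by fastforce
      then have "g \<le> awalk_cost w q - \<rho>" using finF q by (simp add: g_def)
      then show False using le' q g0 by (simp add: \<rho>'_def)
    qed
  qed
  moreover have "0 < \<rho>'" using assms(2) g0 by (simp add: \<rho>'_def)
  ultimately show ?thesis
    using sw' pos unfolding graph_dist_def by (intro exI[of _ w'] exI[of _ \<rho>']) auto
qed

text \<open>Independence and local optimality depend only on which pairs are within \<rho>. The
  perturbation preserves these pairs, so everything can be argued for positive weights.\<close>

theorem metric_local_optimum_ratio:
  fixes G :: "nat pair_pre_digraph" and \<gamma> :: real
  assumes G: "weighted_graph G w" and \<rho>: "0 < \<rho>"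
    and free: "clique_minor_free (parcs G) (pverts G) h" and h: "0 < h"
    and \<gamma>: "0 < \<gamma>" "\<gamma> \<le> 1" and r: "108 * (sep_const h)\<^sup>2 \<le> \<gamma>\<^sup>2 * real r"
    and L: "metric_independent G w \<rho> L" and O': "metric_independent G w \<rho> O'"
    and opt: "\<And>A R. A \<subseteq> O' - L \<Longrightarrow> R \<subseteq> L - O' \<Longrightarrow> card A + card R \<le> r \<Longrightarrow>
      metric_independent G w \<rho> (L - R \<union> A) \<Longrightarrow> card A \<le> card R"
  shows "(1 - \<gamma>) * card O' \<le> (1 + \<gamma>) * card L"
proof -
  obtain w' \<rho>' where w': "sym_weighted G w'" "\<And>a. a \<in> parcs G \<Longrightarrow> 0 < w' a" "0 < \<rho>'"
    "\<And>x y. x \<in> pverts G \<Longrightarrow> y \<in> pverts G \<Longrightarrow>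
      graph_dist G w' x y \<le> ereal \<rho>' \<longleftrightarrow> graph_dist G w x y \<le> ereal \<rho>"
    using positive_perturbation[OF sym_weightedI[OF G] \<rho>] by blast
  interpret sym_weighted G w' by fact
  let ?M = "\<rho>' + 1"
  interpret capped_metric "pverts G" "parcs G" "capped_dist ?M" ?M
    using w'(2,3) by (intro capped_metric_if_pos) auto
  have indep: "metric_independent G w \<rho> S \<longleftrightarrow> S \<subseteq> pverts G \<and> separated \<rho>' S" for S
  proof -
    have "ereal \<rho> < graph_dist G w x y \<longleftrightarrow> \<rho>' < capped_dist ?M x y"
      if "x \<in> pverts G" "y \<in> pverts G" for x y
      using w'(4)[OF that] capped_dist_le_iff[of \<rho>' ?M x y] unfolding graph_dist_def
      by (simp add: not_le[symmetric])
    then show ?thesis unfolding metric_independent_def separated_def by (meson subsetD)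
  qed
  show ?thesis
  proof (rule local_optimum_ratio[OF free h \<gamma> r])
    fix A R assume *: "A \<subseteq> O' - L" "R \<subseteq> L - O'" "card A + card R \<le> r" "separated \<rho>' (L - R \<union> A)"
    have "metric_independent G w \<rho> (L - R \<union> A)"
      using * L O' unfolding indep by blast
    then show "card A \<le> card R" using opt * by blast
  qed (use L O' indep in auto)
qed

section \<open>From an excluded minor to an excluded clique minor\<close>

lemma conn_imp_connected:
  assumes "sym E" "E = parcs G" "conn E T" "T \<subseteq> pverts G"
  shows "Digraph_Component.connected (with_proj G \<restriction> T)"
proof -
  have arcs: "arcs_ends (with_proj G \<restriction> T) = E \<inter> T \<times> T"
    using assms(2) by (auto simp: arcs_ends_conv induce_subgraph_def image_def)
  have "(u, v) \<in> rtrancl_on T ((E \<inter> T \<times> T)\<^sup>s)" if "u \<in> T" "v \<in> T" for u v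
  proof -
    have "(u, v) \<in> (E \<inter> T \<times> T)\<^sup>*" using assms(3) that by (auto simp: conn_def)
    then show ?thesis
    proof (induction rule: rtrancl_induct)
      case base
      then show ?case using that by simp
    next
      case (step y z)
      have "(y, z) \<in> (E \<inter> T \<times> T)\<^sup>s" using step.hyps(2) by (simp add: symcl_def)
      moreover have "z \<in> T" using step.hyps(2) by simp
      ultimately show ?case using step.IH by (blast intro: rtrancl_on_into_rtrancl_on)
    qed
  qed
  then show ?thesis
    using assms(3) unfolding connected_conv arcs by (auto simp: conn_def induce_subgraph_def)
qed

text \<open>A clique model with as many branch sets as H has vertices serves as a model of H under
  any bijection, as arcs of H join distinct vertices. All later constants depend on H through this
  number alone.\<close>

lemma clique_minor_free_if_minor_free:
  assumes H: "pair_graph H" and G: "pair_graph G" and free: "minor_free H G"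
  shows "clique_minor_free (parcs G) (pverts G) (card (pverts H))"
  unfolding clique_minor_free_def
proof
  interpret H: pair_graph H by fact
  interpret G: pair_graph G by fact
  have symG: "sym (parcs G)" using G.sym_arcs by (auto simp: symmetric_conv sym_def)
  assume "\<exists>I C. clique_model (parcs G) I C \<and> card I = card (pverts H) \<and> (\<forall>i\<in>I. C i \<subseteq> pverts G)"
  then obtain I C where I: "clique_model (parcs G) I C" "card I = card (pverts H)"
    "\<And>i. i \<in> I \<Longrightarrow> C i \<subseteq> pverts G" by blast
  have fin: "finite I" using I(1) by (simp add: clique_model_def)
  obtain f where f: "bij_betw f (pverts H) I"
    using finite_same_card_bij[OF H.pair_finite_verts fin] I(2) by auto
  have fI: "f x \<in> I" if "x \<in> pverts H" for x using f that by (auto simp: bij_betw_def)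
  have finj: "f x \<noteq> f y" if "x \<in> pverts H" "y \<in> pverts H" "x \<noteq> y" for x y
    using f that by (auto simp: bij_betw_def inj_on_def)
  have "minor H G"
    unfolding minor_def
  proof (intro exI[of _ "\<lambda>x. C (f x)"] conjI ballI impI)
    fix x assume x: "x \<in> pverts H"
    show "C (f x) \<subseteq> pverts G" using I(3) fI x by blast
    then show "Digraph_Component.connected (with_proj G \<restriction> C (f x))"
      using I(1) fI[OF x] by (intro conn_imp_connected[OF symG refl]) (auto simp: clique_model_def)
  next
    fix x y assume "x \<in> pverts H" "y \<in> pverts H" "x \<noteq> y"
    then show "C (f x) \<inter> C (f y) = {}" using I(1) fI finj unfolding clique_model_def by blast
  next
    fix e assume e: "e \<in> parcs H"
    obtain x y where xy: "e = (x, y)" by force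
    have "x \<in> pverts H" "y \<in> pverts H" "x \<noteq> y"
      using e H.wellformed' H.no_loops' unfolding xy by auto
    then show "case e of (x, y) \<Rightarrow> \<exists>u\<in>C (f x). \<exists>v\<in>C (f y). (u, v) \<in> parcs G"
      using I(1) fI finj unfolding clique_model_def xy by simp
  qed
  then show False using free by (simp add: minor_free_def)
qed

text \<open>The null graph is a minor of every graph.\<close>

lemma minor_free_nonempty: "pair_graph H \<Longrightarrow> minor_free H G \<Longrightarrow> 0 < card (pverts H)"
proof -
  assume H: "pair_graph H" and free: "minor_free H G"
  interpret pair_graph H by fact
  have "pverts H \<noteq> {}"
  proof
    assume "pverts H = {}"
    then have "parcs H = {}" using wellformed' by auto
    then show False using free \<open>pverts H = {}\<close> by (auto simp: minor_free_def minor_def)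
  qed
  then show ?thesis using pair_finite_verts by (simp add: card_gt_0_iff)
qed

section \<open>A structured language for the machine\<close>

text \<open>Register 2 holds 0 and register 3 holds 1, so that \<^term>\<open>JumpNLess 2 3 l\<close> is an
  unconditional jump.\<close>

datatype com =
    Basic instr
  | Seq com com (infixr \<open>;;\<close> 60)
  | IfN nat nat com
  | IfR nat nat com
  | For nat nat com

fun is_jump :: "instr \<Rightarrow> bool" where
  "is_jump (JumpNLess i j l) = True"
| "is_jump (JumpRLess i j l) = True"
| "is_jump _ = False"

fun instr_writes :: "instr \<Rightarrow> nat set" where
  "instr_writes (NConst i c) = {i}"
| "instr_writes (NAdd i j k) = {i}"
| "instr_writes (NSub i j k) = {i}"
| "instr_writes (NLoad i j) = {i}"
| "instr_writes _ = {}"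

primrec writes :: "com \<Rightarrow> nat set" where
  "writes (Basic x) = instr_writes x"
| "writes (c ;; d) = writes c \<union> writes d"
| "writes (IfN i j c) = writes c"
| "writes (IfR i j c) = writes c"
| "writes (For i b c) = insert i (writes c)"

primrec bounds :: "com \<Rightarrow> nat set" where
  "bounds (Basic x) = {}"
| "bounds (c ;; d) = bounds c \<union> bounds d"
| "bounds (IfN i j c) = bounds c"
| "bounds (IfR i j c) = bounds c"
| "bounds (For i b c) = insert b (bounds c)"

primrec wf_com :: "com \<Rightarrow> bool" where
  "wf_com (Basic x) \<longleftrightarrow> \<not> is_jump x"
| "wf_com (c ;; d) \<longleftrightarrow> wf_com c \<and> wf_com d"
| "wf_com (IfN i j c) \<longleftrightarrow> wf_com c"
| "wf_com (IfR i j c) \<longleftrightarrow> wf_com c"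
| "wf_com (For i b c) \<longleftrightarrow> wf_com c \<and> i \<noteq> b \<and> i \<notin> writes c \<and> b \<notin> writes c"

definition set_nreg :: "nat \<Rightarrow> nat \<Rightarrow> config \<Rightarrow> config" where
  "set_nreg i x s = s\<lparr>nreg := (nreg s)(i := x)\<rparr>"

text \<open>A total function suffices because the number of rounds is read from the bound register
  on entry. The program counter is carried along without being read.\<close>

primrec sem :: "com \<Rightarrow> config \<Rightarrow> config" where
  "sem (Basic x) = exec x"
| "sem (c ;; d) = (\<lambda>s. sem d (sem c s))"
| "sem (IfN i j c) = (\<lambda>s. if nreg s i < nreg s j then sem c s else s)"
| "sem (IfR i j c) = (\<lambda>s. if rreg s i < rreg s j then sem c s else s)"
| "sem (For i b c) = (\<lambda>s. ((\<lambda>s. set_nreg i (Suc (nreg s i)) (sem c s)) ^^ nreg s b) (set_nreg i 0 s))"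

primrec code_size :: "com \<Rightarrow> nat" where
  "code_size (Basic x) = 1"
| "code_size (c ;; d) = code_size c + code_size d"
| "code_size (IfN i j c) = code_size c + 2"
| "code_size (IfR i j c) = code_size c + 2"
| "code_size (For i b c) = code_size c + 5"

text \<open>Jumps are absolute, hence the start address \<open>l\<close>. A successful test jumps
  over the unconditional jump that leads past the body.\<close>

primrec compile :: "nat \<Rightarrow> com \<Rightarrow> program" where
  "compile l (Basic x) = [x]"
| "compile l (c ;; d) = compile l c @ compile (l + code_size c) d"
| "compile l (IfN i j c) = [JumpNLess i j (l + 2), JumpNLess 2 3 (l + 2 + code_size c)] @ compile (l + 2) c"
| "compile l (IfR i j c) = [JumpRLess i j (l + 2), JumpNLess 2 3 (l + 2 + code_size c)] @ compile (l + 2) c"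
| "compile l (For i b c) =
     [NConst i 0, JumpNLess i b (l + 3), JumpNLess 2 3 (l + 5 + code_size c)] @
     compile (l + 3) c @ [NAdd i i 3, JumpNLess 2 3 (l + 1)]"

text \<open>\<open>N\<close> stands for a common bound on all loop bounds. A loop spends one step on
  initialisation and two on leaving; each round adds the test, the increment and the jump
  back.\<close>

primrec time_bound :: "com \<Rightarrow> nat \<Rightarrow> nat" where
  "time_bound (Basic x) N = 1"
| "time_bound (c ;; d) N = time_bound c N + time_bound d N"
| "time_bound (IfN i j c) N = time_bound c N + 2"
| "time_bound (IfR i j c) N = time_bound c N + 2"
| "time_bound (For i b c) N = 3 + N * (time_bound c N + 3)"

primrec loop_depth :: "com \<Rightarrow> nat" where
  "loop_depth (Basic x) = 0"
| "loop_depth (c ;; d) = max (loop_depth c) (loop_depth d)"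
| "loop_depth (IfN i j c) = loop_depth c"
| "loop_depth (IfR i j c) = loop_depth c"
| "loop_depth (For i b c) = Suc (loop_depth c)"

lemma length_compile: "length (compile l c) = code_size c"
  by (induction c arbitrary: l) auto

lemma time_bound_poly: "time_bound c N \<le> code_size c * (N + 1) ^ loop_depth c"
proof (induction c)
  case (Seq c d)
  let ?m = "max (loop_depth c) (loop_depth d)"
  have "code_size c * (N + 1) ^ loop_depth c \<le> code_size c * (N + 1) ^ ?m"
    "code_size d * (N + 1) ^ loop_depth d \<le> code_size d * (N + 1) ^ ?m"
    by (intro mult_left_mono power_increasing; simp)+
  then show ?case using Seq unfolding time_bound.simps loop_depth.simps code_size.simps
    by (simp only: add_mult_distrib)
next
  case (For i b c)
  let ?p = "(N + 1) ^ loop_depth c"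
  have "1 \<le> ?p" by simp
  have "3 + N * (time_bound c N + 3) \<le> (N + 1) * (time_bound c N + 3)" by simp
  also have "\<dots> \<le> (N + 1) * (time_bound c N + 3 * ?p)"
    using \<open>1 \<le> ?p\<close> by (intro mult_left_mono) auto
  also have "\<dots> \<le> (N + 1) * (code_size c * ?p + 5 * ?p)"
    using For by (intro mult_left_mono add_mono) auto
  finally show ?case by (simp add: algebra_simps)
next
  case (IfN i j c)
  have "1 \<le> (N + 1) ^ loop_depth c" by simp
  then show ?case using IfN
    unfolding time_bound.simps loop_depth.simps code_size.simps add_mult_distrib by linarith
next
  case (IfR i j c)
  have "1 \<le> (N + 1) ^ loop_depth c" by simp
  then show ?case using IfR
    unfolding time_bound.simps loop_depth.simps code_size.simps add_mult_distrib by linarith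
qed simp

lemma set_nreg_simps [simp]:
  "nreg (set_nreg i x s) = (nreg s)(i := x)" "rreg (set_nreg i x s) = rreg s"
  "nmem (set_nreg i x s) = nmem s" "rmem (set_nreg i x s) = rmem s" "pc (set_nreg i x s) = pc s"
  "set_nreg i x (s\<lparr>pc := l\<rparr>) = (set_nreg i x s)\<lparr>pc := l\<rparr>"
  by (simp_all add: set_nreg_def)

lemma exec_set_nreg:
  "exec (NConst i c) s = set_nreg i c s"
  "exec (NAdd i j k) s = set_nreg i (nreg s j + nreg s k) s"
  "exec (NSub i j k) s = set_nreg i (nreg s j - nreg s k) s"
  "exec (NLoad i j) s = set_nreg i (nmem s (nreg s j)) s"
  by (simp_all add: set_nreg_def)

lemma exec_pc: "\<not> is_jump x \<Longrightarrow> exec x (s\<lparr>pc := l\<rparr>) = (exec x s)\<lparr>pc := l\<rparr>"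
  by (cases x) auto

lemma exec_writes: "r \<notin> instr_writes x \<Longrightarrow> nreg (exec x s) r = nreg s r"
  by (cases x) auto

lemma sem_pc: "wf_com c \<Longrightarrow> sem c (s\<lparr>pc := l\<rparr>) = (sem c s)\<lparr>pc := l\<rparr>"
proof (induction c arbitrary: s)
  case (For i b c)
  let ?F = "\<lambda>s. set_nreg i (Suc (nreg s i)) (sem c s)"
  have "(?F ^^ k) (s\<lparr>pc := l\<rparr>) = ((?F ^^ k) s)\<lparr>pc := l\<rparr>" for k s
    by (induction k) (use For in auto)
  then show ?case by simp
qed (auto simp: exec_pc)

lemma sem_writes: "r \<notin> writes c \<Longrightarrow> nreg (sem c s) r = nreg s r"
proof (induction c arbitrary: s)
  case (For i b c)
  let ?F = "\<lambda>s. set_nreg i (Suc (nreg s i)) (sem c s)"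
  have "nreg ((?F ^^ k) s) r = nreg s r" for k s
    by (induction k) (use For in auto)
  then show ?case using For.prems by simp
qed (auto simp: exec_writes)

text \<open>The rule supplies the counter value and the unchanged bound in each round, so invariants
  need not carry them. \<open>Inv j\<close> describes the state when the counter has just been set
  to j.\<close>

lemma sem_For:
  assumes wf: "wf_com (For i b c)"
    and init: "Inv 0 (set_nreg i 0 s)"
    and step: "\<And>j s'. j < nreg s b \<Longrightarrow> nreg s' i = j \<Longrightarrow> nreg s' b = nreg s b \<Longrightarrow> Inv j s' \<Longrightarrow>
      Inv (Suc j) (set_nreg i (Suc j) (sem c s'))"
  shows "Inv (nreg s b) (sem (For i b c) s)"
proof -
  let ?F = "\<lambda>s. set_nreg i (Suc (nreg s i)) (sem c s)"
  have "k \<le> nreg s b \<Longrightarrow> (let s' = (?F ^^ k) (set_nreg i 0 s) in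
    Inv k s' \<and> nreg s' i = k \<and> nreg s' b = nreg s b)" for k
  proof (induction k)
    case 0
    then show ?case using init wf by simp
  next
    case (Suc k)
    then show ?case using step[of k "(?F ^^ k) (set_nreg i 0 s)"] wf
      by (simp add: Let_def sem_writes)
  qed
  from this[of "nreg s b"] show ?thesis by (simp add: Let_def)
qed

section \<open>Compiled code and its running time\<close>

definition code_at :: "program \<Rightarrow> nat \<Rightarrow> program \<Rightarrow> bool" where
  "code_at P l xs \<longleftrightarrow> (\<exists>pre post. P = pre @ xs @ post \<and> length pre = l)"

lemma code_at_append:
  assumes "code_at P l (xs @ ys)"
  shows "code_at P l xs" "code_at P (l + length xs) ys"
proof -
  obtain pre post where "P = pre @ (xs @ ys) @ post" "length pre = l"
    using assms by (auto simp: code_at_def)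
  then have "P = pre @ xs @ (ys @ post)" "P = (pre @ xs) @ ys @ post" "length (pre @ xs) = l + length xs"
    by auto
  then show "code_at P l xs" "code_at P (l + length xs) ys"
    unfolding code_at_def using \<open>length pre = l\<close> by blast+
qed

lemma code_at_Cons:
  assumes "code_at P l (x # xs)"
  shows "l < length P" "P ! l = x" "code_at P (Suc l) xs"
proof -
  obtain pre post where P: "P = pre @ (x # xs) @ post" "length pre = l"
    using assms by (auto simp: code_at_def)
  then show "l < length P" "P ! l = x" by (auto simp: nth_append)
  show "code_at P (Suc l) xs" using code_at_append(2)[of P l "[x]" xs] assms by simp
qed

lemma step_code_at:
  assumes "code_at P l (x # xs)" "pc s = l"
  shows "step P s = exec x (s\<lparr>pc := Suc l\<rparr>)"
  using code_at_Cons[OF assms(1)] assms(2) by (simp add: step_def halted_def)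

definition reaches :: "program \<Rightarrow> nat \<Rightarrow> config \<Rightarrow> config \<Rightarrow> bool" where
  "reaches P T s s' \<longleftrightarrow> (\<exists>t\<le>T. (step P ^^ t) s = s')"

lemma reaches_refl: "reaches P T s s"
  by (auto simp: reaches_def intro: exI[of _ 0])

lemma reaches_trans: "reaches P T s s' \<Longrightarrow> reaches P T' s' s'' \<Longrightarrow> reaches P (T + T') s s''"
  unfolding reaches_def by (metis (no_types, lifting) add.commute add_mono comp_apply funpow_add)

lemma reaches_step: "step P s = s' \<Longrightarrow> reaches P T s' s'' \<Longrightarrow> reaches P (Suc T) s s''"
  unfolding reaches_def by (metis Suc_le_mono comp_apply funpow_Suc_right)

lemma reaches_mono: "reaches P T s s' \<Longrightarrow> T \<le> T' \<Longrightarrow> reaches P T' s s'"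
  unfolding reaches_def using le_trans by blast

text \<open>No bound register is written by the command, so the bound \<open>N\<close> assumed at
  the start stays valid in every nested loop.\<close>

theorem compile_correct:
  assumes "wf_com c" "code_at P l (compile l c)" "pc s = l"
    and "nreg s 2 = 0" "nreg s 3 = 1" "{2, 3} \<inter> writes c = {}"
    and "\<forall>b\<in>bounds c. nreg s b \<le> N" "bounds c \<inter> writes c = {}"
  shows "reaches P (time_bound c N) s ((sem c s)\<lparr>pc := l + code_size c\<rparr>)"
  using assms
proof (induction c arbitrary: l s)
  case (Basic x)
  have "step P s = (exec x s)\<lparr>pc := Suc l\<rparr>"
    using step_code_at[where l = l and x = x and xs = "[]"] Basic exec_pc[where x = x and s = s and l = "Suc l"] by simp
  then show ?case by (auto intro: reaches_step reaches_refl)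
next
  case (Seq c d)
  note at = code_at_append[OF Seq.prems(2)[unfolded compile.simps], unfolded length_compile]
  let ?s = "(sem c s)\<lparr>pc := l + code_size c\<rparr>"
  have 1: "reaches P (time_bound c N) s ?s"
    by (rule Seq.IH(1)[OF _ at(1)]) (use Seq.prems in auto)
  have r: "nreg (sem c s) b = nreg s b" if "b \<in> {2, 3} \<union> bounds d" for b
    using Seq.prems(6,8) that by (intro sem_writes) auto
  have "reaches P (time_bound d N) ?s ((sem d ?s)\<lparr>pc := l + code_size c + code_size d\<rparr>)"
    by (rule Seq.IH(2)[OF _ at(2)]) (use Seq.prems r in auto)
  with 1 show ?case
    using Seq.prems(1) by (auto simp: sem_pc add.assoc intro: reaches_trans)
next
  case (IfN i j c)
  note at = code_at_Cons[OF IfN.prems(2)[unfolded compile.simps append.simps]]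
  note at2 = code_at_Cons[OF at(3)]
  show ?case
  proof (cases "nreg s i < nreg s j")
    case True
    have "step P s = s\<lparr>pc := l + 2\<rparr>" using at(1,2) IfN.prems(3) True by (simp add: step_def halted_def)
    moreover have "reaches P (time_bound c N) (s\<lparr>pc := l + 2\<rparr>)
        ((sem c (s\<lparr>pc := l + 2\<rparr>))\<lparr>pc := l + 2 + code_size c\<rparr>)"
      by (rule IfN.IH) (use IfN.prems at2(3) in auto)
    ultimately have "reaches P (Suc (time_bound c N)) s
        ((sem c (s\<lparr>pc := l + 2\<rparr>))\<lparr>pc := l + 2 + code_size c\<rparr>)"
      by (rule reaches_step)
    then show ?thesis using True IfN.prems(1)
      by (auto simp: sem_pc add_ac elim: reaches_mono)
  next
    case False
    have "step P s = s\<lparr>pc := l + 1\<rparr>" using at(1,2) IfN.prems(3) False by (simp add: step_def halted_def)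
    moreover have "step P (s\<lparr>pc := l + 1\<rparr>) = s\<lparr>pc := l + 2 + code_size c\<rparr>"
      using at2(1,2) IfN.prems(4,5) by (simp add: step_def halted_def)
    ultimately have "reaches P 2 s (s\<lparr>pc := l + 2 + code_size c\<rparr>)"
      using reaches_step[OF _ reaches_step[OF _ reaches_refl[of P 0]], of s] by (simp add: numeral_2_eq_2)
    then show ?thesis using False by (auto simp: add_ac elim: reaches_mono)
  qed
next
  case (IfR i j c)
  note at = code_at_Cons[OF IfR.prems(2)[unfolded compile.simps append.simps]]
  note at2 = code_at_Cons[OF at(3)]
  show ?case
  proof (cases "rreg s i < rreg s j")
    case True
    have "step P s = s\<lparr>pc := l + 2\<rparr>" using at(1,2) IfR.prems(3) True by (simp add: step_def halted_def)
    moreover have "reaches P (time_bound c N) (s\<lparr>pc := l + 2\<rparr>)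
        ((sem c (s\<lparr>pc := l + 2\<rparr>))\<lparr>pc := l + 2 + code_size c\<rparr>)"
      by (rule IfR.IH) (use IfR.prems at2(3) in auto)
    ultimately have "reaches P (Suc (time_bound c N)) s
        ((sem c (s\<lparr>pc := l + 2\<rparr>))\<lparr>pc := l + 2 + code_size c\<rparr>)"
      by (rule reaches_step)
    then show ?thesis using True IfR.prems(1)
      by (auto simp: sem_pc add_ac elim: reaches_mono)
  next
    case False
    have "step P s = s\<lparr>pc := l + 1\<rparr>" using at(1,2) IfR.prems(3) False by (simp add: step_def halted_def)
    moreover have "step P (s\<lparr>pc := l + 1\<rparr>) = s\<lparr>pc := l + 2 + code_size c\<rparr>"
      using at2(1,2) IfR.prems(4,5) by (simp add: step_def halted_def)
    ultimately have "reaches P 2 s (s\<lparr>pc := l + 2 + code_size c\<rparr>)"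
      using reaches_step[OF _ reaches_step[OF _ reaches_refl[of P 0]], of s] by (simp add: numeral_2_eq_2)
    then show ?thesis using False by (auto simp: add_ac elim: reaches_mono)
  qed
next
  case (For i b c)
  note a1 = code_at_Cons[OF For.prems(2)[unfolded compile.simps append.simps]]
  note a2 = code_at_Cons[OF a1(3)]
  note a3 = code_at_Cons[OF a2(3)]
  note body = code_at_append[OF a3(3), unfolded length_compile]
  note a4 = code_at_Cons[OF body(2)]
  note a5 = code_at_Cons[OF a4(3)]
  let ?F = "\<lambda>s. set_nreg i (Suc (nreg s i)) (sem c s)"
  let ?end = "l + code_size (For i b c)"
  let ?T = "time_bound c N"
  let ?S = "\<lambda>k. (?F ^^ k) (set_nreg i 0 s)"
  have wf: "wf_com c" "i \<noteq> b" "i \<notin> writes c" "b \<notin> writes c" using For.prems(1) by auto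
  have reg: "nreg (?S k) r = nreg s r" if "r \<notin> writes (For i b c)" for k r
    by (induction k) (use that in \<open>auto simp: sem_writes\<close>)
  have counter: "nreg (?S k) i = k" for k
    by (induction k) (use wf(3) in \<open>auto simp: sem_writes\<close>)
  have fixed: "nreg (?S k) 2 = 0" "nreg (?S k) 3 = 1" "nreg (?S k) b = nreg s b"
    for k
    using reg[of _ k] For.prems(4-8) wf by auto
  have fixed_bounds: "\<forall>b\<in>bounds c. nreg (?S k) b \<le> N" for k
  proof
    fix b' assume "b' \<in> bounds c"
    then have "b' \<notin> writes (For i b c)" "nreg s b' \<le> N" using For.prems(7,8) by auto
    then show "nreg (?S k) b' \<le> N" using reg by simp
  qed
  \<comment> \<open>Induction on the number k of remaining rounds, so that each step prepends one
    round to a run that already reaches the end.\<close>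
  have loop: "k \<le> nreg s b \<Longrightarrow> reaches P (2 + k * (?T + 3)) ((?S (nreg s b - k))\<lparr>pc := l + 1\<rparr>)
      ((?S (nreg s b))\<lparr>pc := ?end\<rparr>)" for k
  proof (induction k)
    case 0
    let ?s = "?S (nreg s b)"
    have "step P (?s\<lparr>pc := l + 1\<rparr>) = ?s\<lparr>pc := l + 2\<rparr>"
      using a2(1,2) by (simp add: step_def halted_def counter fixed)
    moreover have "step P (?s\<lparr>pc := l + 2\<rparr>) = ?s\<lparr>pc := ?end\<rparr>"
      using a3(1,2) by (simp add: step_def halted_def fixed add_ac)
    ultimately show ?case
      using reaches_step[OF _ reaches_step[OF _ reaches_refl[of P 0]]] by (simp add: numeral_2_eq_2)
  next
    case (Suc k)
    define m where "m = nreg s b - Suc k"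
    have m: "nreg s b - k = Suc m" "m < nreg s b" using Suc.prems by (auto simp: m_def)
    let ?s = "?S m"
    have "step P (?s\<lparr>pc := l + 1\<rparr>) = ?s\<lparr>pc := l + 3\<rparr>"
      using a2(1,2) m(2) by (simp add: step_def halted_def counter fixed)
    moreover have "reaches P ?T (?s\<lparr>pc := l + 3\<rparr>) ((sem c ?s)\<lparr>pc := l + 3 + code_size c\<rparr>)"
    proof -
      have "reaches P ?T (?s\<lparr>pc := l + 3\<rparr>) ((sem c (?s\<lparr>pc := l + 3\<rparr>))\<lparr>pc := l + 3 + code_size c\<rparr>)"
      proof (rule For.IH)
        have e: "Suc (Suc (Suc l)) = l + 3" by simp
        show "code_at P (l + 3) (compile (l + 3) c)" using body(1) unfolding e .
      qed (use For.prems fixed fixed_bounds wf in auto)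
      then show ?thesis by (simp add: sem_pc wf)
    qed
    moreover have "step P ((sem c ?s)\<lparr>pc := l + 3 + code_size c\<rparr>) = (?S (Suc m))\<lparr>pc := l + 4 + code_size c\<rparr>"
    proof -
      have "nreg (sem c ?s) i = m" "nreg (sem c ?s) 3 = 1"
        using wf(3) For.prems(6) fixed(2) by (auto simp: sem_writes counter)
      then show ?thesis
        using a4(1,2) by (simp add: step_def halted_def counter exec_set_nreg add_ac eval_nat_numeral)
    qed
    moreover have "step P ((?S (Suc m))\<lparr>pc := l + 4 + code_size c\<rparr>) = (?S (Suc m))\<lparr>pc := l + 1\<rparr>"
      using a5(1,2) fixed[of "Suc m"] by (simp add: step_def halted_def add_ac eval_nat_numeral del: funpow.simps)
    moreover have "reaches P (2 + k * (?T + 3)) ((?S (Suc m))\<lparr>pc := l + 1\<rparr>) ((?S (nreg s b))\<lparr>pc := ?end\<rparr>)"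
      using Suc.IH Suc.prems m(1) by simp
    ultimately have "reaches P (Suc (?T + Suc (Suc (2 + k * (?T + 3))))) (?s\<lparr>pc := l + 1\<rparr>)
        ((?S (nreg s b))\<lparr>pc := ?end\<rparr>)"
      by (intro reaches_step[OF _ reaches_trans[OF _ reaches_step[OF _ reaches_step]]])
    then show ?case unfolding m_def[symmetric] by (rule reaches_mono) (simp add: algebra_simps)
  qed
  have "step P s = (?S 0)\<lparr>pc := l + 1\<rparr>"
    using a1(1,2) For.prems(3) by (simp add: step_def halted_def set_nreg_def)
  then have "reaches P (Suc (2 + nreg s b * (?T + 3))) s ((?S (nreg s b))\<lparr>pc := ?end\<rparr>)"
    using loop[of "nreg s b"] by (intro reaches_step) auto
  then show ?case
    using For.prems(7) by (auto elim!: reaches_mono)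
qed

section \<open>Frame properties of real registers and memories\<close>

fun instr_rwrites :: "instr \<Rightarrow> nat set" where
  "instr_rwrites (ROne i) = {i}"
| "instr_rwrites (RAdd i j k) = {i}"
| "instr_rwrites (RSub i j k) = {i}"
| "instr_rwrites (RLoad i j) = {i}"
| "instr_rwrites _ = {}"

fun no_nstore_instr :: "instr \<Rightarrow> bool" where
  "no_nstore_instr (NStore i j) = False"
| "no_nstore_instr _ = True"

fun no_rstore_instr :: "instr \<Rightarrow> bool" where
  "no_rstore_instr (RStore i j) = False"
| "no_rstore_instr _ = True"

primrec rwrites :: "com \<Rightarrow> nat set" where
  "rwrites (Basic x) = instr_rwrites x"
| "rwrites (c ;; d) = rwrites c \<union> rwrites d"
| "rwrites (IfN i j c) = rwrites c"
| "rwrites (IfR i j c) = rwrites c"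
| "rwrites (For i b c) = rwrites c"

primrec no_nstore :: "com \<Rightarrow> bool" where
  "no_nstore (Basic x) = no_nstore_instr x"
| "no_nstore (c ;; d) \<longleftrightarrow> no_nstore c \<and> no_nstore d"
| "no_nstore (IfN i j c) = no_nstore c"
| "no_nstore (IfR i j c) = no_nstore c"
| "no_nstore (For i b c) = no_nstore c"

primrec no_rstore :: "com \<Rightarrow> bool" where
  "no_rstore (Basic x) = no_rstore_instr x"
| "no_rstore (c ;; d) \<longleftrightarrow> no_rstore c \<and> no_rstore d"
| "no_rstore (IfN i j c) = no_rstore c"
| "no_rstore (IfR i j c) = no_rstore c"
| "no_rstore (For i b c) = no_rstore c"

lemma exec_rwrites: "r \<notin> instr_rwrites x \<Longrightarrow> rreg (exec x s) r = rreg s r"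
  by (cases x) auto

lemma exec_no_nstore: "no_nstore_instr x \<Longrightarrow> nmem (exec x s) = nmem s"
  by (cases x) auto

lemma exec_no_rstore: "no_rstore_instr x \<Longrightarrow> rmem (exec x s) = rmem s"
  by (cases x) auto

lemma sem_rwrites: "r \<notin> rwrites c \<Longrightarrow> rreg (sem c s) r = rreg s r"
proof (induction c arbitrary: s)
  case (For i b c)
  let ?F = "\<lambda>s. set_nreg i (Suc (nreg s i)) (sem c s)"
  have "rreg ((?F ^^ k) s) r = rreg s r" for k s
    by (induction k) (use For in auto)
  then show ?case by simp
qed (auto simp: exec_rwrites)

lemma sem_no_nstore: "no_nstore c \<Longrightarrow> nmem (sem c s) = nmem s"
proof (induction c arbitrary: s)
  case (For i b c)
  let ?F = "\<lambda>s. set_nreg i (Suc (nreg s i)) (sem c s)"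
  have "nmem ((?F ^^ k) s) = nmem s" for k s
    by (induction k) (use For in auto)
  then show ?case by simp
qed (auto simp: exec_no_nstore)

lemma sem_no_rstore: "no_rstore c \<Longrightarrow> rmem (sem c s) = rmem s"
proof (induction c arbitrary: s)
  case (For i b c)
  let ?F = "\<lambda>s. set_nreg i (Suc (nreg s i)) (sem c s)"
  have "rmem ((?F ^^ k) s) = rmem s" for k s
    by (induction k) (use For in auto)
  then show ?case by simp
qed (auto simp: exec_no_rstore)

text \<open>The equations in applied form keep the simplifier from evaluating programs on
  unknown states under binders.\<close>

lemma sem_eqs:
  "sem (Basic x) s = exec x s"
  "sem (c ;; d) s = sem d (sem c s)"
  "sem (IfN i j c) s = (if nreg s i < nreg s j then sem c s else s)"
  "sem (IfR i j c) s = (if rreg s i < rreg s j then sem c s else s)"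
  by simp_all

lemmas exec_eqs = exec_set_nreg exec.simps(5-10)

declare sem.simps [simp del] exec.simps [simp del]

section \<open>Computing capped distances\<close>

text \<open>
  Natural registers: 0 holds n, 4 holds $n^2$, 5 holds $n+1$, 8 holds the swap size r, 9 holds
  $(n+1)^r$, 10 holds the size of the current set. Real registers: 2 holds $\<rho>$, 3 holds
  $\<rho>+1$, 4 holds 1, 5 holds 0. From address $n^2$ on, the real memory holds the distance matrix
  and the natural memory the characteristic vector of the current set.
\<close>

definition addr :: "nat \<Rightarrow> nat \<Rightarrow> nat \<Rightarrow> com" where
  "addr r u v = Basic (NAdd r v 2) ;; For 30 0 (IfN 30 u (Basic (NAdd r r 0)))"

text \<open>The product u * n is a sum of u copies of n. The loop is bounded by register 0, not by
  u, and adds n only in its first u rounds; this is why u must not exceed n.\<close>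

lemma sem_addr:
  assumes "nreg s 2 = 0" "nreg s u \<le> nreg s 0" "r \<noteq> 0" "r \<noteq> u" "r \<noteq> 30" "u \<noteq> 30"
  shows "sem (addr r u v) s =
    set_nreg 30 (nreg s 0) (set_nreg r (nreg s v + nreg s u * nreg s 0) s)"
proof -
  let ?F = "\<lambda>s. set_nreg 30 (Suc (nreg s 30)) (if nreg s 30 < nreg s u then set_nreg r (nreg s r + nreg s 0) s else s)"
  have "(?F ^^ j) (set_nreg 30 0 (set_nreg r (nreg s v) s)) =
      set_nreg 30 j (set_nreg r (nreg s v + min j (nreg s u) * nreg s 0) s)" for j
  proof (induction j)
    case (Suc j)
    then show ?case using assms by (auto simp: set_nreg_def fun_upd_twist min_def algebra_simps)
  qed (simp add: set_nreg_def)
  from this[of "nreg s 0"] show ?thesis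
    using assms by (simp add: addr_def exec_eqs sem.simps cong: if_cong)
qed

lemma addr_frames [simp]:
  "writes (addr r u v) = {r, 30}" "bounds (addr r u v) = {0}" "rwrites (addr r u v) = {}"
  "no_nstore (addr r u v)" "no_rstore (addr r u v)"
  "wf_com (addr r u v) \<longleftrightarrow> r \<noteq> 0 \<and> r \<noteq> 30"
  by (auto simp: addr_def)

lemma addr_inj:
  fixes u v u' v' n :: nat
  assumes "v < n" "v' < n"
  shows "v + u * n = v' + u' * n \<longleftrightarrow> u = u' \<and> v = v'"
proof
  assume eq: "v + u * n = v' + u' * n"
  have "(v + u * n) mod n = v" "(v' + u' * n) mod n = v'" using assms by auto
  moreover have "(v + u * n) div n = u" "(v' + u' * n) div n = u'" using assms by auto
  ultimately show "u = u' \<and> v = v'" using eq by metis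
qed simp

lemma addr_less:
  fixes u v n :: nat
  assumes "u < n" "v < n"
  shows "v + u * n < n * n"
proof -
  have "v + u * n < Suc u * n" using assms by simp
  also have "\<dots> \<le> n * n" using assms by (intro mult_le_mono1) simp
  finally show ?thesis .
qed

text \<open>One Bellman-Ford relaxation: with u, v, z in registers 11, 12, 15, the entry for (u, z)
  is improved through the arc (v, z).\<close>

definition relax :: com where
  "relax = addr 13 12 15 ;; Basic (NLoad 16 13) ;;
    IfN 2 16 (Basic (RLoad 7 13) ;;
      addr 17 11 12 ;; Basic (NAdd 17 17 4) ;; Basic (RLoad 8 17) ;; Basic (RAdd 7 7 8) ;;
      addr 17 11 15 ;; Basic (NAdd 17 17 4) ;; Basic (RLoad 8 17) ;;
      IfR 7 8 (Basic (RStore 17 7)))"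

definition dist_init :: com where
  "dist_init = For 11 4 (Basic (NAdd 13 11 4) ;; Basic (RStore 13 3)) ;;
    For 11 0 (addr 13 11 11 ;; Basic (NAdd 13 13 4) ;; Basic (RStore 13 5))"

definition relax_round :: com where
  "relax_round = For 11 0 (For 12 0 (For 15 0 relax))"

definition distances :: com where
  "distances = dist_init ;; For 14 0 relax_round"

lemma relax_frames [simp]:
  "writes relax = {13, 16, 17, 30}" "bounds relax = {0}" "rwrites relax = {7, 8}"
  "no_nstore relax" "wf_com relax"
  by (auto simp: relax_def)

section \<open>Invariants of the Bellman-Ford rounds\<close>

locale dist_spec = sym_weighted G w for G :: "nat pair_pre_digraph" and w +
  fixes n :: nat and \<rho> :: real
  assumes verts: "pverts G = {..<n}" and \<rho>: "0 < \<rho>"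
begin

definition loaded :: "config \<Rightarrow> bool" where
  "loaded s \<longleftrightarrow> nreg s 0 = n \<and> nreg s 2 = 0 \<and> nreg s 3 = 1 \<and> nreg s 4 = n * n \<and>
     rreg s 2 = \<rho> \<and> rreg s 3 = \<rho> + 1 \<and> rreg s 5 = 0 \<and>
     (\<forall>u<n. \<forall>v<n. nmem s (v + u * n) = (if (u, v) \<in> parcs G then 1 else 0)) \<and>
     (\<forall>u<n. \<forall>v<n. (u, v) \<in> parcs G \<longrightarrow> rmem s (v + u * n) = w (u, v))"

definition D :: "config \<Rightarrow> nat \<Rightarrow> nat \<Rightarrow> real" where
  "D s u v = rmem s (n * n + (v + u * n))"

lemma loadedD:
  assumes "loaded s"
  shows "nreg s 0 = n" "nreg s 2 = 0" "nreg s 3 = 1" "nreg s 4 = n * n"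
    "rreg s 2 = \<rho>" "rreg s 3 = \<rho> + 1" "rreg s 5 = 0"
    "u < n \<Longrightarrow> v < n \<Longrightarrow> nmem s (v + u * n) = (if (u, v) \<in> parcs G then 1 else 0)"
    "u < n \<Longrightarrow> v < n \<Longrightarrow> (u, v) \<in> parcs G \<Longrightarrow> rmem s (v + u * n) = w (u, v)"
  using assms by (auto simp: loaded_def)

lemma loaded_set_nreg: "loaded (set_nreg i x s) \<longleftrightarrow> loaded s" if "i \<notin> {0, 2, 3, 4}"
  using that by (auto simp: loaded_def)

lemma D_set_nreg [simp]: "D (set_nreg i x s) = D s"
  by (simp add: D_def fun_eq_iff)

lemma loaded_frame:
  assumes "loaded s" "writes c \<inter> {0, 2, 3, 4} = {}" "rwrites c \<inter> {2, 3, 5} = {}" "no_nstore c"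
    and "\<And>a. a < n * n \<Longrightarrow> rmem (sem c s) a = rmem s a"
  shows "loaded (sem c s)"
proof -
  have "nreg (sem c s) r = nreg s r" if "r \<in> {0, 2, 3, 4}" for r
    using assms(2) that by (intro sem_writes) auto
  moreover have "rreg (sem c s) r = rreg s r" if "r \<in> {2, 3, 5}" for r
    using assms(3) that by (intro sem_rwrites) auto
  ultimately show ?thesis
    using assms(1,4,5) addr_less by (simp add: loaded_def sem_no_nstore)
qed

lemma sem_relax:
  assumes s: "loaded s" and uvz: "nreg s 11 = u" "nreg s 12 = v" "nreg s 15 = z" "u < n" "v < n" "z < n"
  shows "rmem (sem relax s) = (if (v, z) \<in> parcs G \<and> D s u v + w (v, z) < D s u z
      then (rmem s)(n * n + (z + u * n) := D s u v + w (v, z)) else rmem s)"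
proof -
  note l = loadedD[OF s]
  show ?thesis
  proof (cases "(v, z) \<in> parcs G")
    case True
    have "rmem (sem relax s) = (if D s u v + w (v, z) < D s u z
        then (rmem s)(n * n + (z + u * n) := D s u v + w (v, z)) else rmem s)"
      using l(8)[OF uvz(5,6)] l(9)[OF uvz(5,6)] uvz True
      by (simp add: relax_def sem_addr l(1-7) D_def exec_eqs sem_eqs if_distrib[of rmem] add_ac
          cong: if_cong split del: if_split)
    then show ?thesis using True by simp
  next
    case False
    then show ?thesis
      using l(8)[OF uvz(5,6)] uvz
      by (simp add: relax_def sem_addr l(1-7) D_def exec_eqs sem_eqs)
  qed
qed

text \<open>The part of correctness that holds at all times. The diagonal condition is the start of
  the induction on walk length, where the empty walk has cost 0.\<close>

definition approximates :: "config \<Rightarrow> bool" where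
  "approximates s \<longleftrightarrow> loaded s \<and>
     (\<forall>u<n. \<forall>v<n. capped_dist (\<rho> + 1) u v \<le> D s u v \<and> D s u v \<le> \<rho> + 1) \<and> (\<forall>u<n. D s u u \<le> 0)"

lemma approximates_set_nreg:
  "approximates (set_nreg i x s) \<longleftrightarrow> approximates s" if "i \<notin> {0, 2, 3, 4}"
  using that by (simp add: approximates_def loaded_set_nreg)

text \<open>Here \<open>d\<close> is the matrix at the start of a round and \<open>T\<close> the set
  of triples already treated. Updates are made in place, so entries may be ahead of
  \<open>d\<close>; for that reason only upper bounds are claimed.\<close>

definition relaxed :: "(nat \<Rightarrow> nat \<Rightarrow> real) \<Rightarrow> (nat \<times> nat \<times> nat) set \<Rightarrow> config \<Rightarrow> bool" where
  "relaxed d T s \<longleftrightarrow> approximates s \<and> (\<forall>u<n. \<forall>v<n. D s u v \<le> d u v) \<and>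
     (\<forall>u<n. \<forall>v<n. \<forall>z<n. (u, v, z) \<in> T \<longrightarrow> (v, z) \<in> parcs G \<longrightarrow> D s u z \<le> d u v + w (v, z))"

lemma relaxed_set_nreg:
  "relaxed d T (set_nreg i x s) \<longleftrightarrow> relaxed d T s" if "i \<notin> {0, 2, 3, 4}"
  using that by (simp add: relaxed_def approximates_set_nreg)

lemma relaxed_regs: "relaxed d T s \<Longrightarrow> nreg s 0 = n"
  by (simp add: relaxed_def approximates_def loaded_def)

lemma relaxed_relax:
  assumes R: "relaxed d T s"
    and uvz: "nreg s 11 = u" "nreg s 12 = v" "nreg s 15 = z" "u < n" "v < n" "z < n"
  shows "relaxed d (insert (u, v, z) T) (sem relax s)"
proof -
  let ?s = "sem relax s"
  have l: "loaded s" and A: "approximates s" using R by (auto simp: relaxed_def approximates_def)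
  note mem = sem_relax[OF l uvz]
  have D': "D ?s a b = (if (a, b) = (u, z) \<and> (v, z) \<in> parcs G then min (D s u z) (D s u v + w (v, z)) else D s a b)"
    if "a < n" "b < n" for a b
    using that uvz(4-6) addr_inj[of b n z a u] by (auto simp: D_def mem min_def)
  have le: "D ?s a b \<le> D s a b" if "a < n" "b < n" for a b using D'[OF that] by auto
  have "loaded ?s"
    by (rule loaded_frame[OF l]) (auto simp: mem)
  moreover have "capped_dist (\<rho> + 1) a b \<le> D ?s a b" if ab: "a < n" "b < n" for a b
  proof (cases "(a, b) = (u, z) \<and> (v, z) \<in> parcs G")
    case True
    have "capped_dist (\<rho> + 1) u z \<le> capped_dist (\<rho> + 1) u v + capped_dist (\<rho> + 1) v z"
      using \<rho> by (intro capped_dist_triangle) simp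
    also have "\<dots> \<le> D s u v + w (v, z)"
      using A uvz capped_dist_le_awalk[of v "[(v, z)]" z] True verts
      by (auto simp: approximates_def awalk_simps intro!: add_mono)
    finally show ?thesis using D'[OF ab] True A uvz by (simp add: approximates_def)
  next
    case False
    then show ?thesis using D'[OF ab] A ab by (auto simp: approximates_def)
  qed
  ultimately have A': "approximates ?s" using A le by (fastforce simp: approximates_def)
  have "D ?s u z \<le> d u v + w (v, z)" if "(v, z) \<in> parcs G"
    using D'[OF uvz(4,6)] that R uvz(4-6) by (force simp: relaxed_def)
  moreover have "D ?s a b \<le> d a b" if "a < n" "b < n" for a b
    using le[OF that] R that unfolding relaxed_def by (meson order_trans)
  moreover have "D ?s a c \<le> d a b + w (b, c)"
    if "a < n" "b < n" "c < n" "(a, b, c) \<in> T" "(b, c) \<in> parcs G" for a b c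
    using le[OF that(1,3)] R that unfolding relaxed_def by (meson order_trans)
  ultimately show ?thesis using A' unfolding relaxed_def by auto
qed

lemma relaxed_z:
  assumes R: "relaxed d T s" and uv: "nreg s 11 = u" "nreg s 12 = v" "u < n" "v < n"
  shows "relaxed d (T \<union> {(u, v, z) | z. z < n}) (sem (For 15 0 relax) s)"
proof -
  let ?I = "\<lambda>j s. relaxed d (T \<union> {(u, v, z) | z. z < j}) s \<and> nreg s 11 = u \<and> nreg s 12 = v"
  have "?I (nreg s 0) (sem (For 15 0 relax) s)"
  proof (rule sem_For[where Inv = "?I"])
    show "?I 0 (set_nreg 15 0 s)" using R uv by (simp add: relaxed_set_nreg)
  next
    fix j s' assume *: "j < nreg s 0" "nreg s' 15 = j" "?I j s'"
    have "relaxed d (insert (u, v, j) (T \<union> {(u, v, z) | z. z < j})) (sem relax s')"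
      using * uv relaxed_regs[OF R] by (intro relaxed_relax) auto
    moreover have "insert (u, v, j) (T \<union> {(u, v, z) | z. z < j}) = T \<union> {(u, v, z) | z. z < Suc j}"
      by (auto simp: less_Suc_eq)
    ultimately show "?I (Suc j) (set_nreg 15 (Suc j) (sem relax s'))"
      using * by (simp add: relaxed_set_nreg sem_writes)
  qed simp
  then show ?thesis by (simp add: relaxed_regs[OF R])
qed

lemma relaxed_vz:
  assumes R: "relaxed d T s" and u: "nreg s 11 = u" "u < n"
  shows "relaxed d (T \<union> {(u, v, z) | v z. v < n \<and> z < n}) (sem (For 12 0 (For 15 0 relax)) s)"
proof -
  let ?I = "\<lambda>j s. relaxed d (T \<union> {(u, v, z) | v z. v < j \<and> z < n}) s \<and> nreg s 11 = u"
  have "?I (nreg s 0) (sem (For 12 0 (For 15 0 relax)) s)"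
  proof (rule sem_For[where Inv = "?I"])
    show "?I 0 (set_nreg 12 0 s)" using R u by (simp add: relaxed_set_nreg)
  next
    fix j s' assume *: "j < nreg s 0" "nreg s' 12 = j" "?I j s'"
    have "relaxed d (T \<union> {(u, v, z) | v z. v < j \<and> z < n} \<union> {(u, j, z) | z. z < n}) (sem (For 15 0 relax) s')"
      using * u relaxed_regs[OF R] by (intro relaxed_z) auto
    moreover have "T \<union> {(u, v, z) | v z. v < j \<and> z < n} \<union> {(u, j, z) | z. z < n} =
        T \<union> {(u, v, z) | v z. v < Suc j \<and> z < n}"
      by (auto simp: less_Suc_eq)
    ultimately show "?I (Suc j) (set_nreg 12 (Suc j) (sem (For 15 0 relax) s'))"
      using * by (simp add: relaxed_set_nreg sem_writes)
  qed simp
  then show ?thesis by (simp add: relaxed_regs[OF R])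
qed

lemma relaxed_round:
  assumes R: "relaxed d {} s"
  shows "relaxed d {(u, v, z). u < n \<and> v < n \<and> z < n} (sem relax_round s)"
proof -
  let ?I = "\<lambda>j s. relaxed d {(u, v, z). u < j \<and> v < n \<and> z < n} s"
  have "?I (nreg s 0) (sem (For 11 0 (For 12 0 (For 15 0 relax))) s)"
  proof (rule sem_For[where Inv = "?I"])
    have empty: "{(u, v, z). u < (0::nat) \<and> v < n \<and> z < n} = {}" by auto
    show "?I 0 (set_nreg 11 0 s)" unfolding empty using R by (simp add: relaxed_set_nreg)
  next
    fix j s' assume *: "j < nreg s 0" "nreg s' 11 = j" "?I j s'"
    have "relaxed d ({(u, v, z). u < j \<and> v < n \<and> z < n} \<union> {(j, v, z) | v z. v < n \<and> z < n})
        (sem (For 12 0 (For 15 0 relax)) s')"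
      using * relaxed_regs[OF R] by (intro relaxed_vz) auto
    moreover have "{(u, v, z). u < j \<and> v < n \<and> z < n} \<union> {(j, v, z) | v z. v < n \<and> z < n} =
        {(u, v, z). u < Suc j \<and> v < n \<and> z < n}"
      by (auto simp: less_Suc_eq)
    ultimately show "?I (Suc j) (set_nreg 11 (Suc j) (sem (For 12 0 (For 15 0 relax)) s'))"
      by (simp add: relaxed_set_nreg)
  qed simp
  then show ?thesis by (simp add: relaxed_regs[OF R] relax_round_def)
qed

lemma approximates_init:
  assumes "loaded s"
  shows "approximates (sem dist_init s)"
proof -
  let ?c1 = "Basic (NAdd 13 11 4) ;; Basic (RStore 13 3)"
  let ?c2 = "addr 13 11 11 ;; Basic (NAdd 13 13 4) ;; Basic (RStore 13 5)"
  define s1 where "s1 = sem (For 11 4 ?c1) s"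
  let ?I = "\<lambda>j s. loaded s \<and> (\<forall>a<j. rmem s (n * n + a) = \<rho> + 1)"
  have "?I (nreg s 4) s1"
    unfolding s1_def
  proof (rule sem_For[where Inv = "?I"])
    show "?I 0 (set_nreg 11 0 s)" using assms by (simp add: loaded_set_nreg)
  next
    fix j s' assume *: "j < nreg s 4" "nreg s' 11 = j" "?I j s'"
    note l = loadedD[OF conjunct1[OF *(3)]]
    have m: "rmem (sem ?c1 s') = (rmem s')(n * n + j := \<rho> + 1)"
      using *(2) by (simp add: sem_eqs exec_eqs l(1-7) add_ac)
    have "loaded (sem ?c1 s')"
      by (rule loaded_frame) (use * m in auto)
    then show "?I (Suc j) (set_nreg 11 (Suc j) (sem ?c1 s'))"
      using *(3) by (auto simp: loaded_set_nreg m less_Suc_eq)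
  qed simp
  then have l1: "loaded s1" and m1: "\<And>a. a < n * n \<Longrightarrow> rmem s1 (n * n + a) = \<rho> + 1"
    using loadedD(4)[OF assms] by auto
  have D1: "D s1 u v = \<rho> + 1" if "u < n" "v < n" for u v
    using m1 addr_less[OF that] by (simp add: D_def)
  define s2 where "s2 = sem (For 11 0 ?c2) s1"
  let ?J = "\<lambda>j s. loaded s \<and> (\<forall>u<n. \<forall>v<n. D s u v = (if u = v \<and> u < j then 0 else \<rho> + 1))"
  have "?J (nreg s1 0) s2"
    unfolding s2_def
  proof (rule sem_For[where Inv = "?J"])
    show "?J 0 (set_nreg 11 0 s1)" using l1 D1 by (simp add: loaded_set_nreg)
  next
    fix j s' assume *: "j < nreg s1 0" "nreg s' 11 = j" "?J j s'"
    note l = loadedD[OF conjunct1[OF *(3)]]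
    have j: "j < n" using *(1) loadedD(1)[OF l1] by simp
    have m: "rmem (sem ?c2 s') = (rmem s')(n * n + (j + j * n) := 0)"
      using *(2) j by (simp add: sem_eqs exec_eqs sem_addr l(1-7) add_ac)
    have "loaded (sem ?c2 s')"
      by (rule loaded_frame) (use * m in auto)
    moreover have "D (sem ?c2 s') u v = (if u = v \<and> u < Suc j then 0 else \<rho> + 1)" if "u < n" "v < n" for u v
      using *(3) that j addr_inj[of v n j u j] by (auto simp: D_def m less_Suc_eq)
    ultimately show "?J (Suc j) (set_nreg 11 (Suc j) (sem ?c2 s'))"
      by (simp add: loaded_set_nreg)
  qed simp
  then have J: "?J n s2" using loadedD(1)[OF l1] by simp
  have "capped_dist (\<rho> + 1) u u = 0" if "u < n" for u
    using that \<rho> verts by (intro capped_dist_self) auto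
  then have "approximates s2"
    using J \<rho> capped_dist_le[of "\<rho> + 1"] by (auto simp: approximates_def)
  then show ?thesis by (simp add: dist_init_def sem_eqs s1_def s2_def)
qed

text \<open>After t rounds each entry is at most the cost of every walk with at most t arcs.
  Distances below the cap are attained by simple paths with at most n arcs, and
  \<open>approximates\<close> gives the reverse inequality.\<close>

theorem distances_correct:
  assumes "loaded s"
  shows "loaded (sem distances s)"
    and "\<And>u v. u < n \<Longrightarrow> v < n \<Longrightarrow> D (sem distances s) u v = capped_dist (\<rho> + 1) u v"
proof -
  let ?init = "sem dist_init s" and ?s = "sem distances s"
  let ?I = "\<lambda>t s. approximates s \<and> (\<forall>u<n. \<forall>v<n. \<forall>p. awalk u p v \<longrightarrow> length p \<le> t \<longrightarrow> D s u v \<le> awalk_cost w p)"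
  have A0: "approximates ?init" using assms by (rule approximates_init)
  have "?I (nreg ?init 0) (sem (For 14 0 relax_round) ?init)"
  proof (rule sem_For[where Inv = "?I"])
    show "?I 0 (set_nreg 14 0 ?init)"
      using A0 by (auto simp: approximates_set_nreg awalk_Nil_iff) (simp add: approximates_def)
  next
    fix t s' assume *: "t < nreg ?init 0" "nreg s' 14 = t" "?I t s'"
    have "relaxed (D s') {} s'" using *(3) by (simp add: relaxed_def)
    then have R: "relaxed (D s') {(u, v, z). u < n \<and> v < n \<and> z < n} (sem relax_round s')"
      by (rule relaxed_round)
    let ?s' = "sem relax_round s'"
    have "D ?s' u z \<le> awalk_cost w p" if uz: "u < n" "z < n" "awalk u p z" "length p \<le> Suc t" for u z p
    proof (cases p rule: rev_cases)
      case Nil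
      then show ?thesis using uz R by (auto simp: awalk_Nil_iff relaxed_def approximates_def)
    next
      case (snoc q e)
      obtain v z' where e: "e = (v, z')" by force
      have q: "awalk u q v" "(v, z) \<in> parcs G" "z' = z"
        using uz(3) unfolding snoc e by (auto simp: awalk_Cons_iff awalk_Nil_iff)
      have v: "v < n" using wellformed'(1)[OF q(2)] verts by simp
      have "D s' u v \<le> awalk_cost w q" using *(3) uz v q(1) snoc by simp
      moreover have "D ?s' u z \<le> D s' u v + w (v, z)" using R uz v q(2) by (simp add: relaxed_def)
      ultimately show ?thesis by (simp add: snoc e q(3))
    qed
    then show "?I (Suc t) (set_nreg 14 (Suc t) ?s')"
      using R by (auto simp: approximates_set_nreg relaxed_def)
  qed (simp add: relax_round_def)
  moreover have "nreg ?init 0 = n" using A0 by (simp add: approximates_def loaded_def)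
  moreover have "?s = sem (For 14 0 relax_round) ?init" by (simp add: distances_def sem_eqs)
  ultimately have I: "?I n ?s" by simp
  then show "loaded ?s" by (simp add: approximates_def)
  show "D ?s u v = capped_dist (\<rho> + 1) u v" if uv: "u < n" "v < n" for u v
  proof (rule antisym)
    show "capped_dist (\<rho> + 1) u v \<le> D ?s u v" using I uv by (simp add: approximates_def)
    show "D ?s u v \<le> capped_dist (\<rho> + 1) u v"
    proof (cases "capped_dist (\<rho> + 1) u v < \<rho> + 1")
      case True
      then obtain p where p: "apath u p v" "capped_dist (\<rho> + 1) u v = awalk_cost w p"
        by (rule capped_dist_apath)
      then have "length p \<le> n" using length_apath[OF p(1)] verts by simp
      then show ?thesis using I uv awalkI_apath[OF p(1)] p(2) by simp
    next
      case False
      then show ?thesis using I uv unfolding approximates_def by force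
    qed
  qed
qed

end

section \<open>Local search\<close>

text \<open>Swaps act by toggling membership. Toggling the same vertices again undoes a swap, so a
  rejected one needs no backup copy.\<close>

definition symd :: "'a set \<Rightarrow> 'a set \<Rightarrow> 'a set" where
  "symd A B = (A - B) \<union> (B - A)"

lemma symd_empty [simp]: "symd A {} = A" "symd {} A = A"
  by (auto simp: symd_def)

lemma symd_assoc: "symd (symd A B) C = symd A (symd B C)"
  by (auto simp: symd_def)

lemma symd_commute: "symd A B = symd B A"
  by (auto simp: symd_def)

lemma symd_cancel [simp]: "symd (symd A B) B = A"
  by (auto simp: symd_def)

text \<open>A set of at most k vertices is encoded by the base n+1 digits of a number; the digit n is
  padding.\<close>

primrec digit_set :: "nat \<Rightarrow> nat \<Rightarrow> nat \<Rightarrow> nat set" where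
  "digit_set n 0 x = {}"
| "digit_set n (Suc k) x = symd (digit_set n k (x div Suc n)) ({x mod Suc n} \<inter> {..<n})"

lemma digit_set_exists:
  "A \<subseteq> {..<n} \<Longrightarrow> card A \<le> k \<Longrightarrow> \<exists>x<Suc n ^ k. digit_set n k x = A"
proof (induction k arbitrary: A)
  case 0
  then have "A = {}" using finite_subset[of A "{..<n}"] by simp
  then show ?case by simp
next
  case (Suc k)
  obtain d A' where d: "d \<le> n" "A' \<subseteq> {..<n}" "card A' \<le> k" "symd A' ({d} \<inter> {..<n}) = A"
  proof (cases "A = {}")
    case True
    then show ?thesis using that[of n "{}"] by simp
  next
    case False
    then obtain a where a: "a \<in> A" by blast
    have "finite A" using Suc.prems(1) by (rule finite_subset) simp
    then have "card (A - {a}) \<le> k" using a Suc.prems(2) by simp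
    moreover have "symd (A - {a}) ({a} \<inter> {..<n}) = A" using a Suc.prems(1) by (auto simp: symd_def)
    ultimately show ?thesis using that[of a "A - {a}"] a Suc.prems(1) by force
  qed
  obtain x where x: "x < Suc n ^ k" "digit_set n k x = A'" using Suc.IH[OF d(2,3)] by blast
  have "x * Suc n + d < Suc x * Suc n" using d(1) by simp
  also have "\<dots> \<le> Suc n ^ k * Suc n" using x(1) by (intro mult_le_mono1) simp
  finally have "x * Suc n + d < Suc n ^ Suc k" by (simp only: power_Suc mult.commute)
  moreover have "(x * Suc n + d) div Suc n = x" "(x * Suc n + d) mod Suc n = d"
    using d(1) by (auto simp del: mult_Suc_right)
  then have "digit_set n (Suc k) (x * Suc n + d) = A" using x(2) d(4) by simp
  ultimately show ?case by blast
qed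

section \<open>Programs for applying and testing a swap\<close>

definition toggle :: com where
  "toggle = IfN 40 0 (Basic (NAdd 41 40 4) ;; Basic (NLoad 42 41) ;; Basic (NSub 42 3 42) ;;
    Basic (NStore 41 42))"

definition divide :: com where
  "divide = Basic (NAdd 43 2 2) ;; For 34 9 (IfN 0 40 (Basic (NSub 40 40 5) ;; Basic (NAdd 43 43 3)))"

definition toggles :: com where
  "toggles = Basic (NAdd 40 32 2) ;; For 33 8 (divide ;; toggle ;; Basic (NAdd 40 43 2))"

definition count :: com where
  "count = Basic (NAdd 44 2 2) ;;
    For 35 0 (Basic (NAdd 41 35 4) ;; Basic (NLoad 42 41) ;; Basic (NAdd 44 44 42))"

definition check_pair :: com where
  "check_pair = IfN 35 36 (Basic (NAdd 41 35 4) ;; Basic (NLoad 46 41) ;;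
    Basic (NAdd 41 36 4) ;; Basic (NLoad 47 41) ;;
    IfN 2 46 (IfN 2 47 (addr 41 35 36 ;; Basic (NAdd 41 41 4) ;; Basic (RLoad 7 41) ;;
      Basic (NAdd 48 3 2) ;; IfR 2 7 (Basic (NAdd 48 2 2)) ;; Basic (NAdd 45 45 48))))"

definition conflicts :: com where
  "conflicts = Basic (NAdd 45 2 2) ;; For 35 0 (For 36 0 check_pair)"

text \<open>Register 49 starts as 1 and is cleared on acceptance. Otherwise the second run of
  \<open>toggles\<close>, which decodes the same number in register 32 afresh, restores the set.
  Comparing register 45 with 1 tests that there are no conflicts.\<close>

definition try_swap :: com where
  "try_swap = toggles ;; count ;; conflicts ;; Basic (NAdd 49 3 2) ;;
    IfN 45 3 (IfN 10 44 (Basic (NAdd 10 44 2) ;; Basic (NAdd 49 2 2))) ;; IfN 2 49 toggles"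

definition search :: com where
  "search = For 31 5 (For 32 9 try_swap)"

definition copy_out :: com where
  "copy_out = For 35 0 (Basic (NAdd 41 35 4) ;; Basic (NLoad 42 41) ;; Basic (NStore 35 42))"

lemma toggle_frames [simp]:
  "writes toggle = {41, 42}" "bounds toggle = {}" "rwrites toggle = {}" "no_rstore toggle" "wf_com toggle"
  by (auto simp: toggle_def)

lemma divide_frames [simp]:
  "writes divide = {34, 40, 43}" "bounds divide = {9}" "rwrites divide = {}"
  "no_rstore divide" "no_nstore divide" "wf_com divide"
  by (auto simp: divide_def)

lemma toggles_frames [simp]:
  "writes toggles = {33, 34, 40, 41, 42, 43}" "bounds toggles = {8, 9}" "rwrites toggles = {}"
  "no_rstore toggles" "wf_com toggles"
  by (auto simp: toggles_def)

lemma count_frames [simp]: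
  "writes count = {35, 41, 42, 44}" "bounds count = {0}" "rwrites count = {}"
  "no_rstore count" "no_nstore count" "wf_com count"
  by (auto simp: count_def)

lemma check_pair_frames [simp]:
  "writes check_pair = {30, 41, 45, 46, 47, 48}" "bounds check_pair = {0}" "rwrites check_pair = {7}"
  "no_rstore check_pair" "no_nstore check_pair" "wf_com check_pair"
  by (auto simp: check_pair_def)

lemma conflicts_frames [simp]:
  "writes conflicts = {30, 35, 36, 41, 45, 46, 47, 48}" "bounds conflicts = {0}" "rwrites conflicts = {7}"
  "no_rstore conflicts" "no_nstore conflicts" "wf_com conflicts"
  by (auto simp: conflicts_def)

lemma try_swap_frames [simp]:
  "writes try_swap = {10, 30, 33, 34, 35, 36, 40, 41, 42, 43, 44, 45, 46, 47, 48, 49}"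
  "bounds try_swap = {0, 8, 9}" "rwrites try_swap = {7}" "no_rstore try_swap" "wf_com try_swap"
  by (auto simp: try_swap_def)

section \<open>Correctness of the local search\<close>

locale search_spec =
  fixes n k :: nat and \<rho> :: real and d :: "nat \<Rightarrow> nat \<Rightarrow> real"
begin

definition ready :: "config \<Rightarrow> bool" where
  "ready s \<longleftrightarrow> nreg s 0 = n \<and> nreg s 2 = 0 \<and> nreg s 3 = 1 \<and> nreg s 4 = n * n \<and>
     nreg s 5 = Suc n \<and> nreg s 8 = k \<and> nreg s 9 = Suc n ^ k \<and> rreg s 2 = \<rho> \<and>
     (\<forall>u<n. \<forall>v<n. rmem s (n * n + (v + u * n)) = d u v)"

lemma readyD:
  assumes "ready s"
  shows "nreg s 0 = n" "nreg s 2 = 0" "nreg s 3 = 1" "nreg s 4 = n * n"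
    "nreg s 5 = Suc n" "nreg s 8 = k" "nreg s 9 = Suc n ^ k" "rreg s 2 = \<rho>"
    "u < n \<Longrightarrow> v < n \<Longrightarrow> rmem s (n * n + (v + u * n)) = d u v"
  using assms by (auto simp: ready_def)

lemma ready_set_nreg: "ready (set_nreg i x s) \<longleftrightarrow> ready s" if "i \<notin> {0, 2, 3, 4, 5, 8, 9}"
  using that by (auto simp: ready_def)

lemma ready_frame:
  assumes "ready s" "writes c \<inter> {0, 2, 3, 4, 5, 8, 9} = {}" "2 \<notin> rwrites c" "no_rstore c"
  shows "ready (sem c s)"
proof -
  have "nreg (sem c s) r = nreg s r" if "r \<in> {0, 2, 3, 4, 5, 8, 9}" for r
    using assms(2) that by (intro sem_writes) auto
  then show ?thesis
    using assms(1,3,4) by (simp add: ready_def sem_no_rstore sem_rwrites)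
qed

definition holds :: "nat set \<Rightarrow> config \<Rightarrow> bool" where
  "holds A s \<longleftrightarrow> A \<subseteq> {..<n} \<and> (\<forall>v<n. nmem s (n * n + v) = of_bool (v \<in> A))"

lemma holds_set_nreg [simp]: "holds A (set_nreg i x s) \<longleftrightarrow> holds A s"
  by (simp add: holds_def)

lemma holds_frame: "no_nstore c \<Longrightarrow> holds A (sem c s) \<longleftrightarrow> holds A s"
  by (simp add: holds_def sem_no_nstore)

lemma holdsD: "holds A s \<Longrightarrow> v < n \<Longrightarrow> nmem s (n * n + v) = of_bool (v \<in> A)"
  by (simp add: holds_def)

lemma holds_toggle:
  assumes "ready s" "holds A s"
  shows "holds (symd A ({nreg s 40} \<inter> {..<n})) (sem toggle s)"
proof (cases "nreg s 40 < n")
  case True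
  note r = readyD[OF assms(1)]
  have "nmem (sem toggle s) = (nmem s)(n * n + nreg s 40 := 1 - nmem s (n * n + nreg s 40))"
    using True by (simp add: toggle_def sem_eqs exec_eqs r(1-7) add_ac)
  then show ?thesis using assms(2) True by (auto simp: holds_def symd_def)
next
  case False
  then have "sem toggle s = s" using readyD(1)[OF assms(1)] by (simp add: toggle_def sem_eqs)
  then show ?thesis using assms(2) False by simp
qed

text \<open>Division by repeated subtraction. The quotient is below (n+1)^k, the number of rounds
  available in register 9, so the loop cannot run out of rounds early.\<close>

lemma sem_divide:
  assumes R: "ready s" and y: "nreg s 40 < Suc n ^ k"
  shows "nreg (sem divide s) 40 = nreg s 40 mod Suc n" "nreg (sem divide s) 43 = nreg s 40 div Suc n"
proof -
  let ?c = "IfN 0 40 (Basic (NSub 40 40 5) ;; Basic (NAdd 43 43 3))"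
  let ?i = "set_nreg 43 0 s"
  let ?I = "\<lambda>j s'. ready s' \<and> nreg s' 40 + nreg s' 43 * Suc n = nreg s 40 \<and>
    (nreg s' 40 < Suc n \<or> j \<le> nreg s' 43)"
  have "?I (nreg ?i 9) (sem (For 34 9 ?c) ?i)"
  proof (rule sem_For[where Inv = ?I])
    show "?I 0 (set_nreg 34 0 ?i)" using R by (simp add: ready_set_nreg)
  next
    fix j s' assume *: "j < nreg ?i 9" "nreg s' 34 = j" "?I j s'"
    note r = readyD[OF conjunct1[OF *(3)]]
    show "?I (Suc j) (set_nreg 34 (Suc j) (sem ?c s'))"
    proof (cases "n < nreg s' 40")
      case True
      then have "sem ?c s' = set_nreg 43 (Suc (nreg s' 43)) (set_nreg 40 (nreg s' 40 - Suc n) s')"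
        by (simp add: sem_eqs exec_eqs r(1-7))
      then show ?thesis using *(3) True by (simp add: ready_set_nreg algebra_simps)
    next
      case False
      then have "sem ?c s' = s'" by (simp add: sem_eqs r(1-7))
      then show ?thesis using *(3) False by (simp add: ready_set_nreg)
    qed
  qed simp
  moreover have "sem divide s = sem (For 34 9 ?c) ?i"
    using readyD[OF R] by (simp add: divide_def sem_eqs exec_eqs)
  ultimately have I: "nreg (sem divide s) 40 + nreg (sem divide s) 43 * Suc n = nreg s 40"
    "nreg (sem divide s) 40 < Suc n \<or> Suc n ^ k \<le> nreg (sem divide s) 43"
    using readyD(7)[OF R] by auto
  have "nreg (sem divide s) 43 * 1 \<le> nreg (sem divide s) 43 * Suc n" by (intro mult_le_mono2) simp
  then have lt: "nreg (sem divide s) 40 < Suc n" using I y by linarith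
  then have "nreg s 40 mod Suc n = nreg (sem divide s) 40" "nreg s 40 div Suc n = nreg (sem divide s) 43"
    unfolding I(1)[symmetric] by (auto simp del: mult_Suc_right)
  then show "nreg (sem divide s) 40 = nreg s 40 mod Suc n" "nreg (sem divide s) 43 = nreg s 40 div Suc n"
    by simp_all
qed

text \<open>The invariant looks forward: toggling the digits still encoded in register 40 would lead
  from the present set to the goal. The digits already used need no description.\<close>

lemma holds_toggles:
  assumes R: "ready s" and A: "holds A s" and x: "nreg s 32 < Suc n ^ k"
  shows "holds (symd A (digit_set n k (nreg s 32))) (sem toggles s)"
proof -
  let ?c = "divide ;; toggle ;; Basic (NAdd 40 43 2)"
  let ?i = "set_nreg 40 (nreg s 32) s"
  let ?goal = "symd A (digit_set n k (nreg s 32))"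
  let ?I = "\<lambda>j s'. ready s' \<and> nreg s' 40 < Suc n ^ k \<and>
    (\<exists>A'. holds A' s' \<and> symd A' (digit_set n (k - j) (nreg s' 40)) = ?goal)"
  have "?I (nreg ?i 8) (sem (For 33 8 ?c) ?i)"
  proof (rule sem_For[where Inv = ?I])
    show "?I 0 (set_nreg 33 0 ?i)" using R A x by (auto simp: ready_set_nreg)
  next
    fix j s' assume *: "j < nreg ?i 8" "nreg s' 33 = j" "?I j s'"
    have Rs': "ready s'" using *(3) by blast
    define y where "y = nreg s' 40"
    have y: "y < Suc n ^ k" using *(3) by (simp add: y_def)
    obtain A' where A': "holds A' s'" "symd A' (digit_set n (k - j) y) = ?goal"
      using *(3) y_def by blast
    define s1 where "s1 = sem divide s'"
    have s1: "ready s1" "nreg s1 40 = y mod Suc n" "nreg s1 43 = y div Suc n" "holds A' s1"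
      unfolding s1_def y_def using sem_divide[OF Rs'] y[unfolded y_def] A'(1) Rs'
      by (auto simp: holds_frame intro: ready_frame)
    define s2 where "s2 = sem toggle s1"
    have s2: "ready s2" "nreg s2 43 = y div Suc n" "holds (symd A' ({y mod Suc n} \<inter> {..<n})) s2"
      unfolding s2_def using holds_toggle[OF s1(1,4)] s1
      by (auto simp: sem_writes intro: ready_frame)
    have s3: "sem ?c s' = set_nreg 40 (y div Suc n) s2"
      using readyD[OF s2(1)] s2(2) by (simp add: sem_eqs exec_eqs s1_def[symmetric] s2_def[symmetric])
    have kj: "k - j = Suc (k - Suc j)" using *(1) readyD(6)[OF R] by simp
    have "symd (symd A' ({y mod Suc n} \<inter> {..<n})) (digit_set n (k - Suc j) (y div Suc n)) = ?goal"
      unfolding A'(2)[symmetric] kj digit_set.simps symd_assoc by (simp add: symd_commute)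
    moreover have "y div Suc n < Suc n ^ k" using y by (meson div_le_dividend le_less_trans)
    ultimately show "?I (Suc j) (set_nreg 33 (Suc j) (sem ?c s'))"
      using s2 unfolding s3 by (auto simp: ready_set_nreg)
  qed simp
  then have "holds ?goal (sem (For 33 8 ?c) ?i)" using readyD(6)[OF R] by auto
  moreover have "sem toggles s = sem (For 33 8 ?c) ?i"
    using readyD[OF R] by (simp add: toggles_def sem_eqs exec_eqs)
  ultimately show ?thesis by simp
qed

lemma sem_count:
  assumes R: "ready s" and A: "holds A s"
  shows "nreg (sem count s) 44 = card A"
proof -
  let ?c = "Basic (NAdd 41 35 4) ;; Basic (NLoad 42 41) ;; Basic (NAdd 44 44 42)"
  let ?i = "set_nreg 44 0 s"
  let ?I = "\<lambda>j s'. ready s' \<and> holds A s' \<and> nreg s' 44 = card (A \<inter> {..<j})"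
  have "?I (nreg ?i 0) (sem (For 35 0 ?c) ?i)"
  proof (rule sem_For[where Inv = ?I])
    show "?I 0 (set_nreg 35 0 ?i)" using R A by (simp add: ready_set_nreg)
  next
    fix j s' assume *: "j < nreg ?i 0" "nreg s' 35 = j" "?I j s'"
    note r = readyD[OF conjunct1[OF *(3)]]
    have j: "j < n" using *(1) readyD(1)[OF R] by simp
    have "nreg (sem ?c s') 44 = nreg s' 44 + nmem s' (n * n + j)"
      using *(2) by (simp add: sem_eqs exec_eqs r(1-7) add_ac)
    also have "\<dots> = card (A \<inter> {..<Suc j})"
      using *(3) holdsD[of A s' j] j by (simp add: lessThan_Suc)
    finally show "?I (Suc j) (set_nreg 35 (Suc j) (sem ?c s'))"
      using *(3) by (auto simp: ready_set_nreg holds_frame intro: ready_frame)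
  qed simp
  moreover have "sem count s = sem (For 35 0 ?c) ?i"
    using readyD[OF R] by (simp add: count_def sem_eqs exec_eqs)
  moreover have "A \<inter> {..<n} = A" using A by (auto simp: holds_def)
  ultimately show ?thesis using readyD(1)[OF R] by simp
qed

definition spread :: "nat set \<Rightarrow> bool" where
  "spread A \<longleftrightarrow> (\<forall>u\<in>A. \<forall>v\<in>A. u < v \<longrightarrow> \<rho> < d u v)"

definition checked :: "nat set \<Rightarrow> (nat \<times> nat) set \<Rightarrow> config \<Rightarrow> bool" where
  "checked A T s \<longleftrightarrow> ready s \<and> holds A s \<and>
     (nreg s 45 = 0 \<longleftrightarrow> (\<forall>u\<in>A. \<forall>v\<in>A. (u, v) \<in> T \<longrightarrow> u < v \<longrightarrow> \<rho> < d u v))"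

lemma checked_set_nreg:
  "checked A T (set_nreg i x s) \<longleftrightarrow> checked A T s" if "i \<notin> {0, 2, 3, 4, 5, 8, 9, 45}"
  using that by (simp add: checked_def ready_set_nreg)

lemma checked_check_pair:
  assumes C: "checked A T s" and uv: "nreg s 35 = u" "nreg s 36 = v" "u < n" "v < n"
  shows "checked A (insert (u, v) T) (sem check_pair s)"
proof -
  have R: "ready s" and A: "holds A s" using C by (auto simp: checked_def)
  note r = readyD[OF R]
  have mem: "nmem s (u + n * n) = of_bool (u \<in> A)" "nmem s (v + n * n) = of_bool (v \<in> A)"
    using holdsD[OF A] uv by (simp_all add: add.commute)
  have d: "rmem s (v + (n * n + u * n)) = d u v"
    using r(9)[OF uv(3,4)] by (simp add: add_ac)
  have "nreg (sem check_pair s) 45 = (if u < v \<and> u \<in> A \<and> v \<in> A \<and> \<not> \<rho> < d u v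
      then Suc (nreg s 45) else nreg s 45)"
  proof (cases "u < v \<and> u \<in> A \<and> v \<in> A")
    case True
    then show ?thesis
      using uv mem d by (cases "\<rho> < d u v") (simp_all add: check_pair_def sem_eqs exec_eqs sem_addr r(1-8) add_ac)
  next
    case False
    then show ?thesis
      using uv mem by (cases "u < v"; cases "u \<in> A") (simp_all add: check_pair_def sem_eqs exec_eqs r(1-8))
  qed
  then show ?thesis
    using C unfolding checked_def
    by (auto simp: holds_frame intro!: ready_frame split: if_splits)
qed

lemma sem_conflicts:
  assumes R: "ready s" and A: "holds A s"
  shows "nreg (sem conflicts s) 45 = 0 \<longleftrightarrow> spread A"
proof -
  let ?i = "set_nreg 45 0 s"
  have inner: "checked A (T \<union> {(u, v) | v. v < n}) (sem (For 36 0 check_pair) s')"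
    if C: "checked A T s'" and u: "nreg s' 35 = u" "u < n" for T u s'
  proof -
    let ?I = "\<lambda>j s'. checked A (T \<union> {(u, v) | v. v < j}) s' \<and> nreg s' 35 = u"
    have n: "nreg s' 0 = n" using C by (auto simp: checked_def ready_def)
    have "?I (nreg s' 0) (sem (For 36 0 check_pair) s')"
    proof (rule sem_For[where Inv = ?I])
      show "?I 0 (set_nreg 36 0 s')" using C u by (simp add: checked_set_nreg)
    next
      fix j t assume *: "j < nreg s' 0" "nreg t 36 = j" "?I j t"
      have "checked A (insert (u, j) (T \<union> {(u, v) | v. v < j})) (sem check_pair t)"
        using * u n by (intro checked_check_pair) auto
      moreover have "insert (u, j) (T \<union> {(u, v) | v. v < j}) = T \<union> {(u, v) | v. v < Suc j}"
        by (auto simp: less_Suc_eq)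
      ultimately show "?I (Suc j) (set_nreg 36 (Suc j) (sem check_pair t))"
        using * by (simp add: checked_set_nreg sem_writes)
    qed simp
    then show ?thesis by (simp add: n)
  qed
  let ?I = "\<lambda>j. checked A {(u, v). u < j \<and> v < n}"
  have "?I (nreg ?i 0) (sem (For 35 0 (For 36 0 check_pair)) ?i)"
  proof (rule sem_For[where Inv = ?I])
    show "?I 0 (set_nreg 35 0 ?i)" using R A by (simp add: checked_def ready_set_nreg)
  next
    fix j s' assume *: "j < nreg ?i 0" "nreg s' 35 = j" "?I j s'"
    have "checked A ({(u, v). u < j \<and> v < n} \<union> {(j, v) | v. v < n}) (sem (For 36 0 check_pair) s')"
      using * readyD(1)[OF R] by (intro inner) auto
    moreover have "{(u, v). u < j \<and> v < n} \<union> {(j, v) | v. v < n} = {(u, v). u < Suc j \<and> v < n}"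
      by (auto simp: less_Suc_eq)
    ultimately show "?I (Suc j) (set_nreg 35 (Suc j) (sem (For 36 0 check_pair) s'))"
      by (simp add: checked_set_nreg)
  qed simp
  moreover have "sem conflicts s = sem (For 35 0 (For 36 0 check_pair)) ?i"
    using readyD[OF R] by (simp add: conflicts_def sem_eqs exec_eqs)
  moreover have "A \<subseteq> {..<n}" using A by (simp add: holds_def)
  ultimately show ?thesis
    using readyD(1)[OF R] by (auto simp: checked_def spread_def subset_iff)
qed

definition current :: "nat set \<Rightarrow> config \<Rightarrow> bool" where
  "current A s \<longleftrightarrow> ready s \<and> holds A s \<and> nreg s 10 = card A"

lemma current_set_nreg:
  "current A (set_nreg i x s) \<longleftrightarrow> current A s" if "i \<notin> {0, 2, 3, 4, 5, 8, 9, 10}"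
  using that by (simp add: current_def ready_set_nreg)

definition swapped :: "nat set \<Rightarrow> nat \<Rightarrow> nat set" where
  "swapped A x = symd A (digit_set n k x)"

definition improves :: "nat set \<Rightarrow> nat \<Rightarrow> bool" where
  "improves A x \<longleftrightarrow> spread (swapped A x) \<and> card A < card (swapped A x)"

lemma current_try_swap:
  assumes C: "current A s" and x: "nreg s 32 = x" "x < Suc n ^ k"
  shows "current (if improves A x then swapped A x else A) (sem try_swap s)"
proof -
  have R: "ready s" and A: "holds A s" and c: "nreg s 10 = card A" using C by (auto simp: current_def)
  define B where "B = swapped A x"
  define s1 where "s1 = sem toggles s"
  have s1: "ready s1" "holds B s1" "nreg s1 10 = card A" "nreg s1 32 = x"
    unfolding s1_def B_def swapped_def using holds_toggles[OF R A] x R c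
    by (auto simp: sem_writes intro: ready_frame)
  define s2 where "s2 = sem count s1"
  have s2: "ready s2" "holds B s2" "nreg s2 10 = card A" "nreg s2 32 = x" "nreg s2 44 = card B"
    unfolding s2_def using sem_count[OF s1(1,2)] s1
    by (auto simp: sem_writes holds_frame intro: ready_frame)
  define s3 where "s3 = sem conflicts s2"
  have s3: "ready s3" "holds B s3" "nreg s3 10 = card A" "nreg s3 32 = x" "nreg s3 44 = card B"
    "nreg s3 45 = 0 \<longleftrightarrow> spread B"
    unfolding s3_def using sem_conflicts[OF s2(1,2)] s2
    by (auto simp: sem_writes holds_frame intro: ready_frame)
  note r = readyD[OF s3(1)]
  have t: "sem try_swap s = sem (IfN 2 49 toggles) (sem (IfN 45 3 (IfN 10 44
      (Basic (NAdd 10 44 2) ;; Basic (NAdd 49 2 2)))) (set_nreg 49 1 s3))"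
    using r by (simp add: try_swap_def sem_eqs(1,2) exec_eqs s1_def s2_def s3_def)
  show ?thesis
  proof (cases "improves A x")
    case True
    then have "sem try_swap s = set_nreg 49 0 (set_nreg 10 (card B) (set_nreg 49 1 s3))"
      unfolding t using s3 by (simp add: improves_def B_def[symmetric] sem_eqs exec_eqs r(1-7))
    then show ?thesis using True s3 by (simp add: B_def[symmetric] current_def ready_set_nreg)
  next
    case False
    have "sem try_swap s = sem toggles (set_nreg 49 1 s3)"
    proof (cases "spread B")
      case True
      then have "\<not> card A < card B" using False by (simp add: improves_def B_def)
      then show ?thesis unfolding t using True s3 by (simp add: sem_eqs r(1-7))
    next
      case False
      then show ?thesis unfolding t using s3 by (simp add: sem_eqs r(1-7))
    qed
    \<comment> \<open>The second toggling cancels the first and returns to \<open>A\<close>.\<close>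
    moreover have "holds (symd B (digit_set n k x)) (sem toggles (set_nreg 49 1 s3))"
      using holds_toggles[of "set_nreg 49 1 s3" B] s3 x by (simp add: ready_set_nreg)
    moreover have "ready (sem toggles (set_nreg 49 1 s3))"
      using s3(1) by (intro ready_frame) (auto simp: ready_set_nreg)
    ultimately show ?thesis
      using False s3(3) by (simp add: current_def B_def swapped_def sem_writes)
  qed
qed

definition locally_optimal :: "nat set \<Rightarrow> bool" where
  "locally_optimal A \<longleftrightarrow> (\<forall>x<Suc n ^ k. \<not> improves A x)"

text \<open>As long as no swap has been accepted, all of them have been tested against the same set
  \<open>A0\<close>. So a pass without growth certifies local optimality, and a locally optimal set
  survives further passes.\<close>

lemma search_pass:
  assumes C: "current A0 s" and sp: "spread A0"
  shows "\<exists>A. current A (sem (For 32 9 try_swap) s) \<and> spread A \<and>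
    (card A0 < card A \<or> A = A0 \<and> locally_optimal A0) \<and> (locally_optimal A0 \<longrightarrow> A = A0)"
proof -
  let ?I = "\<lambda>j s. \<exists>A. current A s \<and> spread A \<and>
    (card A0 < card A \<or> A = A0 \<and> (\<forall>x<j. \<not> improves A0 x)) \<and> (locally_optimal A0 \<longrightarrow> A = A0)"
  have X: "nreg s 9 = Suc n ^ k" using C by (simp add: current_def ready_def)
  have "?I (nreg s 9) (sem (For 32 9 try_swap) s)"
  proof (rule sem_For[where Inv = ?I])
    show "?I 0 (set_nreg 32 0 s)" using C sp by (auto simp: current_set_nreg)
  next
    fix j s' assume *: "j < nreg s 9" "nreg s' 32 = j" "?I j s'"
    then obtain A where A: "current A s'" "spread A"
      "card A0 < card A \<or> A = A0 \<and> (\<forall>x<j. \<not> improves A0 x)" "locally_optimal A0 \<longrightarrow> A = A0" by blast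
    define B where "B = (if improves A j then swapped A j else A)"
    have j: "j < Suc n ^ k" using *(1) X by simp
    have "current B (sem try_swap s')"
      unfolding B_def using A(1) *(2) j by (rule current_try_swap)
    moreover have "spread B" using A(2) by (simp add: B_def improves_def)
    moreover have "card A0 < card B \<or> B = A0 \<and> (\<forall>x<Suc j. \<not> improves A0 x)"
      using A(3) by (auto simp: B_def improves_def less_Suc_eq)
    moreover have "locally_optimal A0 \<longrightarrow> B = A0"
      using A(4) j by (auto simp: B_def locally_optimal_def)
    ultimately show "?I (Suc j) (set_nreg 32 (Suc j) (sem try_swap s'))"
      by (auto simp: current_set_nreg)
  qed simp
  then show ?thesis unfolding X locally_optimal_def .
qed

text \<open>Each of the n + 1 passes enlarges the set until it is locally optimal. A size of n + 1
  is impossible, so an optimum is reached in time.\<close>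

lemma search_correct:
  assumes C: "current A0 s" and sp: "spread A0"
  shows "\<exists>A. current A (sem search s) \<and> spread A \<and> locally_optimal A"
proof -
  let ?I = "\<lambda>j s. \<exists>A. current A s \<and> spread A \<and> (j \<le> card A \<or> locally_optimal A)"
  have "?I (nreg s 5) (sem (For 31 5 (For 32 9 try_swap)) s)"
  proof (rule sem_For[where Inv = ?I])
    show "?I 0 (set_nreg 31 0 s)" using C sp by (auto simp: current_set_nreg)
  next
    fix j s' assume *: "j < nreg s 5" "nreg s' 31 = j" "?I j s'"
    then obtain A where A: "current A s'" "spread A" "j \<le> card A \<or> locally_optimal A" by blast
    from search_pass[OF A(1,2)] obtain B where B: "current B (sem (For 32 9 try_swap) s')" "spread B"
      "card A < card B \<or> B = A \<and> locally_optimal A" "locally_optimal A \<longrightarrow> B = A" by blast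
    have "Suc j \<le> card B \<or> locally_optimal B" using A(3) B(3,4) by auto
    then show "?I (Suc j) (set_nreg 31 (Suc j) (sem (For 32 9 try_swap) s'))"
      using B(1,2) by (auto simp: current_set_nreg)
  qed simp
  moreover have "nreg s 5 = Suc n" using C by (simp add: current_def ready_def)
  ultimately obtain A where A: "current A (sem search s)" "spread A" "Suc n \<le> card A \<or> locally_optimal A"
    unfolding search_def by auto
  have "card A \<le> card {..<n}"
    using A(1) by (intro card_mono) (auto simp: current_def holds_def)
  then show ?thesis using A by auto
qed

lemma copy_out_correct:
  assumes R: "ready s" and A: "holds A s"
  shows "\<forall>v<n. nmem (sem copy_out s) v = of_bool (v \<in> A)"
proof -
  let ?c = "Basic (NAdd 41 35 4) ;; Basic (NLoad 42 41) ;; Basic (NStore 35 42)"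
  let ?I = "\<lambda>j s'. ready s' \<and> holds A s' \<and> (\<forall>v<j. nmem s' v = of_bool (v \<in> A))"
  have "?I (nreg s 0) (sem (For 35 0 ?c) s)"
  proof (rule sem_For[where Inv = ?I])
    show "?I 0 (set_nreg 35 0 s)" using R A by (simp add: ready_set_nreg)
  next
    fix j s' assume *: "j < nreg s 0" "nreg s' 35 = j" "?I j s'"
    note r = readyD[OF conjunct1[OF *(3)]]
    have j: "j < n" using *(1) readyD(1)[OF R] by simp
    \<comment> \<open>The output overwrites the adjacency matrix but stays below address n * n,
      where the stored set begins.\<close>
    then have jn: "j < n * n" by (metis le_square less_le_trans)
    have m: "nmem (sem ?c s') = (nmem s')(j := of_bool (j \<in> A))"
      using *(2,3) holdsD[of A s' j] j by (simp add: sem_eqs exec_eqs r(1-7) add_ac)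
    have "holds A (sem ?c s')" using *(3) jn by (simp add: holds_def m)
    moreover have "ready (sem ?c s')" using *(3) by (auto intro: ready_frame)
    ultimately show "?I (Suc j) (set_nreg 35 (Suc j) (sem ?c s'))"
      using *(3) by (auto simp: ready_set_nreg m less_Suc_eq)
  qed simp
  then show ?thesis using readyD(1)[OF R] by (simp add: copy_out_def)
qed

text \<open>Since \<open>A\<close> avoids \<open>L\<close> and \<open>R\<close> lies in it, toggling
  A \<union> R is the exchange, and its size puts it among the enumerated swaps.\<close>

lemma locally_optimal_exchange:
  assumes opt: "locally_optimal L" and sub: "A \<subseteq> {..<n}" "R \<subseteq> L" "A \<inter> L = {}" "L \<subseteq> {..<n}"
    and card: "card A + card R \<le> k" and sp: "spread (L - R \<union> A)"
  shows "card A \<le> card R"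
proof (rule ccontr)
  assume gt: "\<not> card A \<le> card R"
  have Rn: "R \<subseteq> {..<n}" using sub(2,4) by (rule subset_trans)
  have fin: "finite A" "finite R" "finite L" using sub Rn by (auto intro: finite_subset)
  have "card (A \<union> R) \<le> k" using card_Un_le[of A R] card by linarith
  then obtain x where x: "x < Suc n ^ k" "digit_set n k x = A \<union> R"
    using digit_set_exists[of "A \<union> R" n k] sub(1) Rn by auto
  have eq: "swapped L x = L - R \<union> A" using sub x(2) by (auto simp: swapped_def symd_def)
  have "card (L - R \<union> A) = card (L - R) + card A"
    using fin sub by (intro card_Un_disjoint) auto
  also have "\<dots> = card L - card R + card A" using sub(2) fin by (simp add: card_Diff_subset)
  finally have "card L < card (swapped L x)" using gt card_mono[OF fin(3) sub(2)] eq by simp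
  then have "improves L x" using sp eq by (simp add: improves_def)
  then show False using opt x(1) by (simp add: locally_optimal_def)
qed

end

section \<open>The approximation scheme\<close>

lemma sem_add_loop:
  assumes "i \<noteq> b" "r \<noteq> i" "r \<noteq> b" "c \<noteq> i" "c \<noteq> r"
  shows "sem (For i b (Basic (NAdd r r c))) s =
    set_nreg i (nreg s b) (set_nreg r (nreg s r + nreg s b * nreg s c) s)"
proof -
  let ?F = "\<lambda>s. set_nreg i (Suc (nreg s i)) (set_nreg r (nreg s r + nreg s c) s)"
  have "(?F ^^ j) (set_nreg i 0 s) = set_nreg i j (set_nreg r (nreg s r + j * nreg s c) s)" for j
    by (induction j) (use assms in \<open>auto simp: set_nreg_def fun_upd_twist algebra_simps\<close>)
  then show ?thesis by (simp add: sem.simps exec_eqs)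
qed

text \<open>Register 6 receives the minimum of n and the ceiling of $1/\<epsilon>$. The cap n is harmless,
  because swaps of n vertices already reach every set.\<close>

definition invert :: com where
  "invert = For 20 0 (IfR 6 4 (Basic (RAdd 6 6 0) ;; Basic (NAdd 6 6 3)))"

text \<open>The constant \<open>K\<close> is the only place where H enters the program text.\<close>

definition setup_base :: "nat \<Rightarrow> com" where
  "setup_base K = Basic (NConst 7 K) ;; Basic (NAdd 5 0 3) ;; Basic (ROne 4) ;; Basic (RAdd 2 1 5) ;;
    Basic (RAdd 3 2 4) ;; For 20 0 (Basic (NAdd 4 4 0)) ;; invert"

definition setup_swap_size :: com where
  "setup_swap_size = For 20 6 (Basic (NAdd 21 21 6)) ;; For 20 7 (Basic (NAdd 8 8 21))"

definition setup_power :: com where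
  "setup_power = Basic (NAdd 9 3 2) ;;
    For 20 8 (Basic (NAdd 22 2 2) ;; For 21 5 (Basic (NAdd 22 22 9)) ;; Basic (NAdd 9 22 2))"

definition local_search :: com where
  "local_search = distances ;; search ;; copy_out"

definition main_com :: "nat \<Rightarrow> com" where
  "main_com K = setup_base K ;; setup_swap_size ;; setup_power ;; local_search"

text \<open>The leading instruction provides the 1 in register 3 that compiled jumps rely on;
  register 2 is already 0 in the input.\<close>

definition main_program :: "nat \<Rightarrow> program" where
  "main_program K = NConst 3 1 # compile 1 (main_com K)"

text \<open>Real register 6 accumulates M * \<epsilon> until it reaches 1. The lower bound on M
  yields the approximation ratio, the upper bound the running time.\<close>

lemma sem_invert:
  assumes init: "nreg s 3 = 1" "nreg s 6 = 0" "rreg s 4 = 1" "rreg s 6 = 0"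
  defines "M \<equiv> nreg (sem invert s) 6"
  shows "M \<le> nreg s 0" "M = nreg s 0 \<or> 1 \<le> real M * rreg s 0"
    "M = 0 \<or> (real M - 1) * rreg s 0 < 1"
proof -
  let ?c = "IfR 6 4 (Basic (RAdd 6 6 0) ;; Basic (NAdd 6 6 3))"
  let ?I = "\<lambda>j (s' :: config). nreg s' 3 = 1 \<and> rreg s' 4 = 1 \<and> rreg s' 0 = rreg s 0 \<and>
    rreg s' 6 = real (nreg s' 6) * rreg s 0 \<and> nreg s' 6 \<le> j \<and>
    (nreg s' 6 = j \<or> 1 \<le> real (nreg s' 6) * rreg s 0) \<and>
    (nreg s' 6 = 0 \<or> (real (nreg s' 6) - 1) * rreg s 0 < 1)"
  have "?I (nreg s 0) (sem (For 20 0 ?c) s)"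
  proof (rule sem_For[where Inv = ?I])
    show "?I 0 (set_nreg 20 0 s)" using init by simp
  next
    fix j s' assume *: "j < nreg s 0" "nreg s' 20 = j" "?I j s'"
    show "?I (Suc j) (set_nreg 20 (Suc j) (sem ?c s'))"
    proof (cases "rreg s' 6 < 1")
      case True
      then show ?thesis using * by (simp add: sem_eqs exec_eqs algebra_simps)
    next
      case False
      then have "sem ?c s' = s'" using * by (simp add: sem_eqs)
      then show ?thesis using * False by simp
    qed
  qed simp
  then show "M \<le> nreg s 0" "M = nreg s 0 \<or> 1 \<le> real M * rreg s 0"
    "M = 0 \<or> (real M - 1) * rreg s 0 < 1"
    by (auto simp: M_def invert_def)
qed

lemma sem_setup_power:
  assumes "nreg s 2 = 0" "nreg s 3 = 1"
  shows "nreg (sem setup_power s) 9 = nreg s 5 ^ nreg s 8"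
proof -
  let ?c = "Basic (NAdd 22 2 2) ;; For 21 5 (Basic (NAdd 22 22 9)) ;; Basic (NAdd 9 22 2)"
  let ?i = "set_nreg 9 1 s"
  let ?I = "\<lambda>j (s' :: config). nreg s' 2 = 0 \<and> nreg s' 5 = nreg s 5 \<and> nreg s' 9 = nreg s 5 ^ j"
  have "?I (nreg ?i 8) (sem (For 20 8 ?c) ?i)"
  proof (rule sem_For[where Inv = ?I])
    show "?I 0 (set_nreg 20 0 ?i)" using assms by simp
  next
    fix j s' assume *: "j < nreg ?i 8" "nreg s' 20 = j" "?I j s'"
    then show "?I (Suc j) (set_nreg 20 (Suc j) (sem ?c s'))"
      by (simp add: sem_eqs exec_eqs sem_add_loop)
  qed simp
  moreover have "sem setup_power s = sem (For 20 8 ?c) ?i"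
    using assms by (simp add: setup_power_def sem_eqs exec_eqs)
  ultimately show ?thesis by simp
qed

lemma program_frames:
  "writes (setup_base K) = {4, 5, 6, 7, 20}" "bounds (setup_base K) = {0}" "wf_com (setup_base K)"
  "writes setup_swap_size = {8, 20, 21}" "bounds setup_swap_size = {6, 7}" "wf_com setup_swap_size"
  "writes setup_power = {9, 20, 21, 22}" "bounds setup_power = {5, 8}" "wf_com setup_power"
  "writes local_search = {10, 11, 12, 13, 14, 15, 16, 17, 30, 31, 32, 33, 34, 35, 36, 40, 41, 42, 43, 44, 45, 46, 47, 48, 49}"
  "bounds local_search = {0, 4, 5, 8, 9}" "wf_com local_search"
  by (auto simp: setup_base_def invert_def setup_swap_size_def setup_power_def local_search_def
      distances_def dist_init_def relax_round_def search_def copy_out_def)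

lemma memory_frames:
  "no_nstore (setup_base K)" "no_nstore setup_swap_size" "no_nstore setup_power"
  "no_rstore (setup_base K)" "no_rstore setup_swap_size" "no_rstore setup_power"
  "rwrites (setup_base K) = {2, 3, 4, 6}" "rwrites setup_swap_size = {}" "rwrites setup_power = {}"
  "writes distances = {11, 12, 13, 14, 15, 16, 17, 30}" "rwrites distances = {7, 8}" "no_nstore distances"
  by (auto simp: setup_base_def invert_def setup_swap_size_def setup_power_def
      distances_def dist_init_def relax_round_def)

section \<open>The program on a fixed input\<close>

context
  fixes G :: "nat pair_pre_digraph" and w :: "(nat \<times> nat) weight_fun" and n K :: nat and \<epsilon> \<rho> :: real
  assumes G: "weighted_graph G w" and verts: "pverts G = {..<n}"
    and \<epsilon>: "0 < \<epsilon>" "\<epsilon> < 1 / 2" and \<rho>: "0 < \<rho>"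
begin

interpretation sym_weighted G w
  using G by (rule sym_weightedI)

interpretation dist_spec G w n \<rho>
  using verts \<rho> by unfold_locales

definition "st0 = set_nreg 3 1 (input G w \<epsilon> \<rho>)"
definition "st1 = sem (setup_base K) st0"
definition "st2 = sem setup_swap_size st1"
definition "st3 = sem setup_power st2"

lemma input_regs:
  "nreg (input G w \<epsilon> \<rho>) = (\<lambda>_. 0)(0 := n)" "rreg (input G w \<epsilon> \<rho>) = (\<lambda>_. 0)(0 := \<epsilon>, 1 := \<rho>)"
  "pc (input G w \<epsilon> \<rho>) = 0"
  by (simp_all add: input_def Let_def verts)

lemma input_mem:
  "v < n \<Longrightarrow> nmem (input G w \<epsilon> \<rho>) (v + u * n) = (if (u, v) \<in> parcs G then 1 else 0)"
  "v < n \<Longrightarrow> (u, v) \<in> parcs G \<Longrightarrow> rmem (input G w \<epsilon> \<rho>) (v + u * n) = w (u, v)"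
  by (simp_all add: input_def Let_def verts)

definition "scale = nreg st1 6"
definition "swap_size = K * (scale * scale)"

lemma st1_regs:
  "nreg st1 0 = n" "nreg st1 2 = 0" "nreg st1 3 = 1" "nreg st1 4 = n * n" "nreg st1 5 = Suc n"
  "nreg st1 7 = K" "nreg st1 8 = 0" "nreg st1 10 = 0" "nreg st1 21 = 0"
  "rreg st1 2 = \<rho>" "rreg st1 3 = \<rho> + 1" "rreg st1 5 = 0"
  and scale: "scale \<le> n" "scale = n \<or> 1 \<le> real scale * \<epsilon>" "scale = 0 \<or> (real scale - 1) * \<epsilon> < 1"
proof -
  define s where "s = set_nreg 20 n (set_nreg 4 (n * n)
    ((set_nreg 5 (Suc n) (set_nreg 7 K st0))\<lparr>rreg := (rreg st0)(4 := 1, 2 := \<rho>, 3 := \<rho> + 1)\<rparr>))"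
  have st1: "st1 = sem invert s"
    by (simp add: st1_def st0_def setup_base_def sem_eqs exec_eqs sem_add_loop input_regs s_def set_nreg_def)
  have w: "writes invert = {6, 20}" "rwrites invert = {6}" by (auto simp: invert_def)
  show "nreg st1 0 = n" "nreg st1 2 = 0" "nreg st1 3 = 1" "nreg st1 4 = n * n" "nreg st1 5 = Suc n"
    "nreg st1 7 = K" "nreg st1 8 = 0" "nreg st1 10 = 0" "nreg st1 21 = 0"
    "rreg st1 2 = \<rho>" "rreg st1 3 = \<rho> + 1" "rreg st1 5 = 0"
    unfolding st1 by (simp_all add: sem_writes sem_rwrites w) (simp_all add: s_def st0_def input_regs)
  have "nreg s 3 = 1" "nreg s 6 = 0" "rreg s 4 = 1" "rreg s 6 = 0" "nreg s 0 = n" "rreg s 0 = \<epsilon>"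
    by (simp_all add: s_def st0_def input_regs)
  then show "scale \<le> n" "scale = n \<or> 1 \<le> real scale * \<epsilon>" "scale = 0 \<or> (real scale - 1) * \<epsilon> < 1"
    unfolding scale_def st1 using sem_invert[of s] by auto
qed

lemma st2_eq: "st2 = set_nreg 20 K (set_nreg 8 swap_size (set_nreg 20 scale (set_nreg 21 (scale * scale) st1)))"
  using st1_regs by (simp add: st2_def setup_swap_size_def sem_eqs sem_add_loop scale_def[symmetric] swap_size_def)

lemma st2_regs:
  "nreg st2 0 = n" "nreg st2 2 = 0" "nreg st2 3 = 1" "nreg st2 4 = n * n" "nreg st2 5 = Suc n"
  "nreg st2 8 = swap_size" "nreg st2 10 = 0"
  "rreg st2 2 = \<rho>" "rreg st2 3 = \<rho> + 1" "rreg st2 5 = 0"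
  unfolding st2_eq using st1_regs by simp_all

lemma st3_regs:
  "nreg st3 0 = n" "nreg st3 2 = 0" "nreg st3 3 = 1" "nreg st3 4 = n * n" "nreg st3 5 = Suc n"
  "nreg st3 8 = swap_size" "nreg st3 9 = Suc n ^ swap_size" "nreg st3 10 = 0"
  "rreg st3 2 = \<rho>" "rreg st3 3 = \<rho> + 1" "rreg st3 5 = 0"
  using sem_setup_power[of st2] st2_regs
  by (simp_all add: st3_def sem_writes sem_rwrites program_frames memory_frames)

lemma st3_mem: "nmem st3 = nmem (input G w \<epsilon> \<rho>)" "rmem st3 = rmem (input G w \<epsilon> \<rho>)"
  by (simp_all add: st3_def st2_def st1_def st0_def sem_no_nstore sem_no_rstore memory_frames)

lemma final_set:
  "\<exists>L. (\<forall>v<n. nmem (sem (main_com K) st0) v = of_bool (v \<in> L)) \<and> metric_independent G w \<rho> L \<and>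
    (\<forall>A R. A \<subseteq> pverts G \<longrightarrow> A \<inter> L = {} \<longrightarrow> R \<subseteq> L \<longrightarrow> card A + card R \<le> swap_size \<longrightarrow>
      metric_independent G w \<rho> (L - R \<union> A) \<longrightarrow> card A \<le> card R)"
proof -
  interpret S: search_spec n swap_size \<rho> "capped_dist (\<rho> + 1)" .
  have "loaded st3"
    using st3_regs input_mem by (simp add: loaded_def st3_mem)
  note dist = distances_correct[OF this]
  let ?s = "sem distances st3"
  have ready: "S.ready ?s"
    unfolding S.ready_def using st3_regs dist(2)
    by (simp add: sem_writes sem_rwrites memory_frames D_def)
  \<comment> \<open>From address n * n on, the input memory would describe row n, which is not a
    vertex. Hence the cells are 0 and the search starts from the empty set.\<close>
  have out: "nmem (input G w \<epsilon> \<rho>) (n * n + v) = 0" if "v < n" for v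
  proof -
    have "(n, v) \<notin> parcs G" using wellformed'(1)[of n v] verts by auto
    then show ?thesis using input_mem(1)[OF that, of n] by (simp add: add.commute)
  qed
  have "S.current {} ?s"
    using ready st3_regs(8) out
    by (simp add: S.current_def S.holds_def sem_no_nstore memory_frames st3_mem sem_writes)
  then obtain L where L: "S.current L (sem search ?s)" "S.spread L" "S.locally_optimal L"
    using S.search_correct[of "{}" ?s] by (auto simp: S.spread_def[of "{}"])
  have Ln: "L \<subseteq> {..<n}" using L(1) by (simp add: S.current_def S.holds_def)
  have indep: "metric_independent G w \<rho> A \<longleftrightarrow> A \<subseteq> {..<n} \<and> S.spread A" for A
  proof -
    have eq: "ereal \<rho> < graph_dist G w x y \<longleftrightarrow> \<rho> < capped_dist (\<rho> + 1) x y" for x y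
      using capped_dist_le_iff[of \<rho> "\<rho> + 1" x y] by (simp add: graph_dist_def not_le[symmetric])
    show ?thesis
      unfolding metric_independent_def S.spread_def eq verts
      using capped_dist_sym[of "\<rho> + 1"] by (metis linorder_neqE_nat less_irrefl)
  qed
  have "sem (main_com K) st0 = sem copy_out (sem search ?s)"
    by (simp add: main_com_def local_search_def sem_eqs st1_def st2_def st3_def)
  then have "\<forall>v<n. nmem (sem (main_com K) st0) v = of_bool (v \<in> L)"
    using S.copy_out_correct L(1) by (simp add: S.current_def)
  moreover have "metric_independent G w \<rho> L" using indep Ln L(2) by simp
  moreover have "card A \<le> card R"
    if "A \<subseteq> pverts G" "A \<inter> L = {}" "R \<subseteq> L" "card A + card R \<le> swap_size"
      "metric_independent G w \<rho> (L - R \<union> A)" for A R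
    using that Ln indep verts by (intro S.locally_optimal_exchange[OF L(3)]) auto
  ultimately show ?thesis by blast
qed

text \<open>From (scale - 1) * \<epsilon> < 1 and \<epsilon> < 1/2 follows scale * \<epsilon> \<le>
  3/2, whose square 9/4 is rounded up to 3.\<close>

lemma swap_size_le: "real swap_size \<le> 3 * real K / \<epsilon>\<^sup>2"
proof -
  have "real scale * \<epsilon> \<le> 3 / 2" using scale(3) \<epsilon> by (auto simp: algebra_simps)
  then have "(real scale * \<epsilon>)\<^sup>2 \<le> (3 / 2)\<^sup>2" using \<epsilon> by (intro power_mono) auto
  then have "(real scale)\<^sup>2 * \<epsilon>\<^sup>2 \<le> 3" by (simp add: power_mult_distrib power_divide)
  then have "real K * ((real scale)\<^sup>2 * \<epsilon>\<^sup>2) \<le> real K * 3" by (intro mult_left_mono) auto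
  then show ?thesis using \<epsilon> by (simp add: swap_size_def field_simps power2_eq_square)
qed

text \<open>The base is at least 2 so that powers also dominate constants when n is 0 or 1. As n + 1
  is at most its square, the number of swaps accounts for 2 * swap_size; \<open>K\<close> and 2
  cover the other bounds.\<close>

definition "run_bound = max 2 n ^ (2 * swap_size + K + 2)"

lemma loop_bounds:
  "n \<le> run_bound" "n * n \<le> run_bound" "scale \<le> run_bound" "K \<le> run_bound" "Suc n \<le> run_bound"
  "swap_size \<le> run_bound" "Suc n ^ swap_size \<le> run_bound"
proof -
  let ?B = "max 2 n" and ?e = "2 * swap_size + K + 2"
  have mono: "x \<le> run_bound" if "x \<le> ?B ^ j" "j \<le> ?e" for x j
    unfolding run_bound_def using that power_increasing[of j ?e ?B] by linarith
  have lin: "j \<le> ?B ^ j" for j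
  proof -
    have "j \<le> 2 ^ j" by (simp add: less_imp_le)
    also have "(2::nat) ^ j \<le> ?B ^ j" by (intro power_mono) auto
    finally show ?thesis .
  qed
  have sq: "n * n \<le> ?B ^ 2" "Suc n \<le> ?B ^ 2"
  proof -
    show "n * n \<le> ?B ^ 2" unfolding power2_eq_square by (intro mult_le_mono) auto
    have "Suc n \<le> 2 * ?B" by auto
    also have "\<dots> \<le> ?B ^ 2" unfolding power2_eq_square by (intro mult_le_mono1) auto
    finally show "Suc n \<le> ?B ^ 2" .
  qed
  show "n * n \<le> run_bound" "Suc n \<le> run_bound" using mono[of _ 2] sq by auto
  then show "n \<le> run_bound" "scale \<le> run_bound" using scale(1) by linarith+
  show "K \<le> run_bound" "swap_size \<le> run_bound" using mono[OF lin] by auto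
  have "Suc n ^ swap_size \<le> (?B ^ 2) ^ swap_size" using sq(2) by (intro power_mono) auto
  also have "\<dots> = ?B ^ (2 * swap_size)" by (simp add: power_mult)
  finally show "Suc n ^ swap_size \<le> run_bound" by (rule mono) simp
qed

text \<open>The four phases run separately because each setup phase writes loop bounds of later
  phases, and \<open>compile_correct\<close> demands that a command leave its own bounds
  alone.\<close>

lemma main_program_run:
  "reaches (main_program K) (Suc (time_bound (main_com K) run_bound)) (input G w \<epsilon> \<rho>)
    ((sem (main_com K) st0)\<lparr>pc := length (main_program K)\<rparr>)"
proof -
  let ?P = "main_program K" and ?N = run_bound
  let ?l1 = "1 + code_size (setup_base K)" let ?l2 = "?l1 + code_size setup_swap_size"
  let ?l3 = "?l2 + code_size setup_power" let ?l4 = "?l3 + code_size local_search"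
  have "code_at ?P 0 (NConst 3 1 # compile 1 (main_com K))"
    unfolding code_at_def main_program_def by (intro exI[of _ "[]"]) simp
  note a0 = code_at_Cons[OF this]
  note a1 = code_at_append[OF a0(3)[unfolded main_com_def compile.simps], unfolded length_compile]
  note a2 = code_at_append[OF a1(2), unfolded length_compile]
  note a3 = code_at_append[OF a2(2), unfolded length_compile]
  have first: "step ?P (input G w \<epsilon> \<rho>) = st0\<lparr>pc := 1\<rparr>"
    using a0(1,2) by (simp add: step_def halted_def input_regs exec_eqs st0_def set_nreg_def)
  have st0: "nreg st0 0 = n" "nreg st0 2 = 0" "nreg st0 3 = 1"
    by (simp_all add: st0_def input_regs)
  have r1: "reaches ?P (time_bound (setup_base K) ?N) (st0\<lparr>pc := 1\<rparr>) (st1\<lparr>pc := ?l1\<rparr>)"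
    using compile_correct[of "setup_base K" ?P 1 "st0\<lparr>pc := 1\<rparr>" ?N] a1(1) loop_bounds
    by (simp add: program_frames st0 sem_pc st1_def)
  have r2: "reaches ?P (time_bound setup_swap_size ?N) (st1\<lparr>pc := ?l1\<rparr>) (st2\<lparr>pc := ?l2\<rparr>)"
    using compile_correct[of setup_swap_size ?P ?l1 "st1\<lparr>pc := ?l1\<rparr>" ?N] a2(1) loop_bounds st1_regs
    by (simp add: program_frames sem_pc scale_def st2_def)
  have r3: "reaches ?P (time_bound setup_power ?N) (st2\<lparr>pc := ?l2\<rparr>) (st3\<lparr>pc := ?l3\<rparr>)"
    using compile_correct[of setup_power ?P ?l2 "st2\<lparr>pc := ?l2\<rparr>" ?N] a3(1) loop_bounds st2_regs
    by (simp add: program_frames sem_pc st3_def)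
  have r4: "reaches ?P (time_bound local_search ?N) (st3\<lparr>pc := ?l3\<rparr>) ((sem local_search st3)\<lparr>pc := ?l4\<rparr>)"
    using compile_correct[of local_search ?P ?l3 "st3\<lparr>pc := ?l3\<rparr>" ?N] a3(2) loop_bounds st3_regs
    by (simp add: program_frames sem_pc)
  have "length ?P = ?l4"
    by (simp add: main_program_def length_compile main_com_def)
  then show ?thesis
    using reaches_step[OF first reaches_trans[OF r1 reaches_trans[OF r2 reaches_trans[OF r3 r4]]]]
    by (simp add: main_com_def sem_eqs st1_def st2_def st3_def)
qed

text \<open>The sum 7 * K + 3 collects twice the swap size, at most 6 * K / \<epsilon>^2, and the K
  + 3 left over in the exponent of run_bound + 1. Only \<open>K\<close> enters.\<close>

definition "time_exponent = code_size (main_com K) + 1 + (7 * K + 3) * loop_depth (main_com K)"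

lemma run_time:
  "real (Suc (time_bound (main_com K) run_bound)) \<le> real (max 2 n) powr (real time_exponent / \<epsilon>\<^sup>2)"
proof -
  let ?B = "max 2 n" and ?z = "code_size (main_com K)" and ?d = "loop_depth (main_com K)"
  let ?e = "2 * swap_size + K + 2"
  have B1: "1 \<le> ?B" by simp
  have "run_bound + 1 \<le> 2 * ?B ^ ?e" unfolding run_bound_def using one_le_power[OF B1] by simp
  also have "\<dots> \<le> ?B ^ Suc ?e" by (simp only: power_Suc) (intro mult_le_mono1, simp)
  finally have N: "run_bound + 1 \<le> ?B ^ Suc ?e" .
  have "Suc (time_bound (main_com K) run_bound) \<le> Suc (?z * (run_bound + 1) ^ ?d)"
    using time_bound_poly by simp
  also have "\<dots> \<le> Suc ?z * (run_bound + 1) ^ ?d" by simp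
  also have "\<dots> \<le> ?B ^ Suc ?z * (?B ^ Suc ?e) ^ ?d"
  proof (rule mult_le_mono)
    have "Suc ?z \<le> 2 ^ Suc ?z" by (meson less_exp less_imp_le)
    also have "(2::nat) ^ Suc ?z \<le> ?B ^ Suc ?z" by (intro power_mono) auto
    finally show "Suc ?z \<le> ?B ^ Suc ?z" .
    show "(run_bound + 1) ^ ?d \<le> (?B ^ Suc ?e) ^ ?d" using N by (intro power_mono) auto
  qed
  also have "\<dots> = ?B ^ (Suc ?z + Suc ?e * ?d)" by (simp only: power_add power_mult)
  finally have "real (Suc (time_bound (main_com K) run_bound)) \<le> real (?B ^ (Suc ?z + Suc ?e * ?d))"
    by (simp only: of_nat_le_iff)
  also have "\<dots> = real ?B powr real (Suc ?z + Suc ?e * ?d)"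
    unfolding of_nat_power by (rule powr_realpow[symmetric]) simp
  also have "\<dots> \<le> real ?B powr (real time_exponent / \<epsilon>\<^sup>2)"
  proof (rule powr_mono)
    have "\<epsilon>\<^sup>2 \<le> 1" using \<epsilon> by (simp add: power_le_one)
    then have inv: "1 \<le> 1 / \<epsilon>\<^sup>2" using \<epsilon> by simp
    \<comment> \<open>Since 1 / \<epsilon>^2 is at least 1, additive constants in the exponent can
      be absorbed.\<close>
    have grow: "x \<le> x / \<epsilon>\<^sup>2" if "0 \<le> x" for x :: real
      using mult_left_mono[OF inv that] by simp
    have "real (Suc ?e) = 2 * real swap_size + (real K + 3)" by simp
    also have "\<dots> \<le> 2 * (3 * real K / \<epsilon>\<^sup>2) + (real K + 3) / \<epsilon>\<^sup>2"
      using swap_size_le grow[of "real K + 3"] by linarith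
    also have "\<dots> = (7 * real K + 3) / \<epsilon>\<^sup>2" by (simp add: add_divide_distrib[symmetric])
    finally have "real (Suc ?e) * real ?d \<le> (7 * real K + 3) / \<epsilon>\<^sup>2 * real ?d"
      by (intro mult_right_mono) auto
    then have "real (Suc ?z + Suc ?e * ?d) \<le> real (Suc ?z) / \<epsilon>\<^sup>2 + (7 * real K + 3) / \<epsilon>\<^sup>2 * real ?d"
      using grow[of "real (Suc ?z)"] by (simp only: of_nat_add of_nat_mult) linarith
    also have "\<dots> = real time_exponent / \<epsilon>\<^sup>2" by (simp add: time_exponent_def add_divide_distrib ring_distribs)
    finally show "real (Suc ?z + Suc ?e * ?d) \<le> real time_exponent / \<epsilon>\<^sup>2" .
  qed simp
  finally show ?thesis .
qed

text \<open>The division is used with \<gamma> = \<epsilon> / 2. The square of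
  \<open>sep_const h\<close> is 4 * h^3, and halving \<epsilon> costs another factor 4, whence 1728
  = 108 * 4 * 4.\<close>

lemma approximation_ratio:
  assumes free: "clique_minor_free (parcs G) (pverts G) h" and h: "0 < h" and K: "K = 1728 * h ^ 3"
    and L: "metric_independent G w \<rho> L"
    and opt: "\<And>A R. A \<subseteq> pverts G \<Longrightarrow> A \<inter> L = {} \<Longrightarrow> R \<subseteq> L \<Longrightarrow> card A + card R \<le> swap_size \<Longrightarrow>
      metric_independent G w \<rho> (L - R \<union> A) \<Longrightarrow> card A \<le> card R"
    and O': "metric_independent G w \<rho> O'"
  shows "(1 - \<epsilon>) * real (card O') \<le> real (card L)"
proof -
  have Ln: "L \<subseteq> {..<n}" and On: "O' \<subseteq> {..<n}"
    using L O' verts by (auto simp: metric_independent_def)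
  have fin: "finite L" "finite O'" using Ln On by (auto intro: finite_subset)
  from scale(2) show ?thesis
  proof
    \<comment> \<open>Here \<epsilon> is small compared with 1 / n. Replacing L by O' altogether is
      one of the swaps, so L is a true maximum.\<close>
    assume "scale = n"
    have K1: "1 \<le> K" using h K by simp
    have "card (O' - L) + card (L - O') = card ((O' - L) \<union> (L - O'))"
      using fin by (intro card_Un_disjoint[symmetric]) auto
    also have "\<dots> \<le> card {..<n}" using Ln On by (intro card_mono) auto
    also have "\<dots> \<le> n * n" by (simp add: le_square)
    also have "\<dots> \<le> K * (n * n)" using mult_le_mono1[OF K1, of "n * n"] by simp
    finally have "card (O' - L) + card (L - O') \<le> swap_size"
      using \<open>scale = n\<close> by (simp add: swap_size_def)
    moreover have "L - (L - O') \<union> (O' - L) = O'" by auto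
    ultimately have "card (O' - L) \<le> card (L - O')" using O' On verts by (intro opt) auto
    then have "card O' \<le> card L"
      using fin card_Int_Diff[of O' L] card_Int_Diff[of L O'] by (simp add: Int_commute)
    then have "real (card O') \<le> real (card L)" by simp
    moreover have "(1 - \<epsilon>) * real (card O') \<le> 1 * real (card O')"
      using \<epsilon> by (intro mult_right_mono) auto
    ultimately show ?thesis by linarith
  next
    assume "1 \<le> real scale * \<epsilon>"
    then have "1 * 1 \<le> (real scale * \<epsilon>) * (real scale * \<epsilon>)" by (intro mult_mono) auto
    then have "real K * 1 \<le> real K * ((real scale * \<epsilon>) * (real scale * \<epsilon>))"
      by (intro mult_left_mono) auto
    also have "\<dots> = 4 * ((\<epsilon> / 2)\<^sup>2 * real swap_size)"
      by (simp add: swap_size_def power2_eq_square)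
    finally have "real K \<le> 4 * ((\<epsilon> / 2)\<^sup>2 * real swap_size)" by simp
    moreover have "(sep_const h)\<^sup>2 = 4 * real (h ^ 3)"
      by (simp add: sep_const_def power_mult_distrib power2_eq_square power3_eq_cube)
    ultimately have r: "108 * (sep_const h)\<^sup>2 \<le> (\<epsilon> / 2)\<^sup>2 * real swap_size"
      by (simp add: K)
    have "(1 - \<epsilon> / 2) * real (card O') \<le> (1 + \<epsilon> / 2) * real (card L)"
    proof (rule metric_local_optimum_ratio[OF G \<rho> free h _ _ r L O'])
      fix A R assume *: "A \<subseteq> O' - L" "R \<subseteq> L - O'" "card A + card R \<le> swap_size"
        "metric_independent G w \<rho> (L - R \<union> A)"
      show "card A \<le> card R" using * On verts by (intro opt) auto
    qed (use \<epsilon> in auto)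
    \<comment> \<open>The difference of the two sides is \<epsilon>^2 / 2; this turns the ratio for
      \<gamma> = \<epsilon> / 2 into 1 - \<epsilon>.\<close>
    moreover have "(1 + \<epsilon> / 2) * (1 - \<epsilon>) \<le> 1 - \<epsilon> / 2"
      using \<epsilon> by (simp add: algebra_simps)
    then have "(1 + \<epsilon> / 2) * (1 - \<epsilon>) * real (card O') \<le> (1 - \<epsilon> / 2) * real (card O')"
      by (intro mult_right_mono) auto
    ultimately have "(1 + \<epsilon> / 2) * ((1 - \<epsilon>) * real (card O')) \<le> (1 + \<epsilon> / 2) * real (card L)"
      by (simp add: mult.assoc)
    then show ?thesis using \<epsilon> by simp
  qed
qed

end

theorem theorem18:
  shows "\<exists>C :: nat \<Rightarrow> real. \<forall>H :: nat pair_pre_digraph. pair_graph H \<longrightarrow>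
    (\<exists>P :: program. \<forall>(G :: nat pair_pre_digraph) (w :: (nat \<times> nat) weight_fun) n \<epsilon> \<rho>.
       weighted_graph G w \<longrightarrow> pverts G = {..<n} \<longrightarrow> minor_free H G \<longrightarrow>
       0 < \<epsilon> \<longrightarrow> \<epsilon> < 1 / 2 \<longrightarrow> 0 < \<rho> \<longrightarrow>
       (\<exists>S. computes_within P G (input G w \<epsilon> \<rho>)
              (real (max 2 n) powr (C (card (pverts H)) / \<epsilon>\<^sup>2)) S \<and>
            metric_independent G w \<rho> S \<and>
            (\<forall>S'. metric_independent G w \<rho> S' \<longrightarrow>
               real (card S) \<ge> (1 - \<epsilon>) * real (card S'))))"
proof (intro exI[of _ "\<lambda>h. real (time_exponent (1728 * h ^ 3))"] allI impI)
  fix H :: "nat pair_pre_digraph"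
  assume H: "pair_graph H"
  define h where "h = card (pverts H)"
  define K where "K = 1728 * h ^ 3"
  show "\<exists>P. \<forall>G w n \<epsilon> \<rho>. weighted_graph G w \<longrightarrow> pverts G = {..<n} \<longrightarrow> minor_free H G \<longrightarrow>
       0 < \<epsilon> \<longrightarrow> \<epsilon> < 1 / 2 \<longrightarrow> 0 < \<rho> \<longrightarrow>
       (\<exists>S. computes_within P G (input G w \<epsilon> \<rho>)
              (real (max 2 n) powr (real (time_exponent (1728 * card (pverts H) ^ 3)) / \<epsilon>\<^sup>2)) S \<and>
            metric_independent G w \<rho> S \<and>
            (\<forall>S'. metric_independent G w \<rho> S' \<longrightarrow> (1 - \<epsilon>) * real (card S') \<le> real (card S)))"
  proof (intro exI[of _ "main_program K"] allI impI)
    fix G :: "nat pair_pre_digraph" and w :: "(nat \<times> nat) weight_fun" and n and \<epsilon> \<rho> :: real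
    assume G: "weighted_graph G w" "pverts G = {..<n}" and free: "minor_free H G"
      and \<epsilon>: "0 < \<epsilon>" "\<epsilon> < 1 / 2" and \<rho>: "0 < \<rho>"
    have h: "0 < h" unfolding h_def using H free by (rule minor_free_nonempty)
    have cfree: "clique_minor_free (parcs G) (pverts G) h"
      unfolding h_def using H _ free by (rule clique_minor_free_if_minor_free) (use G(1) in \<open>simp add: weighted_graph_def\<close>)
    note inst = G \<epsilon> \<rho>
    let ?s = "(sem (main_com K) (st0 G w \<epsilon> \<rho>))\<lparr>pc := length (main_program K)\<rparr>"
    obtain L where L: "\<forall>v<n. nmem (sem (main_com K) (st0 G w \<epsilon> \<rho>)) v = of_bool (v \<in> L)" "metric_independent G w \<rho> L"
      "\<And>A R. A \<subseteq> pverts G \<Longrightarrow> A \<inter> L = {} \<Longrightarrow> R \<subseteq> L \<Longrightarrow> card A + card R \<le> swap_size G w K \<epsilon> \<rho> \<Longrightarrow>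
        metric_independent G w \<rho> (L - R \<union> A) \<Longrightarrow> card A \<le> card R"
      using final_set[OF inst, of K] by blast
    obtain t where t: "t \<le> Suc (time_bound (main_com K) (run_bound G w n K \<epsilon> \<rho>))"
      "(step (main_program K) ^^ t) (input G w \<epsilon> \<rho>) = ?s"
      using main_program_run[OF inst, of K] by (auto simp: reaches_def)
    have "real t \<le> real (max 2 n) powr (real (time_exponent K) / \<epsilon>\<^sup>2)"
      using run_time[OF inst, of K] t(1) by linarith
    moreover have "L = output_set G ?s"
      using L(1,2) G(2) by (auto simp: output_set_def metric_independent_def)
    moreover have "halted (main_program K) ?s" by (simp add: halted_def)
    ultimately have "computes_within (main_program K) G (input G w \<epsilon> \<rho>)
        (real (max 2 n) powr (real (time_exponent K) / \<epsilon>\<^sup>2)) L"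
      unfolding computes_within_def using t(2) by metis
    moreover have "\<forall>S'. metric_independent G w \<rho> S' \<longrightarrow> (1 - \<epsilon>) * real (card S') \<le> real (card L)"
      using approximation_ratio[OF inst cfree h K_def L(2,3)] by blast
    ultimately show "\<exists>S. computes_within (main_program K) G (input G w \<epsilon> \<rho>)
        (real (max 2 n) powr (real (time_exponent (1728 * card (pverts H) ^ 3)) / \<epsilon>\<^sup>2)) S \<and>
      metric_independent G w \<rho> S \<and>
      (\<forall>S'. metric_independent G w \<rho> S' \<longrightarrow> (1 - \<epsilon>) * real (card S') \<le> real (card S))"
      using L(2) unfolding K_def h_def by blast
  qed
qed

end
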